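(* Let $\Omega\subset\mathbb{R}^n$, $n\ge 2$, be open and bounded, and let $s,t,p,q,\Lambda,K_{sp},K_{tq},a$ satisfy the structural assumptions (A1)–(A5) listed in the context. Assume moreover that $$\alpha<tq\le sp+\alpha\ \text{ if } s\le t,\qquad tq\le sp\ \text{ if } s>t.$$ Let $u\in\mathcal{A}(\Omega)\cap L^{p-1}_{sp}(\mathbb{R}^n)\cap L^{q-1}_{a,tq}(\Omega,\mathbb{R}^n)$ be a (local) minimizer in $\Omega$ of $$\mathcal{F}(u;\Omega)=\iint_{\mathcal{C}_\Omega}\left(|u(x)-u(y)|^pK_{sp}(x,y)+a(x,y)|u(x)-u(y)|^qK_{tq}(x,y)\right)dx\,dy .$$ Let $0<R\le1$, and suppose that $B_{2R}(x_0)\Subset\Omega$ and $u\ge0$ a.e. in $B_{2R}(x_0)$. Then there exists a constant $C\ge1$, depending only on $\mathfrak{D}_u(B_{2R}(x_0))$, such that $$\sup_{B_{R/4}(x_0)}u\le C\left[\inf_{B_{R/4}(x_0)}u+(h_{2R})^{-1}\bigl(\mathcal{T}_{R/4,2R}(|u|;x_0)\bigr)\right].$$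
   Context: Structural assumptions. (A1) $0<s,t<1$ and $1<p\le q<\infty$. (A2) $K_{sp},K_{tq}:\mathbb{R}^n\times\mathbb{R}^n\to\mathbb{R}$ are symmetric measurable kernels with, for some $\Lambda\ge1$, $\Lambda^{-1}|x-y|^{-n-sp}\le K_{sp}(x,y)\le\Lambda|x-y|^{-n-sp}$ and $\Lambda^{-1}|x-y|^{-n-tq}\le K_{tq}(x,y)\le\Lambda|x-y|^{-n-tq}$. (A3) $a:\mathbb{R}^n\times\mathbb{R}^n\to[0,\infty)$ is measurable, $a\in L^\infty_{\rm loc}(\Omega\times\Omega)$, and $a(x,y)=a(y,x)$ for a.e. $(x,y)$. (A4) If $s\le t$: there are $\alpha\in(0,1]$ and $[a]_\alpha<\infty$ with $|a(x_1,y_1)-a(x_2,y_2)|\le[a]_\alpha(|x_1-x_2|+|y_1-y_2|)^\alpha$ on $\mathbb{R}^n\times\mathbb{R}^n$. If $s>t$: $|a(x,y)|\le\|a\|_{L^\infty}<\infty$ on $\mathbb{R}^n\times\mathbb{R}^n$. (A5) $q\le\frac{np}{n-sp}$ if $sp<n$; $p\le q<\infty$ if $sp\ge n$. Domain of integration: $\mathcal{C}_\Omega=(\mathbb{R}^n\times\mathbb{R}^n)\setminus\bigl((\mathbb{R}^n\setminus\Omega)\times(\mathbb{R}^n\setminus\Omega)\bigr)$. Function spaces. $\mathcal{A}(\Omega)$ is the set of $u:\mathbb{R}^n\to\mathbb{R}$ with $u|_\Omega\in L^p(\Omega)$ and $\iint_{\mathcal{C}_\Omega}\left(\frac{|u(x)-u(y)|^p}{|x-y|^{n+sp}}+a(x,y)\frac{|u(x)-u(y)|^q}{|x-y|^{n+tq}}\right)dx\,dy<\infty$.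 $L^{p-1}_{sp}(\mathbb{R}^n)$ is the set of $u:\mathbb{R}^n\to\mathbb{R}$ with $\int_{\mathbb{R}^n}\frac{|u(x)|^{p-1}}{(1+|x|)^{n+sp}}dx<\infty$. $L^{q-1}_{a,tq}(\Omega,\mathbb{R}^n)$ is the set of $u:\mathbb{R}^n\to\mathbb{R}$ with $\sup_{x\in\Omega}\int_{\mathbb{R}^n}a(x,y)\frac{|u(y)|^{q-1}}{(1+|y|)^{n+tq}}dy<\infty$. Minimizer: $u\in\mathcal{A}(\Omega)$ is a (local) minimizer of $\mathcal{F}$ in $\Omega$ if $\mathcal{F}(u;\Omega)\le\mathcal{F}(v;\Omega)$ for every $v\in\mathcal{A}(\Omega)$ with $v=u$ a.e. in $\mathbb{R}^n\setminus\Omega$. Notation. $\sup$ and $\inf$ of $u$ on a set are essential. For a fixed center $x_0$ and $r>0$, $a_r^-:=\inf_{B_r(x_0)\times B_r(x_0)}a(x,y)$ and, for $\tau\ge0$, $h_r(\tau):=\frac{\tau^{p-1}}{r^{sp}}+a_r^-\frac{\tau^{q-1}}{r^{tq}}$; $(h_r)^{-1}$ is its inverse on $[0,\infty)$. The two-radius tail is $$\mathcal{T}_{r,R}(v;x_0):=\int_{\mathbb{R}^n\setminus B_r(x_0)}\frac{|v(y)|^{p-1}}{|y-x_0|^{n+sp}}dy+\sup_{x\in B_R(x_0)}\int_{\mathbb{R}^n\setminus B_r(x_0)}a(x,y)\frac{|v(y)|^{q-1}}{|y-x_0|^{n+tq}}dy.$$ Data. For $E\subset\Omega$, $\mathfrak{D}_u(E)$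 is the list consisting of: $n,p,q,s,t,\Lambda$; together with $\alpha,[a]_\alpha$ if $s\le t$, or $\|a\|_{L^\infty}$ if $s>t$; together with $\|u\|_{L^\infty(E)}$ if $sp\le n$, or $[u]_{W^{s,p}(E)}:=\left(\int_E\int_E\frac{|u(x)-u(y)|^p}{|x-y|^{n+sp}}dx\,dy\right)^{1/p}$ if $sp>n$. Under the assumptions $u$ is known to be locally bounded in $\Omega$. *)

theory Defs
  imports "HOL-Analysis.Analysis" "HOL-Probability.Essential_Supremum"
begin

text \<open>
  Conventions. Measurability and integration on \<open>\<real>\<^sup>n\<close> and on \<open>\<real>\<^sup>n \<times> \<real>\<^sup>n\<close> refer to Lebesgue
  measure. All integrands below are nonnegative, so integrals are taken in \<open>[0, \<infinity>]\<close> via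
  \<^const>\<open>nn_integral\<close>, and a quantity being finite is stated as being \<open>< \<infinity>\<close>. Powers with real
  exponent are \<^const>\<open>powr\<close>; here \<open>0 powr b = 0\<close> and \<open>0 / 0 = 0\<close>, so the difference quotients
  vanish on the (null) diagonal.
\<close>


section \<open>Structural assumptions\<close>

text \<open>The bounds are required off the diagonal only: at \<open>x = y\<close> the expression
  \<open>|x - y|\<^sup>-\<^sup>b\<close> is infinite and the value of the real-valued kernel is irrelevant.\<close>

definition comparable_kernel :: "real \<Rightarrow> real \<Rightarrow> (real^'n \<Rightarrow> real^'n \<Rightarrow> real) \<Rightarrow> bool" where
  "comparable_kernel \<Lambda> \<sigma> K \<longleftrightarrow>
     (\<lambda>(x, y). K x y) \<in> borel_measurable lebesgue \<and>
     (\<forall>x y. K x y = K y x) \<and>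
     (\<forall>x y. x \<noteq> y \<longrightarrow>
        inverse \<Lambda> * norm (x - y) powr (- (real CARD('n) + \<sigma>)) \<le> K x y \<and>
        K x y \<le> \<Lambda> * norm (x - y) powr (- (real CARD('n) + \<sigma>)))"

definition Linf_norm :: "'a::euclidean_space set \<Rightarrow> ('a \<Rightarrow> real) \<Rightarrow> ennreal" where
  "Linf_norm E f = esssup (restrict_space lebesgue E) (\<lambda>x. ennreal \<bar>f x\<bar>)"

definition Linf_loc :: "'a::euclidean_space set \<Rightarrow> ('a \<Rightarrow> real) \<Rightarrow> bool" where
  "Linf_loc S f \<longleftrightarrow> (\<forall>K. compact K \<and> K \<subseteq> S \<longrightarrow> Linf_norm K f < \<infinity>)"

definition coefficient :: "(real^'n) set \<Rightarrow> (real^'n \<Rightarrow> real^'n \<Rightarrow> real) \<Rightarrow> bool" where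
  "coefficient \<Omega> a \<longleftrightarrow>
     (\<lambda>(x, y). a x y) \<in> borel_measurable lebesgue \<and>
     (\<forall>x y. 0 \<le> a x y) \<and>
     Linf_loc (\<Omega> \<times> \<Omega>) (\<lambda>(x, y). a x y) \<and>
     (AE (x, y) in lebesgue. a x y = a y x)"

text \<open>The number \<open>A\<close> is the Hoelder constant \<open>[a]\<^sub>\<alpha>\<close> if \<open>s \<le> t\<close> and the norm of \<open>a\<close> in
  \<open>L\<^sup>\<infinity>\<close> if \<open>s > t\<close>; in the latter case \<open>\<alpha>\<close> plays no role.\<close>

definition coefficient_regularity ::
    "real \<Rightarrow> real \<Rightarrow> real \<Rightarrow> real \<Rightarrow> (real^'n \<Rightarrow> real^'n \<Rightarrow> real) \<Rightarrow> bool" where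
  "coefficient_regularity s t \<alpha> A a \<longleftrightarrow>
     (if s \<le> t then
        (\<forall>x1 y1 x2 y2. \<bar>a x1 y1 - a x2 y2\<bar> \<le> A * (norm (x1 - x2) + norm (y1 - y2)) powr \<alpha>)
      else
        Linf_norm UNIV (\<lambda>(x, y). a x y) = ennreal A \<and> (\<forall>x y. \<bar>a x y\<bar> \<le> A))"


section \<open>Function spaces and minimizers\<close>

definition C_dom :: "(real^'n) set \<Rightarrow> ((real^'n) \<times> (real^'n)) set" where
  "C_dom \<Omega> = UNIV - (UNIV - \<Omega>) \<times> (UNIV - \<Omega>)"

definition A_space ::
    "real \<Rightarrow> real \<Rightarrow> real \<Rightarrow> real \<Rightarrow> (real^'n \<Rightarrow> real^'n \<Rightarrow> real) \<Rightarrow> (real^'n) set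
      \<Rightarrow> (real^'n \<Rightarrow> real) set" where
  "A_space s t p q a \<Omega> = {u. u \<in> borel_measurable lebesgue \<and>
     (\<integral>\<^sup>+x\<in>\<Omega>. ennreal (\<bar>u x\<bar> powr p) \<partial>lebesgue) < \<infinity> \<and>
     (\<integral>\<^sup>+z\<in>C_dom \<Omega>. (case z of (x, y) \<Rightarrow> ennreal
         (\<bar>u x - u y\<bar> powr p / norm (x - y) powr (real CARD('n) + s * p)
          + a x y * (\<bar>u x - u y\<bar> powr q / norm (x - y) powr (real CARD('n) + t * q))))
       \<partial>lebesgue) < \<infinity>}"

definition tail_space :: "real \<Rightarrow> real \<Rightarrow> (real^'n \<Rightarrow> real) set" where
  "tail_space s p = {u. u \<in> borel_measurable lebesgue \<and>
     (\<integral>\<^sup>+x. ennreal (\<bar>u x\<bar> powr (p - 1) / (1 + norm x) powr (real CARD('n) + s * p))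
       \<partial>lebesgue) < \<infinity>}"

definition weighted_tail_space ::
    "real \<Rightarrow> real \<Rightarrow> (real^'n \<Rightarrow> real^'n \<Rightarrow> real) \<Rightarrow> (real^'n) set \<Rightarrow> (real^'n \<Rightarrow> real) set" where
  "weighted_tail_space t q a \<Omega> = {u. u \<in> borel_measurable lebesgue \<and>
     (SUP x\<in>\<Omega>. \<integral>\<^sup>+y. ennreal
         (a x y * (\<bar>u y\<bar> powr (q - 1) / (1 + norm y) powr (real CARD('n) + t * q)))
       \<partial>lebesgue) < \<infinity>}"

definition F_energy ::
    "real \<Rightarrow> real \<Rightarrow> (real^'n \<Rightarrow> real^'n \<Rightarrow> real) \<Rightarrow> (real^'n \<Rightarrow> real^'n \<Rightarrow> real)
      \<Rightarrow> (real^'n \<Rightarrow> real^'n \<Rightarrow> real) \<Rightarrow> (real^'n) set \<Rightarrow> (real^'n \<Rightarrow> real) \<Rightarrow> ennreal" where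
  "F_energy p q Ksp Ktq a \<Omega> u =
     (\<integral>\<^sup>+z\<in>C_dom \<Omega>. (case z of (x, y) \<Rightarrow> ennreal
         (\<bar>u x - u y\<bar> powr p * Ksp x y + a x y * \<bar>u x - u y\<bar> powr q * Ktq x y)) \<partial>lebesgue)"

definition is_minimizer ::
    "real \<Rightarrow> real \<Rightarrow> real \<Rightarrow> real \<Rightarrow> (real^'n \<Rightarrow> real^'n \<Rightarrow> real) \<Rightarrow> (real^'n \<Rightarrow> real^'n \<Rightarrow> real)
      \<Rightarrow> (real^'n \<Rightarrow> real^'n \<Rightarrow> real) \<Rightarrow> (real^'n) set \<Rightarrow> (real^'n \<Rightarrow> real) \<Rightarrow> bool" where
  "is_minimizer s t p q Ksp Ktq a \<Omega> u \<longleftrightarrow>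
     u \<in> A_space s t p q a \<Omega> \<and>
     (\<forall>v \<in> A_space s t p q a \<Omega>. (AE x in lebesgue. x \<notin> \<Omega> \<longrightarrow> v x = u x) \<longrightarrow>
        F_energy p q Ksp Ktq a \<Omega> u \<le> F_energy p q Ksp Ktq a \<Omega> v)"


section \<open>Quantities in the estimate\<close>

definition ess_sup_on :: "(real^'n) set \<Rightarrow> (real^'n \<Rightarrow> real) \<Rightarrow> ereal" where
  "ess_sup_on E u = esssup (restrict_space lebesgue E) (\<lambda>x. ereal (u x))"

definition ess_inf_on :: "(real^'n) set \<Rightarrow> (real^'n \<Rightarrow> real) \<Rightarrow> ereal" where
  "ess_inf_on E u = - esssup (restrict_space lebesgue E) (\<lambda>x. - ereal (u x))"

definition a_minus :: "(real^'n \<Rightarrow> real^'n \<Rightarrow> real) \<Rightarrow> real^'n \<Rightarrow> real \<Rightarrow> real" where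
  "a_minus a x0 r = (INF (x, y)\<in>ball x0 r \<times> ball x0 r. a x y)"

definition h_fun ::
    "real \<Rightarrow> real \<Rightarrow> real \<Rightarrow> real \<Rightarrow> (real^'n \<Rightarrow> real^'n \<Rightarrow> real) \<Rightarrow> real^'n \<Rightarrow> real \<Rightarrow> real \<Rightarrow> real" where
  "h_fun s t p q a x0 r \<tau> =
     \<tau> powr (p - 1) / r powr (s * p) + a_minus a x0 r * (\<tau> powr (q - 1) / r powr (t * q))"

definition h_inv ::
    "real \<Rightarrow> real \<Rightarrow> real \<Rightarrow> real \<Rightarrow> (real^'n \<Rightarrow> real^'n \<Rightarrow> real) \<Rightarrow> real^'n \<Rightarrow> real \<Rightarrow> real \<Rightarrow> real" where
  "h_inv s t p q a x0 r = inv_into {0..} (h_fun s t p q a x0 r)"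

text \<open>As in \<^const>\<open>weighted_tail_space\<close>, the supremum over the first variable of \<open>a\<close> is the
  pointwise one, and so is the infimum in \<^const>\<open>a_minus\<close>. If \<open>v\<close> lies in both tail spaces
  and \<open>ball x0 R \<subseteq> \<Omega>\<close>, the two-radius tail is finite for every \<open>r > 0\<close>, so
  converting it to a real number loses nothing.\<close>

definition tail2 ::
    "real \<Rightarrow> real \<Rightarrow> real \<Rightarrow> real \<Rightarrow> (real^'n \<Rightarrow> real^'n \<Rightarrow> real) \<Rightarrow> real \<Rightarrow> real
      \<Rightarrow> (real^'n \<Rightarrow> real) \<Rightarrow> real^'n \<Rightarrow> ennreal" where
  "tail2 s t p q a r R v x0 =
     (\<integral>\<^sup>+y\<in>UNIV - ball x0 r. ennreal
         (\<bar>v y\<bar> powr (p - 1) / norm (y - x0) powr (real CARD('n) + s * p)) \<partial>lebesgue)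
     + (SUP x\<in>ball x0 R. \<integral>\<^sup>+y\<in>UNIV - ball x0 r. ennreal
         (a x y * (\<bar>v y\<bar> powr (q - 1) / norm (y - x0) powr (real CARD('n) + t * q))) \<partial>lebesgue)"

definition Wsp_seminorm :: "real \<Rightarrow> real \<Rightarrow> (real^'n) set \<Rightarrow> (real^'n \<Rightarrow> real) \<Rightarrow> ennreal" where
  "Wsp_seminorm s p E u =
     (let I = (\<integral>\<^sup>+z\<in>E \<times> E. (case z of (x, y) \<Rightarrow> ennreal
         (\<bar>u x - u y\<bar> powr p / norm (x - y) powr (real CARD('n) + s * p))) \<partial>lebesgue)
      in if I = \<infinity> then \<infinity> else ennreal (enn2real I powr (1 / p)))"

text \<open>The entry of the list of data that depends on the solution.\<close>

definition data_norm :: "real \<Rightarrow> real \<Rightarrow> (real^'n) set \<Rightarrow> (real^'n \<Rightarrow> real) \<Rightarrow> ennreal" where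
  "data_norm s p E u =
     (if s * p \<le> real CARD('n) then Linf_norm E u else Wsp_seminorm s p E u)"

end

theory Submission
  imports Defs
begin

text \<open>
  The tail in the estimate contains \<open>\<bar>u\<bar>\<close> on \<open>B\<^sub>2\<^sub>R - B\<^bsub>R/4\<^esub>\<close> and \<open>u \<ge> 0\<close> on \<open>B\<^sub>2\<^sub>R\<close>, so it is
  enough to bound \<open>sup u\<close> on \<open>B\<^bsub>R/4\<^esub>\<close> by \<open>C k\<close> whenever \<open>T \<le> h\<^sub>2\<^sub>R(k)\<close> for the tail \<open>T\<close>.
  Such a \<open>k\<close> makes \<open>u\<close> at most a multiple of \<open>k\<close> on most of the annulus \<open>B\<^bsub>R/2\<^esub> - B\<^bsub>R/4\<^esub>\<close>.
  Truncating the minimizer gives a Caccioppoli inequality. Let \<open>u \<le> N\<close> on \<open>B\<^bsub>\<rho>'\<^esub>\<close> with \<open>N\<close> much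
  larger than \<open>k\<close>. The jumps between \<open>{u > N/2}\<close> and the annulus cost energy, which forces
  \<open>{u > N/2}\<close> to be small, and De Giorgi iteration improves the bound to \<open>u \<le> 3N/4\<close> on a smaller
  ball \<open>B\<^sub>\<rho>\<close>. Here \<open>N \<ge> C k (R/(\<rho>' - \<rho>))\<^sup>m\<close> suffices, and iterating over radii between \<open>R/4\<close> and
  \<open>R/2\<close> yields the claim. In place of Sobolev inequalities only the observation is used that a
  small set cannot cover most of a ball, so that points of a small superlevel set see the singular
  kernel against its complement. The part of the coefficient \<open>a\<close> exceeding its infimum is absorbed
  by the first phase because \<open>u\<close> is bounded in terms of the data: by assumption if \<open>s p \<le> n\<close>, and by
  a fractional Morrey estimate if \<open>s p > n\<close>.
\<close>


section \<open>Elementary inequalities\<close>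

text \<open>The local error of the Caccioppoli inequality is confined to the annulus between the two
  balls, because the cutoff is constant on the inner one. In that annulus the set where u > N/8 has
  proportion at most a multiple of \<epsilon> = (k/N)^(p-1), by Chebyshev's inequality for the tail.
  The tail term carries the same factor, since T \<le> h(k) \<le> \<epsilon> h(N). The whole
  right-hand side is thus of order \<epsilon> N h(N), whereas the jumps between high values and the
  annulus cost energy of order N h(N) per unit of proportion. Both phases are measured in this one
  unit, so no distinction between a p-regime and a q-regime is made. The obstacle is that the gain
  carries the infimum of \<open>a\<close> and the error its upper bound. Their difference satisfies
  (sup a - inf a) N^q (2R)^(-tq) \<le> Cb N^p (2R)^(-sp) only for N \<le> M, by the gap condition on
  the exponents. Hence an a priori bound M of u in terms of the data is required. It enters the
  constants through Cb alone, and M itself is removed by iterating infinitely often.\<close>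

lemma two_power_powr: "(2 ^ m :: real) powr c = (2 powr c) ^ m"
  by (induction m) (simp_all add: powr_mult)

text \<open>For \<open>z\<close> between 0 and \<open>x + y\<close> one has
  \<open>z powr r \<le> z * (x + y) powr (r - 1)\<close>; the cases \<open>x\<close> and
  \<open>y\<close> are added. This is the source of the gain term in \<open>truncation_near\<close>
  and of the lower bounds for volumes of annuli.\<close>

lemma powr_superadditive:
  fixes x y r :: real
  assumes "0 \<le> x" "0 \<le> y" "1 \<le> r"
  shows "x powr r + y powr r \<le> (x + y) powr r"
proof (cases "x + y = 0")
  case True
  then have "x = 0" "y = 0" using assms by auto
  then show ?thesis by simp
next
  case False
  then have pos: "0 < x + y" using assms by auto
  have *: "z powr r \<le> z * (x + y) powr (r - 1)" if "0 \<le> z" "z \<le> x + y" for z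
  proof (cases "z = 0")
    case False
    then have "z powr r = z * z powr (r - 1)" using that by (simp add: powr_mult_base)
    also have "\<dots> \<le> z * (x + y) powr (r - 1)"
      using that assms by (intro mult_left_mono powr_mono2) auto
    finally show ?thesis .
  qed auto
  have "x powr r + y powr r \<le> x * (x + y) powr (r - 1) + y * (x + y) powr (r - 1)"
    using *[of x] *[of y] assms by simp
  also have "\<dots> = (x + y) * (x + y) powr (r - 1)" by (simp add: algebra_simps)
  also have "\<dots> = (x + y) powr r" using pos by (simp add: powr_mult_base)
  finally show ?thesis .
qed

lemma powr_diff_le:
  fixes x y r :: real
  assumes "0 \<le> x" "x \<le> y" "1 \<le> r"
  shows "y powr r - x powr r \<le> r * y powr (r - 1) * (y - x)"
proof (cases "x = y \<or> x = 0")
  case True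
  show ?thesis
  proof (cases "y = x")
    case False
    with True assms have "0 < y" "x = 0" by auto
    then have "y powr r = y powr (r - 1) * y" by (simp add: powr_mult_base mult.commute)
    also have "\<dots> \<le> r * (y powr (r - 1) * y)"
      using assms \<open>0 < y\<close> mult_right_mono[of 1 r "y powr (r - 1) * y"] by simp
    finally show ?thesis using \<open>x = 0\<close> by simp
  qed auto
next
  case False
  then have "0 < x" "x < y" using assms by auto
  then obtain z where z: "x < z" "z < y" "y powr r - x powr r = (y - x) * (r * z powr (r - 1))"
    using MVT2[of x y "\<lambda>x. x powr r" "\<lambda>z. r * z powr (r - 1)"] has_real_derivative_powr
    by force
  have "z powr (r - 1) \<le> y powr (r - 1)"
    using z \<open>0 < x\<close> assms by (intro powr_mono2) auto
  then have "(y - x) * (r * z powr (r - 1)) \<le> (y - x) * (r * y powr (r - 1))"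
    using \<open>x < y\<close> assms by (intro mult_left_mono) auto
  then show ?thesis using z by (simp add: algebra_simps)
qed

lemma powr_convex_comb:
  fixes x y r \<theta> :: real
  assumes "0 \<le> x" "0 \<le> y" "1 \<le> r" "0 \<le> \<theta>" "\<theta> \<le> 1"
  shows "((1 - \<theta>) * x + \<theta> * y) powr r \<le> (1 - \<theta>) * x powr r + \<theta> * y powr r"
proof -
  have small: "t powr r \<le> t" if "0 \<le> t" "t \<le> 1" for t :: real
    using powr_le_one_le[of t r] that assms by (cases "t = 0") auto
  consider "x = 0" | "y = 0" | "0 < x" "0 < y" using assms by fastforce
  then show ?thesis
  proof cases
    case 1
    then show ?thesis using small[of \<theta>] assms by (simp add: powr_mult mult_right_mono)
  next
    case 2
    then show ?thesis using small[of "1 - \<theta>"] assms by (simp add: powr_mult mult_right_mono)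
  next
    case 3
    from convex_onD[OF powr_convex[OF assms(3)] assms(4,5), of x y] 3 show ?thesis by simp
  qed
qed

text \<open>Convexity yields the comparison and the gain at once. If both values exceed
  \<open>k\<close>, the new difference is \<open>(1 - ex) * (wU - wV) - (ex - ey) * wV\<close>;
  convexity with weights \<open>1 - ex\<close> and \<open>ex\<close> applies, and the weight taken
  away from \<open>\<bar>wU - wV\<bar> powr r\<close> is the gain. The cutoff enters with the power
  \<open>q\<close> so that the other term stays bounded for all \<open>r \<le> q\<close>:
  \<open>(ex - ey) / ex \<le> q * (zx - zy) / zx\<close>, and
  \<open>zx powr (q - r) \<le> 1\<close>. The error carries the value at the point with the smaller
  cutoff, which confines it to an annulus later.\<close>

lemma truncation_near:
  fixes U V k r q zx zy wU wV :: real
  assumes r: "1 \<le> r" "r \<le> q" and z: "0 \<le> zy" "zy \<le> zx" "zx \<le> 1"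
    and w: "wU = max (U - k) 0" "wV = max (V - k) 0"
  shows "\<bar>(U - zx powr q * wU) - (V - zy powr q * wV)\<bar> powr r + zy powr q * \<bar>wU - wV\<bar> powr r
      \<le> \<bar>U - V\<bar> powr r + (q * wV * (zx - zy)) powr r"
proof -
  define ex ey where "ex = zx powr q" and "ey = zy powr q"
  have e: "0 \<le> ey" "ey \<le> ex" "ex \<le> 1"
    using z r powr_mono2[of q zy zx] powr_mono2[of q zx 1] by (auto simp: ex_def ey_def)
  \<comment> \<open>If only \<open>s\<close> exceeds the level, the truncated difference is the
    convex combination of \<open>s - t\<close> and \<open>k - t\<close>; superadditivity bounds
    \<open>(k - t) powr r\<close> by \<open>(s - t) powr r - (s - k) powr r\<close> and so leaves
    the gain.\<close>
  have one: "\<bar>(s - e * (s - k)) - t\<bar> powr r + e * \<bar>s - k\<bar> powr r \<le> \<bar>s - t\<bar> powr r"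
    if "k < s" "t \<le> k" "0 \<le> e" "e \<le> 1" for s t e
  proof -
    have "(s - e * (s - k)) - t = (1 - e) * (s - t) + e * (k - t)" by (simp add: algebra_simps)
    moreover have "0 \<le> (1 - e) * (s - t) + e * (k - t)" using that by auto
    ultimately have "\<bar>(s - e * (s - k)) - t\<bar> powr r \<le> (1 - e) * (s - t) powr r + e * (k - t) powr r"
      using powr_convex_comb[of "s - t" "k - t" r e] that r by simp
    moreover have "(s - k) powr r + (k - t) powr r \<le> (s - t) powr r"
      using powr_superadditive[of "s - k" "k - t" r] that r by simp
    then have "e * (s - k) powr r + e * (k - t) powr r \<le> e * (s - t) powr r"
      using that by (metis mult_left_mono distrib_left)
    ultimately show ?thesis using that by (simp add: algebra_simps)
  qed
  have nn: "0 \<le> (q * wV * (zx - zy)) powr r" by simp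
  consider "U \<le> k" "V \<le> k" | "k < U" "V \<le> k" | "U \<le> k" "k < V" | "k < U" "k < V" by linarith
  then have "\<bar>(U - ex * wU) - (V - ey * wV)\<bar> powr r + ey * \<bar>wU - wV\<bar> powr r
      \<le> \<bar>U - V\<bar> powr r + (q * wV * (zx - zy)) powr r"
  proof cases
    case 1
    then show ?thesis using w r by simp
  next
    case 2
    have "ey * \<bar>U - k\<bar> powr r \<le> ex * \<bar>U - k\<bar> powr r" using e by (intro mult_right_mono) auto
    moreover have "\<bar>(U - ex * (U - k)) - V\<bar> powr r + ex * \<bar>U - k\<bar> powr r \<le> \<bar>U - V\<bar> powr r"
      using 2 e by (intro one) auto
    moreover have "wU = U - k" "wV = 0" using 2 w by auto
    ultimately show ?thesis using nn by (simp only: mult_zero_right diff_zero)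
  next
    case 3
    have "\<bar>(V - ey * (V - k)) - U\<bar> powr r + ey * \<bar>V - k\<bar> powr r \<le> \<bar>V - U\<bar> powr r"
      using 3 e by (intro one) auto
    moreover have "wV = V - k" "wU = 0" using 3 w by auto
    moreover have "\<bar>U - (V - ey * (V - k))\<bar> = \<bar>(V - ey * (V - k)) - U\<bar>" "\<bar>U - V\<bar> = \<bar>V - U\<bar>"
      "\<bar>0 - (V - k)\<bar> = \<bar>V - k\<bar>" by auto
    ultimately show ?thesis using nn by (simp only: mult_zero_right diff_zero)
  next
    case 4
    have wp: "wU = U - k" "wV = V - k" "0 < wV" using 4 w by auto
    show ?thesis
    proof (cases "zx = 0")
      case True
      then have "zy = 0" using z by auto
      then show ?thesis using True by (simp add: ex_def ey_def)
    next
      case False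
      then have zx: "0 < zx" "0 < ex" using z by (auto simp: ex_def)
      \<comment> \<open>The perturbation \<open>(ex - ey) * wV\<close> is written as
        \<open>ex * b\<close>, so that it can be the second point, of weight \<open>ex\<close>, in a
        convex combination.\<close>
      define b where "b = wV * ((ex - ey) / ex)"
      have b: "0 \<le> b" using wp e zx by (auto simp: b_def)
      have "ex * b = (ex - ey) * wV" using zx by (simp add: b_def)
      then have "\<bar>(U - ex * wU) - (V - ey * wV)\<bar> = \<bar>(1 - ex) * (wU - wV) - ex * b\<bar>"
        by (simp add: wp algebra_simps)
      also have "\<dots> \<le> (1 - ex) * \<bar>wU - wV\<bar> + ex * b"
        using e b abs_triangle_ineq4[of "(1 - ex) * (wU - wV)" "ex * b"]
        by (simp add: abs_mult)
      finally have "\<bar>(U - ex * wU) - (V - ey * wV)\<bar> powr r \<le> ((1 - ex) * \<bar>wU - wV\<bar> + ex * b) powr r"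
        using r by (intro powr_mono2) auto
      also have "\<dots> \<le> (1 - ex) * \<bar>wU - wV\<bar> powr r + ex * b powr r"
        using e b r by (intro powr_convex_comb) auto
      also have "ex * b powr r \<le> (q * wV * (zx - zy)) powr r"
      proof -
        have "ex - ey \<le> q * zx powr (q - 1) * (zx - zy)"
          unfolding ex_def ey_def using z r by (intro powr_diff_le) auto
        then have "(ex - ey) / ex \<le> q * zx powr (q - 1) * (zx - zy) / ex"
          using zx by (intro divide_right_mono) auto
        also have "\<dots> = q * (zx - zy) / zx"
          using zx by (simp add: ex_def powr_diff)
        finally have "b \<le> q * wV * (zx - zy) / zx"
          using wp mult_left_mono[of "(ex - ey) / ex" "q * (zx - zy) / zx" wV]
          by (simp add: b_def mult_ac)
        then have "b powr r \<le> (q * wV * (zx - zy) / zx) powr r"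
          using b r by (intro powr_mono2) auto
        also have "\<dots> = (q * wV * (zx - zy)) powr r / zx powr r"
          using zx z wp r by (subst powr_divide) auto
        finally have "ex * b powr r \<le> ex * ((q * wV * (zx - zy)) powr r / zx powr r)"
          using zx by (intro mult_left_mono) auto
        also have "\<dots> = zx powr (q - r) * (q * wV * (zx - zy)) powr r"
          using zx by (simp add: ex_def powr_diff)
        also have "\<dots> \<le> 1 * (q * wV * (zx - zy)) powr r"
          using zx z r by (intro mult_right_mono powr_le1) auto
        finally show ?thesis by simp
      qed
      finally have "\<bar>(U - ex * wU) - (V - ey * wV)\<bar> powr r
          \<le> (1 - ex) * \<bar>wU - wV\<bar> powr r + (q * wV * (zx - zy)) powr r" by simp
      moreover have "ey * \<bar>wU - wV\<bar> powr r \<le> ex * \<bar>wU - wV\<bar> powr r"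
        using e by (intro mult_right_mono) auto
      ultimately show ?thesis by (simp add: wp algebra_simps)
    qed
  qed
  then show ?thesis by (simp add: ex_def ey_def)
qed

text \<open>Lowering \<open>U\<close> towards \<open>k\<close> can increase the difference only if
  \<open>V\<close> lies above the new value, and then above \<open>k\<close>. The increase is at
  most the shift, which is bounded by \<open>wU\<close>, times the derivative
  \<open>r * wV powr (r - 1)\<close>. After integration in \<open>V\<close> this product becomes the
  tail.\<close>

lemma truncation_far:
  fixes U V k r \<eta> wU wV :: real
  assumes r: "1 \<le> r" and e: "0 \<le> \<eta>" "\<eta> \<le> 1"
    and w: "wU = max (U - k) 0" "wV = max (V - k) 0"
  shows "\<bar>(U - \<eta> * wU) - V\<bar> powr r \<le> \<bar>U - V\<bar> powr r + r * wU * wV powr (r - 1)"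
proof -
  define v where "v = U - \<eta> * wU"
  have ewU: "0 \<le> \<eta> * wU" "\<eta> * wU \<le> wU" using e w by (auto intro: mult_left_le_one_le)
  have nn: "0 \<le> r * wU * wV powr (r - 1)" using r w by auto
  consider "V \<le> v" | "v < V" "U \<le> k" | "v < V" "k < U" by linarith
  then have "\<bar>v - V\<bar> powr r \<le> \<bar>U - V\<bar> powr r + r * wU * wV powr (r - 1)"
  proof cases
    case 1
    then have "\<bar>v - V\<bar> powr r \<le> \<bar>U - V\<bar> powr r"
      using ewU r by (intro powr_mono2) (auto simp: v_def)
    then show ?thesis using nn by linarith
  next
    case 2
    then show ?thesis using w by (simp add: v_def)
  next
    case 3
    then have k: "k \<le> v" using ewU w unfolding v_def by linarith
    then have wV: "wV = V - k" "0 < wV" using 3 w by auto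
    have vU: "v \<le> U" "U - v \<le> wU" using ewU by (auto simp: v_def)
    have m: "(V - v) powr (r - 1) \<le> wV powr (r - 1)"
      using 3 k wV r by (intro powr_mono2) auto
    show ?thesis
    proof (cases "V \<le> U")
      case True
      have "(V - v) powr r = (V - v) * (V - v) powr (r - 1)"
        using 3 by (simp add: powr_mult_base)
      also have "\<dots> \<le> wU * wV powr (r - 1)"
        using m 3 True vU by (intro mult_mono) auto
      also have "\<dots> \<le> r * (wU * wV powr (r - 1))"
        using r w mult_right_mono[of 1 r "wU * wV powr (r - 1)"] by simp
      finally have "(V - v) powr r \<le> r * wU * wV powr (r - 1)" by simp
      moreover have "\<bar>v - V\<bar> = V - v" using 3 by simp
      ultimately show ?thesis by (metis add_increasing powr_ge_zero)
    next
      case False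
      have "(V - v) powr r - (V - U) powr r \<le> r * (V - v) powr (r - 1) * ((V - v) - (V - U))"
        using False vU r by (intro powr_diff_le) auto
      also have "\<dots> = r * ((V - v) powr (r - 1) * (U - v))" by simp
      also have "\<dots> \<le> r * (wV powr (r - 1) * wU)"
        using m vU r by (intro mult_left_mono mult_mono) auto
      finally show ?thesis using 3 False by (simp add: abs_if mult_ac)
    qed
  qed
  then show ?thesis by (simp add: v_def)
qed

text \<open>The ratio \<open>\<theta>\<close> is chosen so that
  \<open>b * \<theta> powr \<beta> = 1\<close>: the superlinear part of the recursion then cancels
  the growing factor \<open>b ^ j\<close>. The bound on \<open>Y 0\<close> says exactly that
  \<open>C * Y 0 powr \<beta> \<le> \<theta>\<close>, and so
  \<open>Y j \<le> Y 0 * \<theta> ^ j\<close> propagates.\<close>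

lemma fast_geometric_convergence:
  fixes Y :: "nat \<Rightarrow> real"
  assumes nn: "\<And>j. 0 \<le> Y j" and C: "0 < C" and b: "1 < b" and \<beta>: "0 < \<beta>"
    and rec: "\<And>j. Y (Suc j) \<le> C * b ^ j * Y j powr (1 + \<beta>)"
    and init: "Y 0 \<le> C powr (- 1 / \<beta>) * b powr (- 1 / \<beta>\<^sup>2)"
  shows "Y \<longlonglongrightarrow> 0"
proof -
  define \<theta> where "\<theta> = b powr (- 1 / \<beta>)"
  have \<theta>: "0 < \<theta>" "\<theta> < 1" using b \<beta> by (auto simp: \<theta>_def powr_less_one)
  have bound: "Y j \<le> Y 0 * \<theta> ^ j" for j
  proof (induction j)
    case (Suc j)
    have "Y (Suc j) \<le> C * b ^ j * (Y 0 * \<theta> ^ j) powr (1 + \<beta>)"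
    proof (rule order_trans[OF rec])
      show "C * b ^ j * Y j powr (1 + \<beta>) \<le> C * b ^ j * (Y 0 * \<theta> ^ j) powr (1 + \<beta>)"
        using Suc nn[of j] C b \<beta> by (intro mult_left_mono powr_mono2) auto
    qed
    also have "(Y 0 * \<theta> ^ j) powr (1 + \<beta>) = Y 0 * Y 0 powr \<beta> * (\<theta> ^ j * (\<theta> ^ j) powr \<beta>)"
      using nn[of 0] \<theta> by (cases "Y 0 = 0") (simp_all add: powr_mult powr_add)
    also have "(\<theta> ^ j) powr \<beta> = (1 / b) ^ j"
    proof -
      have "(\<theta> ^ j) powr \<beta> = (\<theta> powr \<beta>) ^ j" using \<theta>
        by (simp add: powr_powr mult.commute flip: powr_realpow)
      moreover have "\<theta> powr \<beta> = 1 / b"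
        using b \<beta> unfolding \<theta>_def powr_powr by (simp add: powr_minus_divide)
      ultimately show ?thesis by simp
    qed
    also have "C * b ^ j * (Y 0 * Y 0 powr \<beta> * (\<theta> ^ j * (1 / b) ^ j))
        = (C * Y 0 powr \<beta>) * (Y 0 * \<theta> ^ j)"
      using b by (simp add: power_divide field_simps)
    also have "\<dots> \<le> \<theta> * (Y 0 * \<theta> ^ j)"
    proof -
      have "Y 0 powr \<beta> \<le> (C powr (- 1 / \<beta>) * b powr (- 1 / \<beta>\<^sup>2)) powr \<beta>"
        using init nn[of 0] \<beta> by (intro powr_mono2) auto
      also have "\<dots> = C powr (- 1 / \<beta> * \<beta>) * b powr (- 1 / \<beta>\<^sup>2 * \<beta>)"
        using C b by (simp only: powr_mult powr_powr powr_ge_zero)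
      also have "\<dots> = \<theta> / C"
        using C b \<beta> by (simp add: \<theta>_def power2_eq_square powr_minus_divide)
      finally have "C * Y 0 powr \<beta> \<le> \<theta>" using C by (simp add: field_simps)
      then show ?thesis using nn[of 0] \<theta> by (intro mult_right_mono) auto
    qed
    finally show ?case by (simp add: mult_ac)
  qed simp
  have "(\<lambda>j. Y 0 * \<theta> ^ j) \<longlonglongrightarrow> 0"
    using \<theta> by (intro tendsto_mult_right_zero LIMSEQ_power_zero) auto
  then show ?thesis
    by (rule tendsto_sandwich[rotated 2, OF tendsto_const])
       (use nn bound in \<open>auto intro: always_eventually\<close>)
qed

section \<open>Level sets and the Gagliardo seminorm\<close>

lemma sets_ball_borel [measurable]: "ball x r \<in> sets borel"
  for x :: "'a::metric_space"
  by simp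

text \<open>The ball is covered by dyadic shells around \<open>x\<close>; on each of them the
  integrand is comparable to a constant, and the contributions form a geometric series of ratio
  \<open>2 powr (-\<epsilon>)\<close>. The factor \<open>2 powr n\<close> serves both signs of the
  exponent \<open>\<epsilon> - n\<close>.\<close>

lemma nn_integral_dist_powr_ball:
  fixes \<epsilon> :: real
  assumes \<epsilon>: "0 < \<epsilon>"
  shows "\<exists>C>0. \<forall>(x::'a::euclidean_space) r. 0 < r \<longrightarrow>
    (\<integral>\<^sup>+y\<in>ball x r. ennreal (dist x y powr (\<epsilon> - real DIM('a))) \<partial>lborel) \<le> ennreal (C * r powr \<epsilon>)"
proof -
  define n where "n = real DIM('a)"
  define V where "V = unit_ball_vol n"
  have V: "0 < V" by (simp add: V_def n_def)
  have n: "1 \<le> n" by (simp add: n_def Suc_leI)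
  define c where "c = 2 powr (-\<epsilon>)"
  have c: "0 < c" "c < 1" using \<epsilon> by (auto simp: c_def powr_less_one)
  define C where "C = 2 powr n * V / (1 - c)"
  have "(\<integral>\<^sup>+y\<in>ball x r. ennreal (dist x y powr (\<epsilon> - n)) \<partial>lborel) \<le> ennreal (C * r powr \<epsilon>)"
    if r: "0 < r" for x :: 'a and r
  proof -
    define g where "g = (\<lambda>i (y::'a). ennreal (2 powr n * (r / 2 ^ i) powr (\<epsilon> - n)) * indicator (ball x (r / 2 ^ i)) y)"
    have "ennreal (dist x y powr (\<epsilon> - n)) * indicator (ball x r) y \<le> (\<Sum>i. g i y)" for y
    proof (cases "y \<in> ball x r \<and> y \<noteq> x")
      case True
      define d where "d = dist x y"
      have d: "0 < d" "d < r" using True by (auto simp: d_def)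
      \<comment> \<open>The index of the shell containing \<open>y\<close>:
        \<open>r / 2 ^ Suc i \<le> d < r / 2 ^ i\<close>.\<close>
      define i where "i = (LEAST j. r / 2 ^ Suc j \<le> d)"
      have "\<exists>j. r / d < 2 ^ j" using real_arch_pow[of 2 "r / d"] by auto
      then obtain j where j: "r / d < 2 ^ j" ..
      have "r / 2 ^ Suc j \<le> d"
      proof -
        have "r < d * 2 ^ j" using j d by (simp add: field_simps)
        also have "\<dots> \<le> d * 2 ^ Suc j" using d by simp
        finally show ?thesis by (simp add: field_simps)
      qed
      then have i1: "r / 2 ^ Suc i \<le> d" unfolding i_def by (rule LeastI)
      have i2: "d < r / 2 ^ i"
      proof (cases i)
        case (Suc k)
        then have "k < (LEAST j. r / 2 ^ Suc j \<le> d)" by (simp add: i_def)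
        from not_less_Least[OF this] show ?thesis using Suc by simp
      qed (use d in simp)
      have "d powr (\<epsilon> - n) \<le> 2 powr n * (r / 2 ^ i) powr (\<epsilon> - n)"
      proof (cases "\<epsilon> \<le> n")
        case True
        have "d powr (\<epsilon> - n) \<le> (r / 2 ^ Suc i) powr (\<epsilon> - n)"
          using True i1 r by (intro powr_mono2') auto
        also have "\<dots> = ((r / 2 ^ i) * (1 / 2)) powr (\<epsilon> - n)" by (simp add: mult.commute)
        also have "\<dots> = (r / 2 ^ i) powr (\<epsilon> - n) * (1 / 2) powr (\<epsilon> - n)"
          using r by (subst powr_mult) auto
        also have "(1 / 2 :: real) powr (\<epsilon> - n) = 2 powr (n - \<epsilon>)"
          using powr_powr[of 2 "-1" "\<epsilon> - n"] by simp
        also have "(r / 2 ^ i) powr (\<epsilon> - n) * 2 powr (n - \<epsilon>) \<le> (r / 2 ^ i) powr (\<epsilon> - n) * 2 powr n"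
          using \<epsilon> by (intro mult_left_mono) auto
        finally show ?thesis by (simp add: mult.commute)
      next
        case False
        have "d powr (\<epsilon> - n) \<le> (r / 2 ^ i) powr (\<epsilon> - n)"
          using False i2 d by (intro powr_mono2) auto
        also have "\<dots> \<le> 2 powr n * (r / 2 ^ i) powr (\<epsilon> - n)"
          using n ge_one_powr_ge_zero[of 2 n] mult_right_mono[of 1 "2 powr n" "(r / 2 ^ i) powr (\<epsilon> - n)"]
          by simp
        finally show ?thesis .
      qed
      then have "ennreal (dist x y powr (\<epsilon> - n)) * indicator (ball x r) y \<le> g i y"
        using True i2 by (simp add: g_def d_def ennreal_leI)
      also have "\<dots> = (\<Sum>j\<in>{i}. g j y)" by simp
      also have "\<dots> \<le> (\<Sum>j. g j y)" by (rule sum_le_suminf) auto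
      finally show ?thesis .
    qed (auto simp: indicator_def)
    note le = this
    have "(\<integral>\<^sup>+y\<in>ball x r. ennreal (dist x y powr (\<epsilon> - n)) \<partial>lborel) \<le> (\<integral>\<^sup>+y. (\<Sum>i. g i y) \<partial>lborel)"
      by (rule nn_integral_mono) (rule le)
    also have "\<dots> = (\<Sum>i. \<integral>\<^sup>+y. g i y \<partial>lborel)"
    proof (rule nn_integral_suminf)
      show "g i \<in> borel_measurable lborel" for i
        unfolding g_def by (intro borel_measurable_times_ennreal borel_measurable_indicator borel_measurable_const) auto
    qed
    also have "\<dots> = (\<Sum>i. ennreal (2 powr n * V * r powr \<epsilon> * c ^ i))"
    proof (rule suminf_cong)
      fix i
      have "(\<integral>\<^sup>+y. g i y \<partial>lborel) = ennreal (2 powr n * (r / 2 ^ i) powr (\<epsilon> - n)) * emeasure lborel (ball x (r / 2 ^ i))"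
        unfolding g_def by (subst nn_integral_cmult_indicator) auto
      also have "emeasure lborel (ball x (r / 2 ^ i)) = ennreal (V * (r / 2 ^ i) powr n)"
        using r by (simp add: emeasure_ball V_def n_def powr_realpow)
      also have "ennreal (2 powr n * (r / 2 ^ i) powr (\<epsilon> - n)) * ennreal (V * (r / 2 ^ i) powr n)
          = ennreal (2 powr n * (r / 2 ^ i) powr (\<epsilon> - n) * (V * (r / 2 ^ i) powr n))"
        using V by (intro ennreal_mult[symmetric]) auto
      also have "2 powr n * (r / 2 ^ i) powr (\<epsilon> - n) * (V * (r / 2 ^ i) powr n)
          = 2 powr n * V * ((r / 2 ^ i) powr (\<epsilon> - n) * (r / 2 ^ i) powr n)" by simp
      also have "(r / 2 ^ i) powr (\<epsilon> - n) * (r / 2 ^ i) powr n = r powr \<epsilon> * c ^ i"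
      proof -
        have "(r / 2 ^ i) powr (\<epsilon> - n) * (r / 2 ^ i) powr n = (r / 2 ^ i) powr \<epsilon>"
          by (simp flip: powr_add)
        also have "\<dots> = r powr \<epsilon> / (2 ^ i) powr \<epsilon>" using r by (simp add: powr_divide)
        also have "(2 ^ i) powr \<epsilon> = (1 / c) ^ i"
          by (simp add: c_def powr_minus_divide powr_powr mult.commute flip: powr_realpow)
        finally show ?thesis by (simp add: field_simps)
      qed
      finally show "(\<integral>\<^sup>+y. g i y \<partial>lborel) = ennreal (2 powr n * V * r powr \<epsilon> * c ^ i)"
        by (simp add: mult_ac)
    qed
    also have "\<dots> = ennreal (2 powr n * V * r powr \<epsilon> * (1 / (1 - c)))"
    proof (rule suminf_ennreal_eq)
      show "(\<lambda>i. 2 powr n * V * r powr \<epsilon> * c ^ i) sums (2 powr n * V * r powr \<epsilon> * (1 / (1 - c)))"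
        using c by (intro sums_mult geometric_sums) auto
    qed (use V c in auto)
    finally show ?thesis by (simp add: C_def mult_ac)
  qed
  moreover have "0 < C" using V c by (auto simp: C_def)
  ultimately show ?thesis unfolding n_def by blast
qed

text \<open>Moving \<open>x\<close> towards \<open>x0\<close> by the fraction
  \<open>\<rho> / (2 * r)\<close> of their difference changes it by at most
  \<open>\<rho> / 2\<close> and brings it within \<open>r - \<rho> / 2\<close> of \<open>x0\<close>.
  Hence points near the boundary of a ball still have a fixed share of each smaller ball around them
  inside it.\<close>

lemma ball_inter_ball_superset:
  fixes x0 x :: "'a::real_normed_vector"
  assumes "x \<in> ball x0 r" "0 < \<rho>" "\<rho> \<le> r"
  shows "\<exists>z. ball z (\<rho> / 2) \<subseteq> ball x \<rho> \<inter> ball x0 r"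
proof -
  have r: "0 < r" using assms by linarith
  define z where "z = x - (\<rho> / (2 * r)) *\<^sub>R (x - x0)"
  have d: "norm (x - x0) < r" using assms by (simp add: dist_norm norm_minus_commute)
  have "norm (x - z) = \<rho> / (2 * r) * norm (x - x0)"
    using assms r by (simp add: z_def)
  also have "\<dots> \<le> \<rho> / (2 * r) * r" using d r assms by (intro mult_left_mono) auto
  finally have 1: "norm (x - z) \<le> \<rho> / 2" using r by simp
  have "z - x0 = (1 - \<rho> / (2 * r)) *\<^sub>R (x - x0)" by (simp add: z_def algebra_simps)
  moreover have "0 \<le> 1 - \<rho> / (2 * r)" using assms r by (simp add: field_simps)
  ultimately have "norm (z - x0) = (1 - \<rho> / (2 * r)) * norm (x - x0)" by simp
  also have "\<dots> \<le> (1 - \<rho> / (2 * r)) * r"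
    using d r assms by (intro mult_left_mono) (auto simp: field_simps)
  also have "\<dots> = r - \<rho> / 2" using r by (simp add: field_simps)
  finally have 2: "norm (z - x0) \<le> r - \<rho> / 2" .
  have "y \<in> ball x \<rho> \<inter> ball x0 r" if "y \<in> ball z (\<rho> / 2)" for y
    using that 1 2 dist_triangle[of x y z] dist_triangle[of x0 y z]
    by (simp add: dist_norm norm_minus_commute)
  then show ?thesis by blast
qed

text \<open>This replaces the fractional isoperimetric and Sobolev inequalities: most of a ball around
  \<open>x\<close> whose volume is a large multiple of \<open>m\<close> is not covered by \<open>S\<close>.\<close>

lemma nn_integral_dist_powr_Diff_ge:
  fixes x x0 :: "'a::euclidean_space" and \<sigma> m r :: real
  defines "n \<equiv> real DIM('a)"
  assumes x: "x \<in> ball x0 r" and S: "S \<in> sets borel" "emeasure lborel (ball x0 r \<inter> S) \<le> ennreal m"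
    and m: "0 < m" "m \<le> unit_ball_vol n * r powr n / 2 powr (n + 1)" and \<sigma>: "0 \<le> \<sigma>"
  shows "ennreal ((2 powr (n + 1) / unit_ball_vol n) powr (- 1 - \<sigma> / n) * m powr (- \<sigma> / n))
    \<le> (\<integral>\<^sup>+y\<in>ball x0 r - S. ennreal (dist x y powr (- (n + \<sigma>))) \<partial>lborel)"
proof -
  define V where "V = unit_ball_vol n"
  have V: "0 < V" by (simp add: V_def n_def)
  have n: "1 \<le> n" by (simp add: n_def Suc_leI)
  have r: "0 < r" using x by (simp add: le_less_trans[OF zero_le_dist])
  define Q where "Q = 2 powr (n + 1) / V"
  have Q: "0 < Q" using V by (simp add: Q_def)
  \<comment> \<open>The radius for which a ball of radius \<open>\<rho> / 2\<close> has volume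
    \<open>2 * m\<close>, so that removing \<open>S\<close> leaves at least \<open>m\<close>. The
    upper bound assumed for \<open>m\<close> means exactly \<open>\<rho> \<le> r\<close>.\<close>
  define \<rho> where "\<rho> = (Q * m) powr (1 / n)"
  have \<rho>: "0 < \<rho>" using Q m by (simp add: \<rho>_def)
  have \<rho>n: "\<rho> powr n = Q * m" using Q m n by (simp add: \<rho>_def powr_powr)
  have "Q * m \<le> r powr n" using m(2) V by (simp add: Q_def V_def field_simps)
  then have "\<rho> powr n \<le> r powr n" by (simp add: \<rho>n)
  then have \<rho>r: "\<rho> \<le> r" using \<rho> r n using powr_less_mono2[of n r \<rho>] by force
  obtain z where z: "ball z (\<rho> / 2) \<subseteq> ball x \<rho> \<inter> ball x0 r"
    using ball_inter_ball_superset[OF x \<rho> \<rho>r] by blast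
  have mb: "emeasure lborel (ball z (\<rho> / 2)) = ennreal (2 * m)"
  proof -
    have "emeasure lborel (ball z (\<rho> / 2)) = ennreal (V * (\<rho> / 2) powr n)"
      using \<rho> by (simp add: emeasure_ball V_def n_def powr_realpow)
    also have "V * (\<rho> / 2) powr n = V * (Q * m) / 2 powr n"
      using \<rho> by (simp add: powr_divide \<rho>n)
    also have "\<dots> = 2 * m" using V by (simp add: Q_def powr_add)
    finally show ?thesis .
  qed
  define E where "E = ball z (\<rho> / 2) - S"
  have E: "E \<in> sets borel" using S by (simp add: E_def)
  have "ennreal (2 * m) \<le> emeasure lborel E + emeasure lborel (ball x0 r \<inter> S)"
  proof -
    have "emeasure lborel (ball z (\<rho> / 2)) \<le> emeasure lborel (E \<union> (ball x0 r \<inter> S))"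
      using z S E by (intro emeasure_mono) (auto simp: E_def)
    also have "\<dots> \<le> emeasure lborel E + emeasure lborel (ball x0 r \<inter> S)"
      using S E by (intro emeasure_subadditive) auto
    finally show ?thesis by (simp add: mb)
  qed
  also have "\<dots> \<le> emeasure lborel E + ennreal m" using S(2) by (intro add_left_mono)
  finally have "ennreal m + ennreal m \<le> ennreal m + emeasure lborel E"
    using m by (simp add: add.commute flip: ennreal_plus)
  then have Em: "ennreal m \<le> emeasure lborel E" using m by (simp add: ennreal_add_left_cancel_le)
  have "Q powr (- 1 - \<sigma> / n) * m powr (- \<sigma> / n) = \<rho> powr (- (n + \<sigma>)) * m"
  proof -
    have "(1 / n) * (- (n + \<sigma>)) = - 1 - \<sigma> / n" using n by (simp add: field_simps)
    then have "\<rho> powr (- (n + \<sigma>)) = (Q * m) powr (- 1 - \<sigma> / n)"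
      unfolding \<rho>_def powr_powr by simp
    also have "\<dots> = Q powr (- 1 - \<sigma> / n) * (m powr (- \<sigma> / n) / m)"
      using Q m by (simp add: powr_mult powr_diff powr_minus_divide)
    finally show ?thesis using m by simp
  qed
  then have "ennreal (Q powr (- 1 - \<sigma> / n) * m powr (- \<sigma> / n)) = ennreal (\<rho> powr (- (n + \<sigma>))) * ennreal m"
    using m by (simp add: ennreal_mult)
  \<comment> \<open>The point \<open>x\<close> is removed because there
    \<open>0 powr (- (n + \<sigma>))\<close> has the default value 0, below the lower bound
    used.\<close>
  also have "\<dots> \<le> ennreal (\<rho> powr (- (n + \<sigma>))) * emeasure lborel (E - {x})"
    using Em E countable_imp_null_set_lborel[of "{x}"]
    by (intro mult_left_mono) (auto simp: emeasure_Diff_null_set)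
  also have "\<dots> = (\<integral>\<^sup>+y\<in>E - {x}. ennreal (\<rho> powr (- (n + \<sigma>))) \<partial>lborel)"
    using E by (subst nn_integral_cmult_indicator) auto
  also have "\<dots> \<le> (\<integral>\<^sup>+y\<in>ball x0 r - S. ennreal (dist x y powr (- (n + \<sigma>))) \<partial>lborel)"
  proof (intro nn_integral_mono)
    fix y
    show "ennreal (\<rho> powr (- (n + \<sigma>))) * indicator (E - {x}) y
        \<le> ennreal (dist x y powr (- (n + \<sigma>))) * indicator (ball x0 r - S) y"
    proof (cases "y \<in> E - {x}")
      case True
      then have y: "y \<in> ball x \<rho>" "y \<in> ball x0 r - S" "y \<noteq> x" using z by (auto simp: E_def)
      have "\<rho> powr (- (n + \<sigma>)) \<le> dist x y powr (- (n + \<sigma>))"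
        using y n \<sigma> by (intro powr_mono2') auto
      then show ?thesis using y True by (simp add: ennreal_leI)
    qed simp
  qed
  finally show ?thesis by (simp add: Q_def V_def)
qed

lemma emeasure_mult_le_nn_integral:
  assumes "E \<in> sets M" "\<And>y. y \<in> E \<Longrightarrow> c \<le> f y"
  shows "c * emeasure M E \<le> (\<integral>\<^sup>+y. f y \<partial>M)"
proof -
  have "c * emeasure M E = (\<integral>\<^sup>+y. c * indicator E y \<partial>M)"
    using assms by (simp add: nn_integral_cmult_indicator)
  also have "\<dots> \<le> (\<integral>\<^sup>+y. f y \<partial>M)"
    using assms by (intro nn_integral_mono) (auto split: split_indicator)
  finally show ?thesis .
qed

text \<open>Let \<open>t = w x / 2\<close>. By Chebyshev's inequality the set where
  \<open>w > t\<close> has measure at most \<open>I * t powr (- \<kappa>)\<close>, so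
  \<open>x\<close> sees its complement with a kernel integral of at least a multiple of
  \<open>(I * t powr (- \<kappa>)) powr (- \<beta>)\<close>, and across it \<open>w\<close> jumps by
  at least \<open>t\<close>. With \<open>\<beta> = (\<kappa> - p) / \<kappa>\<close> the powers of
  \<open>t\<close> combine to \<open>\<kappa>\<close>, which bounds \<open>w x powr \<kappa>\<close>
  by the energy density at \<open>x\<close>; integration finishes. The condition on
  \<open>\<sigma>\<close> says that \<open>\<kappa>\<close> does not exceed the Sobolev
  exponent.\<close>

lemma fractional_sobolev_small_support:
  fixes r p \<kappa> \<sigma> :: real
  defines "n \<equiv> real DIM('a::euclidean_space)"
  assumes r: "0 < r" and p: "0 < p" "p < \<kappa>" and \<sigma>: "n * ((\<kappa> - p) / \<kappa>) \<le> \<sigma>"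
  shows "\<exists>C>0. \<forall>(w::'a \<Rightarrow> real) x0 \<rho> I. w \<in> borel_measurable borel \<longrightarrow> (\<forall>y. 0 \<le> w y) \<longrightarrow> 0 < \<rho> \<longrightarrow> \<rho> \<le> r \<longrightarrow>
    emeasure lborel {y \<in> ball x0 \<rho>. 0 < w y} \<le> ennreal (unit_ball_vol n * \<rho> powr n / 2 powr (n + 1)) \<longrightarrow>
    0 \<le> I \<longrightarrow> (\<integral>\<^sup>+x\<in>ball x0 \<rho>. ennreal (w x powr \<kappa>) \<partial>lborel) = ennreal I \<longrightarrow>
    ennreal I \<le> ennreal (C * I powr ((\<kappa> - p) / \<kappa>)) *
      (\<integral>\<^sup>+x\<in>ball x0 \<rho>. (\<integral>\<^sup>+y\<in>ball x0 \<rho>. ennreal (\<bar>w x - w y\<bar> powr p * dist x y powr (- (n + \<sigma>))) \<partial>lborel) \<partial>lborel)"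
proof -
  define V where "V = unit_ball_vol n"
  have V: "0 < V" by (simp add: V_def n_def)
  have n: "1 \<le> n" by (simp add: n_def Suc_leI)
  define \<beta> where "\<beta> = (\<kappa> - p) / \<kappa>"
  have \<beta>: "0 < \<beta>" "\<beta> \<le> \<sigma> / n" using p \<sigma> n by (auto simp: \<beta>_def field_simps)
  then have \<sigma>0: "0 \<le> \<sigma>" using n by (smt (verit) divide_nonneg_pos zero_le_divide_iff)
  define M0 where "M0 = V * r powr n / 2 powr (n + 1)"
  have M0: "0 < M0" using V r by (simp add: M0_def)
  \<comment> \<open>The last factor pays for lowering the exponent \<open>\<sigma> / n\<close> to
    \<open>\<beta>\<close>, with the help of \<open>m \<le> M0\<close>.\<close>
  define c' where "c' = (2 powr (n + 1) / V) powr (- 1 - \<sigma> / n) * M0 powr (- (\<sigma> / n - \<beta>))"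
  have c': "0 < c'" using V M0 by (simp add: c'_def)
  define C where "C = 2 powr \<kappa> / c'"
  have C: "0 < C" using c' by (simp add: C_def)
  have "ennreal I \<le> ennreal (C * I powr \<beta>) *
      (\<integral>\<^sup>+x\<in>ball x0 \<rho>. (\<integral>\<^sup>+y\<in>ball x0 \<rho>. ennreal (\<bar>w x - w y\<bar> powr p * dist x y powr (- (n + \<sigma>))) \<partial>lborel) \<partial>lborel)"
    if w[measurable]: "w \<in> borel_measurable borel" and w0: "\<And>y. 0 \<le> w y"
      and \<rho>: "0 < \<rho>" "\<rho> \<le> r"
      and small: "emeasure lborel {y \<in> ball x0 \<rho>. 0 < w y} \<le> ennreal (V * \<rho> powr n / 2 powr (n + 1))"
      and I: "0 \<le> I" "(\<integral>\<^sup>+x\<in>ball x0 \<rho>. ennreal (w x powr \<kappa>) \<partial>lborel) = ennreal I"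
    for w :: "'a \<Rightarrow> real" and x0 \<rho> I
  proof (cases "I = 0")
    case False
    then have Ip: "0 < I" using I by simp
    define m0 where "m0 = V * \<rho> powr n / 2 powr (n + 1)"
    have m0: "0 < m0" using V \<rho> by (simp add: m0_def)
    have mM: "m0 \<le> M0" using V \<rho> n unfolding m0_def M0_def
      by (intro divide_right_mono mult_left_mono powr_mono2) auto
    define e where "e = (\<lambda>x. \<integral>\<^sup>+y\<in>ball x0 \<rho>. ennreal (\<bar>w x - w y\<bar> powr p * dist x y powr (- (n + \<sigma>))) \<partial>lborel)"
    have [measurable]: "e \<in> borel_measurable borel" unfolding e_def by measurable
    have point: "ennreal (w x powr \<kappa>) \<le> ennreal (C * I powr \<beta>) * e x" if x: "x \<in> ball x0 \<rho>" for x
    proof (cases "w x = 0")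
      case False
      define t where "t = w x / 2"
      have t: "0 < t" using False w0[of x] by (simp add: t_def)
      define S where "S = {y. t < w y}"
      have S: "S \<in> sets borel" unfolding S_def by measurable
      \<comment> \<open>Both entries bound the measure of the level set: the first by the assumption
        on the support, the second by Chebyshev's inequality. The first also ensures the size
        condition of \<open>nn_integral_dist_powr_Diff_ge\<close>.\<close>
      define m where "m = min m0 (I * t powr (- \<kappa>))"
      have m: "0 < m" "m \<le> m0" "m \<le> I * t powr (- \<kappa>)" using m0 Ip t by (auto simp: m_def)
      have "emeasure lborel (ball x0 \<rho> \<inter> S) \<le> ennreal m0"
        using small[folded m0_def] by (rule order_trans[rotated])
          (intro emeasure_mono, use t in \<open>auto simp: S_def\<close>)
      moreover have "emeasure lborel (ball x0 \<rho> \<inter> S) \<le> ennreal (I * t powr (- \<kappa>))"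
      proof -
        have "ennreal (t powr \<kappa>) * emeasure lborel (ball x0 \<rho> \<inter> S)
            \<le> (\<integral>\<^sup>+x\<in>ball x0 \<rho>. ennreal (w x powr \<kappa>) \<partial>lborel)"
          using S t p by (intro emeasure_mult_le_nn_integral) (auto simp: S_def intro!: ennreal_leI powr_mono2)
        then have "ennreal (t powr (- \<kappa>)) * (ennreal (t powr \<kappa>) * emeasure lborel (ball x0 \<rho> \<inter> S))
            \<le> ennreal (t powr (- \<kappa>)) * ennreal I"
          unfolding I by (intro mult_left_mono) auto
        moreover have "ennreal (t powr (- \<kappa>)) * ennreal (t powr \<kappa>) = 1"
          using t by (simp flip: ennreal_mult powr_add)
        ultimately show ?thesis using I
          by (simp add: mult.assoc[symmetric] ennreal_mult mult.commute[of "ennreal I"])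
      qed
      ultimately have Sm: "emeasure lborel (ball x0 \<rho> \<inter> S) \<le> ennreal m"
        by (simp add: m_def min_def)
      have "c' * (I * t powr (- \<kappa>)) powr (- \<beta>) \<le> (2 powr (n + 1) / V) powr (- 1 - \<sigma> / n) * m powr (- \<sigma> / n)"
      proof -
        have "M0 powr (- (\<sigma> / n - \<beta>)) * (I * t powr (- \<kappa>)) powr (- \<beta>)
            \<le> m powr (- (\<sigma> / n - \<beta>)) * m powr (- \<beta>)"
          using m \<beta> mM by (intro mult_mono powr_mono2') auto
        also have "\<dots> = m powr (- \<sigma> / n)" by (simp flip: powr_add)
        finally show ?thesis unfolding c'_def by (simp add: mult.assoc mult_left_mono)
      qed
      then have "ennreal (c' * (I * t powr (- \<kappa>)) powr (- \<beta>))
          \<le> ennreal ((2 powr (n + 1) / V) powr (- 1 - \<sigma> / n) * m powr (- \<sigma> / n))"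
        by (rule ennreal_leI)
      also have "\<dots> \<le> (\<integral>\<^sup>+y\<in>ball x0 \<rho> - S. ennreal (dist x y powr (- (n + \<sigma>))) \<partial>lborel)"
        using nn_integral_dist_powr_Diff_ge[OF x S Sm m(1) _ \<sigma>0] m by (simp add: m0_def V_def n_def)
      finally have "ennreal (t powr p) * ennreal (c' * (I * t powr (- \<kappa>)) powr (- \<beta>))
          \<le> ennreal (t powr p) * (\<integral>\<^sup>+y\<in>ball x0 \<rho> - S. ennreal (dist x y powr (- (n + \<sigma>))) \<partial>lborel)"
        by (intro mult_left_mono) auto
      also have "\<dots> = (\<integral>\<^sup>+y\<in>ball x0 \<rho> - S. ennreal (t powr p) * ennreal (dist x y powr (- (n + \<sigma>))) \<partial>lborel)"
        using S by (subst nn_integral_cmult[symmetric]) (auto simp: mult.assoc)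
      also have "\<dots> \<le> e x"
        unfolding e_def
      proof (intro nn_integral_mono)
        fix y
        show "ennreal (t powr p) * ennreal (dist x y powr (- (n + \<sigma>))) * indicator (ball x0 \<rho> - S) y
          \<le> ennreal (\<bar>w x - w y\<bar> powr p * dist x y powr (- (n + \<sigma>))) * indicator (ball x0 \<rho>) y"
        proof (cases "y \<in> ball x0 \<rho> - S")
          case True
          then have "t \<le> \<bar>w x - w y\<bar>" by (auto simp: S_def t_def abs_if)
          then have "t powr p \<le> \<bar>w x - w y\<bar> powr p" using t p by (intro powr_mono2) auto
          then show ?thesis using True
            by (auto simp flip: ennreal_mult intro!: ennreal_leI mult_right_mono)
        qed simp
      qed
      finally have "ennreal (C * I powr \<beta>) * (ennreal (t powr p) * ennreal (c' * (I * t powr (- \<kappa>)) powr (- \<beta>)))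
          \<le> ennreal (C * I powr \<beta>) * e x"
        by (intro mult_left_mono) auto
      moreover have "C * I powr \<beta> * (t powr p * (c' * (I * t powr (- \<kappa>)) powr (- \<beta>))) = w x powr \<kappa>"
      proof -
        have "(I * t powr (- \<kappa>)) powr (- \<beta>) = I powr (- \<beta>) * t powr (\<kappa> - p)"
          using Ip p by (simp add: powr_mult powr_powr \<beta>_def)
        then have "C * I powr \<beta> * (t powr p * (c' * (I * t powr (- \<kappa>)) powr (- \<beta>)))
            = (C * c') * (I powr \<beta> * I powr (- \<beta>)) * (t powr p * t powr (\<kappa> - p))" by simp
        also have "\<dots> = 2 powr \<kappa> * t powr \<kappa>" using c' Ip by (simp add: C_def flip: powr_add)
        also have "\<dots> = w x powr \<kappa>" using t w0[of x] by (simp add: t_def flip: powr_mult)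
        finally show ?thesis .
      qed
      ultimately show ?thesis
        using C c' by (simp flip: ennreal_mult)
    qed (use p in simp)
    have "ennreal I = (\<integral>\<^sup>+x\<in>ball x0 \<rho>. ennreal (w x powr \<kappa>) \<partial>lborel)" using I by simp
    also have "\<dots> \<le> (\<integral>\<^sup>+x. ennreal (C * I powr \<beta>) * (e x * indicator (ball x0 \<rho>) x) \<partial>lborel)"
      using point by (intro nn_integral_mono) (auto split: split_indicator)
    also have "\<dots> = ennreal (C * I powr \<beta>) * (\<integral>\<^sup>+x\<in>ball x0 \<rho>. e x \<partial>lborel)"
      by (rule nn_integral_cmult) measurable
    finally show ?thesis by (simp add: e_def)
  qed simp
  then show ?thesis using C unfolding V_def \<beta>_def by blast
qed

section \<open>Truncation and the Caccioppoli inequality\<close>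

text \<open>It is 1 on the ball of radius \<rho> and vanishes already outside radius (\<rho> +
  \<rho>')/2 instead of \<rho>'. The gap keeps its support at a positive distance from the
  complement of the larger ball, where the tail is taken.\<close>

definition cutoff :: "'a::metric_space \<Rightarrow> real \<Rightarrow> real \<Rightarrow> 'a \<Rightarrow> real" where
  "cutoff x0 \<rho> \<rho>' x = min 1 (max 0 ((\<rho> + \<rho>' - 2 * dist x0 x) / (\<rho>' - \<rho>)))"

lemma cutoff_bounds: "0 \<le> cutoff x0 \<rho> \<rho>' x" "cutoff x0 \<rho> \<rho>' x \<le> 1"
  by (auto simp: cutoff_def)

lemma cutoff_eq_1: "\<rho> < \<rho>' \<Longrightarrow> x \<in> ball x0 \<rho> \<Longrightarrow> cutoff x0 \<rho> \<rho>' x = 1"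
  by (simp add: cutoff_def min_def max_def field_simps)

lemma cutoff_eq_0: "\<rho> < \<rho>' \<Longrightarrow> x \<notin> ball x0 ((\<rho> + \<rho>') / 2) \<Longrightarrow> cutoff x0 \<rho> \<rho>' x = 0"
  by (simp add: cutoff_def min_def max_def field_simps)

lemma cutoff_lipschitz:
  assumes "\<rho> < \<rho>'"
  shows "\<bar>cutoff x0 \<rho> \<rho>' x - cutoff x0 \<rho> \<rho>' y\<bar> \<le> 2 / (\<rho>' - \<rho>) * dist x y"
proof -
  have "\<bar>cutoff x0 \<rho> \<rho>' x - cutoff x0 \<rho> \<rho>' y\<bar>
      \<le> \<bar>(\<rho> + \<rho>' - 2 * dist x0 x) / (\<rho>' - \<rho>) - (\<rho> + \<rho>' - 2 * dist x0 y) / (\<rho>' - \<rho>)\<bar>"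
    unfolding cutoff_def by linarith
  also have "\<dots> = 2 / (\<rho>' - \<rho>) * \<bar>dist x0 y - dist x0 x\<bar>"
  proof -
    have "(\<rho> + \<rho>' - 2 * dist x0 x) / (\<rho>' - \<rho>) - (\<rho> + \<rho>' - 2 * dist x0 y) / (\<rho>' - \<rho>)
        = 2 / (\<rho>' - \<rho>) * (dist x0 y - dist x0 x)"
      by (simp add: right_diff_distrib flip: diff_divide_distrib)
    then show ?thesis using assms by (simp only: abs_mult) simp
  qed
  also have "\<dots> \<le> 2 / (\<rho>' - \<rho>) * dist x y"
    using assms abs_dist_diff_le[of y x0 x] by (intro mult_left_mono) (auto simp: dist_commute)
  finally show ?thesis .
qed

lemma borel_measurable_cutoff [measurable]: "cutoff x0 \<rho> \<rho>' \<in> borel_measurable borel"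
  for x0 :: "'a::{metric_space, second_countable_topology}"
  unfolding cutoff_def by measurable

text \<open>The symmetrized errors of \<open>truncation_near\<close> and
  \<open>truncation_far\<close>. The first summand belongs to pairs in the larger ball and charges
  only endpoints outside the smaller one; the other two belong to one point in the support of the
  cutoff and one outside the larger ball.\<close>

definition truncation_error ::
    "real \<Rightarrow> 'a::metric_space \<Rightarrow> real \<Rightarrow> real \<Rightarrow> ('a \<Rightarrow> real) \<Rightarrow> real \<Rightarrow> 'a \<Rightarrow> 'a \<Rightarrow> real" where
  "truncation_error q x0 \<rho> \<rho>' w r x y =
     indicator (ball x0 \<rho>') x * indicator (ball x0 \<rho>') y * (2 * q / (\<rho>' - \<rho>) * dist x y) powr r
       * (indicator (- ball x0 \<rho>) x * w x powr r + indicator (- ball x0 \<rho>) y * w y powr r)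
     + indicator (ball x0 ((\<rho> + \<rho>') / 2)) x * indicator (- ball x0 \<rho>') y * (r * w x * w y powr (r - 1))
     + indicator (ball x0 ((\<rho> + \<rho>') / 2)) y * indicator (- ball x0 \<rho>') x * (r * w y * w x powr (r - 1))"

lemma truncation_error_nonneg:
  "0 \<le> r \<Longrightarrow> (\<And>x. 0 \<le> w x) \<Longrightarrow> 0 \<le> truncation_error q x0 \<rho> \<rho>' w r x y"
  unfolding truncation_error_def by (intro add_nonneg_nonneg mult_nonneg_nonneg) auto

lemma truncation_error_sym: "truncation_error q x0 \<rho> \<rho>' w r x y = truncation_error q x0 \<rho> \<rho>' w r y x"
  by (simp add: truncation_error_def dist_commute algebra_simps)

text \<open>Two points of the larger ball are compared by \<open>truncation_near\<close>, a point of
  the support and a point outside the larger ball by \<open>truncation_far\<close>; in the remaining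
  case nothing changes. In the near case, if the point with the smaller cutoff lies in the inner
  ball, both cutoffs are 1 and the error vanishes: this is why the annulus suffices.\<close>

lemma truncation_pointwise:
  fixes u :: "'a::metric_space \<Rightarrow> real" and k :: real and x0 :: 'a
  assumes r: "1 \<le> r" "r \<le> q" and \<rho>: "\<rho> < \<rho>'"
  defines "w \<equiv> \<lambda>x. max (u x - k) 0"
  defines "v \<equiv> \<lambda>x. u x - cutoff x0 \<rho> \<rho>' x powr q * w x"
  shows "\<And>x y. \<bar>v x - v y\<bar> powr r + indicator (ball x0 \<rho>) x * indicator (ball x0 \<rho>) y * \<bar>w x - w y\<bar> powr r
    \<le> \<bar>u x - u y\<bar> powr r + truncation_error q x0 \<rho> \<rho>' w r x y"
proof -
  let ?\<zeta> = "cutoff x0 \<rho> \<rho>'" and ?E = "truncation_error q x0 \<rho> \<rho>' w r"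
  let ?L = "\<lambda>x y. \<bar>v x - v y\<bar> powr r + indicator (ball x0 \<rho>) x * indicator (ball x0 \<rho>) y * \<bar>w x - w y\<bar> powr r"
  have w0: "0 \<le> w x" for x by (simp add: w_def)
  have E0: "0 \<le> ?E x y" for x y using w0 r by (intro truncation_error_nonneg) auto
  have sub: "x \<in> ball x0 \<rho>'" if "x \<in> ball x0 ((\<rho> + \<rho>') / 2)" for x
    using that \<rho> by (simp add: field_simps)
  have sub2: "x \<in> ball x0 ((\<rho> + \<rho>') / 2)" if "x \<in> ball x0 \<rho>" for x
    using that \<rho> by (simp add: field_simps)
  have near: "?L x y \<le> \<bar>u x - u y\<bar> powr r + ?E x y"
    if xy: "x \<in> ball x0 \<rho>'" "y \<in> ball x0 \<rho>'" "?\<zeta> y \<le> ?\<zeta> x" for x y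
  proof -
    have "\<bar>v x - v y\<bar> powr r + ?\<zeta> y powr q * \<bar>w x - w y\<bar> powr r
        \<le> \<bar>u x - u y\<bar> powr r + (q * w y * (?\<zeta> x - ?\<zeta> y)) powr r"
      unfolding v_def by (rule truncation_near) (use r xy cutoff_bounds w_def in auto)
    moreover have "indicator (ball x0 \<rho>) x * indicator (ball x0 \<rho>) y * \<bar>w x - w y\<bar> powr r
        \<le> ?\<zeta> y powr q * \<bar>w x - w y\<bar> powr r"
      using cutoff_eq_1[OF \<rho>, of y] by (intro mult_right_mono) (auto simp: indicator_def)
    moreover have "(q * w y * (?\<zeta> x - ?\<zeta> y)) powr r \<le> ?E x y"
    proof (cases "y \<in> ball x0 \<rho>")
      case True
      then have "?\<zeta> x - ?\<zeta> y = 0"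
        using xy(3) cutoff_eq_1[OF \<rho>, of y x0] cutoff_bounds(2)[of x0 \<rho> \<rho>' x] by simp
      then show ?thesis using E0[of x y] by simp
    next
      case False
      have "q * w y * (?\<zeta> x - ?\<zeta> y) \<le> q * w y * (2 / (\<rho>' - \<rho>) * dist x y)"
        using cutoff_lipschitz[OF \<rho>, of x0 x y] r w0[of y] by (intro mult_left_mono) auto
      then have "(q * w y * (?\<zeta> x - ?\<zeta> y)) powr r \<le> (2 * q / (\<rho>' - \<rho>) * dist x y * w y) powr r"
        using xy r w0[of y] by (intro powr_mono2) (auto simp: mult_ac)
      also have "\<dots> = (2 * q / (\<rho>' - \<rho>) * dist x y) powr r * w y powr r"
        by (rule powr_mult)
      also have "\<dots> \<le> ?E x y"
        using False xy w0 r unfolding truncation_error_def by (simp add: distrib_left)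
      finally show ?thesis .
    qed
    ultimately show ?thesis by linarith
  qed
  have far: "?L x y \<le> \<bar>u x - u y\<bar> powr r + ?E x y"
    if xy: "x \<in> ball x0 ((\<rho> + \<rho>') / 2)" "y \<notin> ball x0 \<rho>'" for x y
  proof -
    have y: "y \<notin> ball x0 ((\<rho> + \<rho>') / 2)" "y \<notin> ball x0 \<rho>" using xy sub sub2 by blast+
    then have "v y = u y" using cutoff_eq_0[OF \<rho> y(1)] by (simp add: v_def)
    moreover have "\<bar>v x - u y\<bar> powr r \<le> \<bar>u x - u y\<bar> powr r + r * w x * w y powr (r - 1)"
      unfolding v_def
      using r cutoff_bounds[of x0 \<rho> \<rho>' x] powr_le1[of q "?\<zeta> x"]
      by (intro truncation_far) (auto simp: w_def)
    ultimately show ?thesis using xy y sub by (simp add: truncation_error_def)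
  qed
  fix x y
  have symL: "?L x y = ?L y x" for x y
    by (simp add: abs_minus_commute mult.commute mult.left_commute)
  have symu: "\<bar>u x - u y\<bar> powr r + ?E x y = \<bar>u y - u x\<bar> powr r + ?E y x" for x y
    by (simp add: abs_minus_commute truncation_error_sym[of q x0 \<rho> \<rho>' w r x y])
  consider "x \<in> ball x0 \<rho>'" "y \<in> ball x0 \<rho>'" "?\<zeta> y \<le> ?\<zeta> x"
    | "x \<in> ball x0 \<rho>'" "y \<in> ball x0 \<rho>'" "?\<zeta> x \<le> ?\<zeta> y"
    | "x \<in> ball x0 ((\<rho> + \<rho>') / 2)" "y \<notin> ball x0 \<rho>'"
    | "y \<in> ball x0 ((\<rho> + \<rho>') / 2)" "x \<notin> ball x0 \<rho>'"
    | "x \<notin> ball x0 ((\<rho> + \<rho>') / 2)" "y \<notin> ball x0 ((\<rho> + \<rho>') / 2)"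
    using sub linorder_le_cases by blast
  then show "?L x y \<le> \<bar>u x - u y\<bar> powr r + ?E x y"
  proof cases
    case 1
    then show ?thesis by (rule near)
  next
    case 2
    then show ?thesis unfolding symL[of x y] symu[of x y] by (intro near)
  next
    case 3
    then show ?thesis by (rule far)
  next
    case 4
    then show ?thesis unfolding symL[of x y] symu[of x y] by (intro far)
  next
    case 5
    then have "v x = u x" "v y = u y" using cutoff_eq_0[OF \<rho>] by (auto simp: v_def)
    moreover have "x \<notin> ball x0 \<rho>" using 5 sub2 by blast
    ultimately show ?thesis using E0[of x y] by simp
  qed
qed

text \<open>For the diagonal, where the kernel bounds say nothing and every term has to
  vanish.\<close>

lemma truncation_error_same: "\<rho> < \<rho>' \<Longrightarrow> truncation_error q x0 \<rho> \<rho>' w r x x = 0"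
  by (auto simp: truncation_error_def indicator_def field_simps)

lemma borel_measurable_truncation_error [measurable]:
  fixes w :: "'a::{metric_space, second_countable_topology} \<Rightarrow> real"
  assumes [measurable]: "w \<in> borel_measurable borel"
  shows "(\<lambda>z. truncation_error q x0 \<rho> \<rho>' w r (fst z) (snd z)) \<in> borel_measurable (borel \<Otimes>\<^sub>M borel)"
  unfolding truncation_error_def by measurable

text \<open>The two energies keep the true kernel \<open>K\<close>, as minimality requires. Only the
  gain and the error pass to the model kernel \<open>P\<close>, by the lower and the upper bound
  respectively.\<close>

lemma kernel_comparison:
  fixes U V G B K P \<Lambda> :: real
  assumes "V + G \<le> U + B" "0 \<le> G" "0 \<le> B" "1 \<le> \<Lambda>" "inverse \<Lambda> * P \<le> K" "K \<le> \<Lambda> * P" "0 \<le> P"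
  shows "V * K + inverse \<Lambda> * (G * P) \<le> U * K + \<Lambda> * (B * P)"
proof -
  have "0 \<le> K" using assms by (smt (verit) mult_nonneg_nonneg inverse_nonnegative_iff_nonnegative)
  then have "(V + G) * K \<le> (U + B) * K" using assms by (intro mult_right_mono) auto
  moreover have "G * (inverse \<Lambda> * P) \<le> G * K" "B * K \<le> B * (\<Lambda> * P)"
    using assms by (auto intro: mult_left_mono)
  ultimately show ?thesis by (simp add: algebra_simps)
qed

text \<open>Comparing a minimizer with \<open>u - \<zeta>\<^sup>q (u - k)\<^sub>+\<close> gives a Caccioppoli inequality
  directly, by convexity, without the Euler-Lagrange equation.\<close>

lemma minimizer_truncation:
  fixes u :: "real^'n \<Rightarrow> real" and s t p q k \<Lambda> :: real and x0 :: "real^'n"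
  assumes A1: "0 < s" "s < 1" "0 < t" "t < 1" "1 < p" "p \<le> q" and \<Lambda>: "1 \<le> \<Lambda>"
    and \<Omega>: "open \<Omega>"
    and K: "comparable_kernel \<Lambda> (s * p) Ksp" "comparable_kernel \<Lambda> (t * q) Ktq"
    and a: "coefficient \<Omega> a"
    and u[measurable]: "u \<in> borel_measurable borel" and min: "is_minimizer s t p q Ksp Ktq a \<Omega> u"
    and k: "0 \<le> k" and \<rho>: "\<rho> < \<rho>'" and sub: "ball x0 \<rho>' \<subseteq> \<Omega>"
  defines "w \<equiv> \<lambda>x. max (u x - k) 0"
  defines "P \<equiv> \<lambda>x y :: real^'n. norm (x - y) powr (- (real CARD('n) + s * p))"
  defines "Q \<equiv> \<lambda>x y :: real^'n. norm (x - y) powr (- (real CARD('n) + t * q))"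
  shows "(\<integral>\<^sup>+z. ennreal (indicator (ball x0 \<rho>) (fst z) * indicator (ball x0 \<rho>) (snd z) *
        (\<bar>w (fst z) - w (snd z)\<bar> powr p * P (fst z) (snd z)
          + a (fst z) (snd z) * (\<bar>w (fst z) - w (snd z)\<bar> powr q * Q (fst z) (snd z)))) \<partial>lborel)
    \<le> ennreal (\<Lambda>\<^sup>2) * (\<integral>\<^sup>+z. ennreal (truncation_error q x0 \<rho> \<rho>' w p (fst z) (snd z) * P (fst z) (snd z)
          + a (fst z) (snd z) * (truncation_error q x0 \<rho> \<rho>' w q (fst z) (snd z) * Q (fst z) (snd z))) \<partial>lborel)"
    (is "(\<integral>\<^sup>+z. ennreal (?g z) \<partial>lborel) \<le> ennreal (\<Lambda>\<^sup>2) * (\<integral>\<^sup>+z. ennreal (?b z) \<partial>lborel)")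
proof -
  define L where "L = (lebesgue :: ((real^'n) \<times> (real^'n)) measure)"
  define v where "v = (\<lambda>x. u x - cutoff x0 \<rho> \<rho>' x powr q * w x)"
  define C where "C = C_dom \<Omega>"
  define e where "e = (\<lambda>f z. \<bar>f (fst z) - f (snd z)\<bar> powr p * Ksp (fst z) (snd z)
      + a (fst z) (snd z) * (\<bar>f (fst z) - f (snd z)\<bar> powr q * Ktq (fst z) (snd z)))"
  define e0 where "e0 = (\<lambda>f z. \<bar>f (fst z) - f (snd z)\<bar> powr p * P (fst z) (snd z)
      + a (fst z) (snd z) * (\<bar>f (fst z) - f (snd z)\<bar> powr q * Q (fst z) (snd z)))"
  define Ep where "Ep = truncation_error q x0 \<rho> \<rho>' w p"
  define Eq where "Eq = truncation_error q x0 \<rho> \<rho>' w q"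
  define Gp where "Gp = (\<lambda>x y. indicator (ball x0 \<rho>) x * indicator (ball x0 \<rho>) y * \<bar>w x - w y\<bar> powr p)"
  define Gq where "Gq = (\<lambda>x y. indicator (ball x0 \<rho>) x * indicator (ball x0 \<rho>) y * \<bar>w x - w y\<bar> powr q)"
  have g_eq: "?g z = Gp (fst z) (snd z) * P (fst z) (snd z) + a (fst z) (snd z) * (Gq (fst z) (snd z) * Q (fst z) (snd z))" for z
    by (simp add: Gp_def Gq_def algebra_simps)
  have w0: "0 \<le> w x" for x by (simp add: w_def)
  have a0: "0 \<le> a x y" for x y using a by (auto simp: coefficient_def)
  have q1: "1 < q" using A1 by simp
  have E0: "0 \<le> Ep x y" "0 \<le> Eq x y" for x y
    using w0 A1 unfolding Ep_def Eq_def by (auto intro: truncation_error_nonneg)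
  have G0: "0 \<le> Gp x y" "0 \<le> Gq x y" for x y by (auto simp: Gp_def Gq_def)
  have P0: "0 \<le> P x y" "0 \<le> Q x y" for x y by (auto simp: P_def Q_def)
  have trp: "\<bar>v x - v y\<bar> powr p + Gp x y \<le> \<bar>u x - u y\<bar> powr p + Ep x y" for x y
    unfolding v_def w_def Gp_def Ep_def by (rule truncation_pointwise) (use A1 \<rho> in auto)
  have trq: "\<bar>v x - v y\<bar> powr q + Gq x y \<le> \<bar>u x - u y\<bar> powr q + Eq x y" for x y
    unfolding v_def w_def Gq_def Eq_def by (rule truncation_pointwise) (use A1 \<rho> in auto)
  have Kb: "inverse \<Lambda> * P x y \<le> Ksp x y" "Ksp x y \<le> \<Lambda> * P x y"
    "inverse \<Lambda> * Q x y \<le> Ktq x y" "Ktq x y \<le> \<Lambda> * Q x y" if "x \<noteq> y" for x y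
    using K that by (auto simp: comparable_kernel_def P_def Q_def)
  have EP: "e v z + inverse \<Lambda> * ?g z \<le> e u z + \<Lambda> * ?b z" for z
  proof (cases "fst z = snd z")
    case True
    then show ?thesis using \<rho> A1 by (simp add: e_def truncation_error_same)
  next
    case False
    define x y where xy: "x = fst z" "y = snd z"
    have ne: "x \<noteq> y" using False xy by simp
    have "\<bar>v x - v y\<bar> powr p * Ksp x y + inverse \<Lambda> * (Gp x y * P x y)
        \<le> \<bar>u x - u y\<bar> powr p * Ksp x y + \<Lambda> * (Ep x y * P x y)"
      by (rule kernel_comparison) (use trp E0 G0 \<Lambda> Kb[OF ne] P0 in auto)
    moreover have "a x y * (\<bar>v x - v y\<bar> powr q * Ktq x y + inverse \<Lambda> * (Gq x y * Q x y))
        \<le> a x y * (\<bar>u x - u y\<bar> powr q * Ktq x y + \<Lambda> * (Eq x y * Q x y))"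
      by (intro mult_left_mono kernel_comparison) (use trq E0 G0 \<Lambda> Kb[OF ne] P0 a0 in auto)
    ultimately show ?thesis unfolding g_eq
      by (simp add: e_def xy Ep_def Eq_def algebra_simps)
  qed
  \<comment> \<open>The same comparison with the model kernels, in terms of which
    \<open>A_space\<close> is defined; it serves to show that \<open>v\<close> is
    admissible.\<close>
  have EP0: "e0 v z + ?g z \<le> e0 u z + ?b z" for z
  proof -
    define x y where xy: "x = fst z" "y = snd z"
    have "(\<bar>v x - v y\<bar> powr p + Gp x y) * P x y \<le> (\<bar>u x - u y\<bar> powr p + Ep x y) * P x y"
      using trp P0 by (intro mult_right_mono) auto
    moreover have "a x y * ((\<bar>v x - v y\<bar> powr q + Gq x y) * Q x y)
        \<le> a x y * ((\<bar>u x - u y\<bar> powr q + Eq x y) * Q x y)"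
      using trq P0 a0 by (intro mult_left_mono mult_right_mono) auto
    ultimately show ?thesis unfolding g_eq
      by (simp add: e0_def xy Ep_def Eq_def algebra_simps)
  qed
  have e_le: "e u z \<le> \<Lambda> * e0 u z" for z
  proof (cases "fst z = snd z")
    case True
    then show ?thesis using A1 by (simp add: e_def e0_def)
  next
    case False
    define x y where xy: "x = fst z" "y = snd z"
    have "\<bar>u x - u y\<bar> powr p * Ksp x y \<le> \<bar>u x - u y\<bar> powr p * (\<Lambda> * P x y)"
      "a x y * (\<bar>u x - u y\<bar> powr q * Ktq x y) \<le> a x y * (\<bar>u x - u y\<bar> powr q * (\<Lambda> * Q x y))"
      using Kb(2,4)[of x y] False xy a0 by (auto intro!: mult_left_mono)
    then show ?thesis by (simp add: e_def e0_def xy algebra_simps)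
  qed
  have nn: "0 \<le> e0 f z" "0 \<le> ?g z" "0 \<le> ?b z" for f z
    using a0 P0 E0 G0 unfolding g_eq by (auto simp: e0_def simp flip: Ep_def Eq_def)
  have e_nn: "0 \<le> e f z" for f z
  proof (cases "fst z = snd z")
    case False
    then have "0 \<le> Ksp (fst z) (snd z)" "0 \<le> Ktq (fst z) (snd z)"
      using Kb(1,3)[of "fst z" "snd z"] P0[of "fst z" "snd z"] \<Lambda>
      by (smt (verit) inverse_nonnegative_iff_nonnegative mult_nonneg_nonneg)+
    then show ?thesis using a0 by (simp add: e_def)
  qed (simp add: e_def)
  have [measurable]: "w \<in> borel_measurable borel" "v \<in> borel_measurable borel"
    unfolding v_def w_def by measurable
  have Lborel: "f \<in> borel_measurable L" if "f \<in> borel_measurable (borel \<Otimes>\<^sub>M borel)" for f :: "(real^'n) \<times> (real^'n) \<Rightarrow> real"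
    unfolding L_def using that by (intro measurable_completion) (simp add: borel_prod)
  have [measurable]: "(\<lambda>z. Ksp (fst z) (snd z)) \<in> borel_measurable L" "(\<lambda>z. Ktq (fst z) (snd z)) \<in> borel_measurable L"
    "(\<lambda>z. a (fst z) (snd z)) \<in> borel_measurable L"
    using K a by (simp_all add: comparable_kernel_def coefficient_def L_def case_prod_unfold)
  have [measurable]: "(\<lambda>z. P (fst z) (snd z)) \<in> borel_measurable L"
    unfolding P_def by (rule Lborel) measurable
  have [measurable]: "(\<lambda>z. Q (fst z) (snd z)) \<in> borel_measurable L"
    unfolding Q_def by (rule Lborel) measurable
  have [measurable]: "(\<lambda>z. Ep (fst z) (snd z)) \<in> borel_measurable L"
    unfolding Ep_def by (intro Lborel borel_measurable_truncation_error) fact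
  have [measurable]: "(\<lambda>z. Eq (fst z) (snd z)) \<in> borel_measurable L"
    unfolding Eq_def by (intro Lborel borel_measurable_truncation_error) fact
  have [measurable]: "(\<lambda>z. Gp (fst z) (snd z)) \<in> borel_measurable L"
    unfolding Gp_def by (rule Lborel) measurable
  have [measurable]: "(\<lambda>z. Gq (fst z) (snd z)) \<in> borel_measurable L"
    unfolding Gq_def by (rule Lborel) measurable
  have pow[measurable]: "(\<lambda>z. \<bar>f (fst z) - f (snd z)\<bar> powr c) \<in> borel_measurable L"
    if [measurable]: "f \<in> borel_measurable borel" for f :: "real^'n \<Rightarrow> real" and c
    by (rule Lborel) measurable
  have [measurable]: "e v \<in> borel_measurable L" "e u \<in> borel_measurable L" "e0 u \<in> borel_measurable L" "e0 v \<in> borel_measurable L"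
    unfolding e_def e0_def by measurable
  have [measurable]: "?b \<in> borel_measurable L" unfolding Ep_def[symmetric] Eq_def[symmetric] by measurable
  have [measurable]: "?g \<in> borel_measurable L" unfolding g_eq by measurable
  have C[measurable]: "C \<in> sets L"
  proof -
    have "closed ((UNIV - \<Omega>) \<times> (UNIV - \<Omega>))"
      using \<Omega> by (intro closed_Times) (auto simp: Compl_eq_Diff_UNIV[symmetric])
    then show ?thesis
      unfolding C_def C_dom_def L_def by (intro sets_completionI_sets) auto
  qed
  define Bd where "Bd = (\<integral>\<^sup>+z. ennreal (?b z) \<partial>L)"
  define Gd where "Gd = (\<integral>\<^sup>+z\<in>C. ennreal (?g z) \<partial>L)"
  have Bd_C: "(\<integral>\<^sup>+z\<in>C. ennreal (?b z) \<partial>L) \<le> Bd"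
    unfolding Bd_def by (intro nn_integral_mono) (auto split: split_indicator)
  have Gd_eq: "Gd = (\<integral>\<^sup>+z. ennreal (?g z) \<partial>L)"
    unfolding Gd_def
  proof (intro nn_integral_cong)
    fix z
    show "ennreal (?g z) * indicator C z = ennreal (?g z)"
    proof (cases "fst z \<in> ball x0 \<rho>")
      case True
      then have "fst z \<in> \<Omega>" using sub \<rho> by (auto simp: subset_iff)
      then have "z \<in> C" by (cases z) (simp add: C_def C_dom_def)
      then show ?thesis by simp
    qed simp
  qed
  have F_e: "F_energy p q Ksp Ktq a \<Omega> f = (\<integral>\<^sup>+z\<in>C. ennreal (e f z) \<partial>L)" for f
    unfolding F_energy_def C_def L_def e_def by (simp add: split_beta mult.assoc)
  have A_e: "f \<in> A_space s t p q a \<Omega> \<longleftrightarrow> f \<in> borel_measurable lebesgue \<and>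
      (\<integral>\<^sup>+x\<in>\<Omega>. ennreal (\<bar>f x\<bar> powr p) \<partial>lebesgue) < \<infinity> \<and> (\<integral>\<^sup>+z\<in>C. ennreal (e0 f z) \<partial>L) < \<infinity>" for f
    unfolding A_space_def C_def L_def e0_def P_def Q_def
    by (simp add: split_beta divide_inverse flip: powr_minus)
  have uA: "u \<in> A_space s t p q a \<Omega>" using min by (simp add: is_minimizer_def)
  have "Gd \<le> ennreal (\<Lambda>\<^sup>2) * Bd"
  \<comment> \<open>An infinite right-hand side makes the claim trivial; a finite one gives the
    competitor finite energy.\<close>
  proof (cases "Bd = \<infinity>")
    case True
    then show ?thesis using \<Lambda> by (simp add: ennreal_mult_top)
  next
    case False
    have e0v: "(\<integral>\<^sup>+z\<in>C. ennreal (e0 v z) \<partial>L) < \<infinity>"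
    proof -
      have "(\<integral>\<^sup>+z\<in>C. ennreal (e0 v z) \<partial>L)
          \<le> (\<integral>\<^sup>+z. ennreal (e0 u z) * indicator C z + ennreal (?b z) * indicator C z \<partial>L)"
      proof (intro nn_integral_mono)
        fix z
        have "e0 v z \<le> e0 u z + ?b z" using EP0[of z] nn(2)[of z] by linarith
        then have "ennreal (e0 v z) \<le> ennreal (e0 u z) + ennreal (?b z)"
          using nn(1)[of u z] nn(3)[of z] by (simp flip: ennreal_plus)
        then show "ennreal (e0 v z) * indicator C z
            \<le> ennreal (e0 u z) * indicator C z + ennreal (?b z) * indicator C z"
          by (auto split: split_indicator)
      qed
      also have "\<dots> = (\<integral>\<^sup>+z\<in>C. ennreal (e0 u z) \<partial>L) + (\<integral>\<^sup>+z\<in>C. ennreal (?b z) \<partial>L)"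
        by (rule nn_integral_add) measurable
      also have "\<dots> < \<infinity>"
        using uA Bd_C False unfolding A_e by (auto simp: less_top intro: le_less_trans)
      finally show ?thesis .
    qed
    \<comment> \<open>As \<open>k \<ge> 0\<close>, values are only lowered where they exceed a
      nonnegative level, and never below it. Hence \<open>v\<close> inherits p-integrability from
      \<open>u\<close>.\<close>
    have vu: "\<bar>v x\<bar> \<le> \<bar>u x\<bar>" for x
    proof -
      have "0 \<le> cutoff x0 \<rho> \<rho>' x powr q" "cutoff x0 \<rho> \<rho>' x powr q \<le> 1"
        using cutoff_bounds[of x0 \<rho> \<rho>' x] q1 by (auto intro: powr_le1)
      then have "0 \<le> cutoff x0 \<rho> \<rho>' x powr q * w x" "cutoff x0 \<rho> \<rho>' x powr q * w x \<le> w x"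
        using w0[of x] by (auto intro: mult_left_le_one_le)
      moreover have "w x = 0 \<or> w x = u x - k \<and> k < u x" by (auto simp: w_def)
      ultimately show ?thesis using k unfolding v_def by argo
    qed
    have "(\<integral>\<^sup>+x\<in>\<Omega>. ennreal (\<bar>v x\<bar> powr p) \<partial>lebesgue) \<le> (\<integral>\<^sup>+x\<in>\<Omega>. ennreal (\<bar>u x\<bar> powr p) \<partial>lebesgue)"
      using vu A1 by (intro nn_integral_mono mult_right_mono ennreal_leI powr_mono2) auto
    then have vA: "v \<in> A_space s t p q a \<Omega>"
      using uA e0v unfolding A_e by (auto intro: measurable_completion le_less_trans)
    have "v x = u x" if "x \<notin> \<Omega>" for x
    proof -
      have "x \<notin> ball x0 ((\<rho> + \<rho>') / 2)" using that sub \<rho> by (auto simp: subset_iff field_simps)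
      then show ?thesis by (simp add: v_def cutoff_eq_0[OF \<rho>])
    qed
    then have Fuv: "F_energy p q Ksp Ktq a \<Omega> u \<le> F_energy p q Ksp Ktq a \<Omega> v"
      using min vA by (auto simp: is_minimizer_def)
    have "F_energy p q Ksp Ktq a \<Omega> u \<le> (\<integral>\<^sup>+z. ennreal \<Lambda> * (ennreal (e0 u z) * indicator C z) \<partial>L)"
      unfolding F_e
    proof (intro nn_integral_mono)
      fix z
      show "ennreal (e u z) * indicator C z \<le> ennreal \<Lambda> * (ennreal (e0 u z) * indicator C z)"
        using e_le[of z] \<Lambda> nn(1)[of u z] by (auto split: split_indicator intro: ennreal_leI simp flip: ennreal_mult)
    qed
    also have "\<dots> = ennreal \<Lambda> * (\<integral>\<^sup>+z\<in>C. ennreal (e0 u z) \<partial>L)"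
      by (rule nn_integral_cmult) measurable
    also have "\<dots> < \<infinity>" using uA unfolding A_e by (auto simp: ennreal_mult_less_top)
    finally have Fu: "F_energy p q Ksp Ktq a \<Omega> u < \<infinity>" .
    have "F_energy p q Ksp Ktq a \<Omega> v + ennreal (inverse \<Lambda>) * Gd
        = (\<integral>\<^sup>+z. ennreal (e v z) * indicator C z + ennreal (inverse \<Lambda>) * (ennreal (?g z) * indicator C z) \<partial>L)"
      unfolding F_e Gd_def by (subst nn_integral_add) (auto simp: nn_integral_cmult)
    also have "\<dots> \<le> (\<integral>\<^sup>+z. ennreal (e u z) * indicator C z + ennreal \<Lambda> * (ennreal (?b z) * indicator C z) \<partial>L)"
    proof (intro nn_integral_mono)
      fix z
      have "ennreal (e v z) + ennreal (inverse \<Lambda>) * ennreal (?g z) \<le> ennreal (e u z) + ennreal \<Lambda> * ennreal (?b z)"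
        using EP[of z] \<Lambda> nn(2,3)[of z] e_nn[of u z] e_nn[of v z]
        by (simp flip: ennreal_mult ennreal_plus del: inverse_eq_divide)
      then show "ennreal (e v z) * indicator C z + ennreal (inverse \<Lambda>) * (ennreal (?g z) * indicator C z)
          \<le> ennreal (e u z) * indicator C z + ennreal \<Lambda> * (ennreal (?b z) * indicator C z)"
        by (auto split: split_indicator)
    qed
    also have "\<dots> = F_energy p q Ksp Ktq a \<Omega> u + ennreal \<Lambda> * (\<integral>\<^sup>+z\<in>C. ennreal (?b z) \<partial>L)"
      unfolding F_e by (subst nn_integral_add) (auto simp: nn_integral_cmult)
    also have "\<dots> \<le> F_energy p q Ksp Ktq a \<Omega> u + ennreal \<Lambda> * Bd"
      using Bd_C by (intro add_left_mono mult_left_mono) auto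
    finally have main: "F_energy p q Ksp Ktq a \<Omega> v + ennreal (inverse \<Lambda>) * Gd
        \<le> F_energy p q Ksp Ktq a \<Omega> u + ennreal \<Lambda> * Bd" .
    also have "\<dots> \<le> F_energy p q Ksp Ktq a \<Omega> v + ennreal \<Lambda> * Bd"
      using Fuv by (intro add_right_mono)
    finally have *: "F_energy p q Ksp Ktq a \<Omega> v + ennreal (inverse \<Lambda>) * Gd
        \<le> F_energy p q Ksp Ktq a \<Omega> v + ennreal \<Lambda> * Bd" .
    \<comment> \<open>Finiteness of the energy of \<open>v\<close>, which is about to be cancelled
      from both sides in \<open>ennreal\<close>.\<close>
    have "F_energy p q Ksp Ktq a \<Omega> v \<le> F_energy p q Ksp Ktq a \<Omega> u + ennreal \<Lambda> * Bd"
      using main by (rule order_trans[rotated]) simp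
    also have "\<dots> < \<infinity>" using Fu False by (simp add: ennreal_mult_less_top less_top)
    finally have "ennreal (inverse \<Lambda>) * Gd \<le> ennreal \<Lambda> * Bd"
      using * by (auto simp: ennreal_add_left_cancel_le)
    then have "ennreal \<Lambda> * (ennreal (inverse \<Lambda>) * Gd) \<le> ennreal \<Lambda> * (ennreal \<Lambda> * Bd)"
      by (intro mult_left_mono) auto
    moreover have "ennreal \<Lambda> * ennreal (inverse \<Lambda>) = 1"
      using \<Lambda> by (simp flip: ennreal_mult)
    ultimately show ?thesis using \<Lambda>
      by (simp add: mult.assoc[symmetric] power2_eq_square ennreal_mult)
  qed
  then show ?thesis unfolding Gd_eq Bd_def L_def nn_integral_completion .
qed

section \<open>Integration of the truncation error\<close>

lemma nn_integral_lborel_pair: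
  fixes f :: "'a::euclidean_space \<times> 'a \<Rightarrow> ennreal"
  assumes [measurable]: "f \<in> borel_measurable (borel \<Otimes>\<^sub>M borel)"
  shows "(\<integral>\<^sup>+z. f z \<partial>lborel) = (\<integral>\<^sup>+x. \<integral>\<^sup>+y. f (x, y) \<partial>lborel \<partial>lborel)"
  unfolding lborel_prod[symmetric] by (rule lborel.nn_integral_fst[symmetric]) measurable

lemma nn_integral_lborel_swap:
  fixes f :: "'a::euclidean_space \<times> 'a \<Rightarrow> ennreal"
  assumes [measurable]: "f \<in> borel_measurable (borel \<Otimes>\<^sub>M borel)"
  shows "(\<integral>\<^sup>+z. f (snd z, fst z) \<partial>lborel) = (\<integral>\<^sup>+z. f z \<partial>lborel)"
proof -
  have "(\<integral>\<^sup>+z. f (snd z, fst z) \<partial>lborel) = (\<integral>\<^sup>+x. \<integral>\<^sup>+y. f (y, x) \<partial>lborel \<partial>lborel)"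
    by (subst nn_integral_lborel_pair) auto
  also have "\<dots> = (\<integral>\<^sup>+z. f z \<partial>(lborel \<Otimes>\<^sub>M lborel))"
    by (rule lborel_pair.nn_integral_snd) measurable
  finally show ?thesis by (simp only: lborel_prod)
qed

text \<open>The Lipschitz bound of the cutoff supplies \<open>dist x y powr r\<close>, which makes
  the kernel of order \<open>\<sigma> < r\<close> integrable over a ball of radius
  \<open>2 * \<rho>'\<close> around \<open>x\<close>. The result has the factor
  \<open>\<rho>' / (\<rho>' - \<rho>)\<close> to the power \<open>r\<close>, raised to
  \<open>n + q\<close> to have one exponent for all error terms.\<close>

lemma truncation_error_near:
  fixes q r \<sigma> :: real
  defines "n \<equiv> real DIM('a::euclidean_space)"
  assumes r: "0 < r" "r \<le> q" and \<sigma>: "\<sigma> < r"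
  shows "\<exists>C>0. \<forall>(x0::'a) \<rho> \<rho>' g. 0 < \<rho> \<longrightarrow> \<rho> < \<rho>' \<longrightarrow> g \<in> borel_measurable borel \<longrightarrow> (\<forall>x. 0 \<le> g x) \<longrightarrow>
    (\<integral>\<^sup>+z. ennreal (indicator (ball x0 \<rho>') (fst z) * indicator (ball x0 \<rho>') (snd z)
        * (2 * q / (\<rho>' - \<rho>) * dist (fst z) (snd z)) powr r
        * (indicator (- ball x0 \<rho>) (fst z) * g (fst z)) * dist (fst z) (snd z) powr (- (n + \<sigma>))) \<partial>lborel)
    \<le> ennreal (C * (\<rho>' / (\<rho>' - \<rho>)) powr (n + q)) *
      (\<integral>\<^sup>+x\<in>ball x0 \<rho>' - ball x0 \<rho>. ennreal (\<rho>' powr (- \<sigma>) * g x) \<partial>lborel)"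
proof -
  obtain C0 where C0: "0 < C0" and pot: "\<And>(x::'a) \<rho>. 0 < \<rho> \<Longrightarrow>
      (\<integral>\<^sup>+y\<in>ball x \<rho>. ennreal (dist x y powr (r - \<sigma> - n)) \<partial>lborel) \<le> ennreal (C0 * \<rho> powr (r - \<sigma>))"
    using nn_integral_dist_powr_ball[of "r - \<sigma>"] \<sigma> unfolding n_def by auto
  have n: "1 \<le> n" by (simp add: n_def Suc_leI)
  define C where "C = (2 * q) powr r * C0 * 2 powr (r - \<sigma>)"
  have C: "0 < C" using C0 r by (simp add: C_def)
  have "(\<integral>\<^sup>+z. ennreal (indicator (ball x0 \<rho>') (fst z) * indicator (ball x0 \<rho>') (snd z)
        * (2 * q / (\<rho>' - \<rho>) * dist (fst z) (snd z)) powr r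
        * (indicator (- ball x0 \<rho>) (fst z) * g (fst z)) * dist (fst z) (snd z) powr (- (n + \<sigma>))) \<partial>lborel)
    \<le> ennreal (C * (\<rho>' / (\<rho>' - \<rho>)) powr (n + q)) *
      (\<integral>\<^sup>+x\<in>ball x0 \<rho>' - ball x0 \<rho>. ennreal (\<rho>' powr (- \<sigma>) * g x) \<partial>lborel)" (is "?l \<le> ?r")
    if \<rho>: "0 < \<rho>" "\<rho> < \<rho>'" and g[measurable]: "g \<in> borel_measurable borel" and g0: "\<And>x. 0 \<le> g x"
    for x0 :: 'a and \<rho> \<rho>' g
  proof -
    define A where "A = 2 * q / (\<rho>' - \<rho>)"
    have A: "0 < A" using \<rho> r by (simp add: A_def)
    have [measurable]: "ball x0 \<rho>' - ball x0 \<rho> \<in> sets borel" by simp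
    have "?l = (\<integral>\<^sup>+x. \<integral>\<^sup>+y. ennreal (indicator (ball x0 \<rho>') x * indicator (ball x0 \<rho>') y
        * (A * dist x y) powr r * (indicator (- ball x0 \<rho>) x * g x) * dist x y powr (- (n + \<sigma>))) \<partial>lborel \<partial>lborel)"
      unfolding A_def[symmetric] by (subst nn_integral_lborel_pair) auto
    also have "\<dots> \<le> (\<integral>\<^sup>+x. ennreal (C * (\<rho>' / (\<rho>' - \<rho>)) powr (n + q)) *
        (ennreal (\<rho>' powr (- \<sigma>) * g x) * indicator (ball x0 \<rho>' - ball x0 \<rho>) x) \<partial>lborel)"
    proof (intro nn_integral_mono)
      fix x :: 'a
      show "(\<integral>\<^sup>+y. ennreal (indicator (ball x0 \<rho>') x * indicator (ball x0 \<rho>') y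
        * (A * dist x y) powr r * (indicator (- ball x0 \<rho>) x * g x) * dist x y powr (- (n + \<sigma>))) \<partial>lborel)
        \<le> ennreal (C * (\<rho>' / (\<rho>' - \<rho>)) powr (n + q)) *
        (ennreal (\<rho>' powr (- \<sigma>) * g x) * indicator (ball x0 \<rho>' - ball x0 \<rho>) x)"
      proof (cases "x \<in> ball x0 \<rho>' - ball x0 \<rho>")
        case True
        have "(\<integral>\<^sup>+y. ennreal (indicator (ball x0 \<rho>') x * indicator (ball x0 \<rho>') y
            * (A * dist x y) powr r * (indicator (- ball x0 \<rho>) x * g x) * dist x y powr (- (n + \<sigma>))) \<partial>lborel)
          \<le> (\<integral>\<^sup>+y. ennreal (A powr r * g x) * (ennreal (dist x y powr (r - \<sigma> - n)) * indicator (ball x (2 * \<rho>')) y) \<partial>lborel)"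
        proof (intro nn_integral_mono)
          fix y
          show "ennreal (indicator (ball x0 \<rho>') x * indicator (ball x0 \<rho>') y
            * (A * dist x y) powr r * (indicator (- ball x0 \<rho>) x * g x) * dist x y powr (- (n + \<sigma>)))
            \<le> ennreal (A powr r * g x) * (ennreal (dist x y powr (r - \<sigma> - n)) * indicator (ball x (2 * \<rho>')) y)"
          proof (cases "y \<in> ball x0 \<rho>'")
            case y: True
            then have "y \<in> ball x (2 * \<rho>')"
              using True dist_triangle[of x y x0] by (simp add: dist_commute)
            moreover have "dist x y powr r * dist x y powr (- (n + \<sigma>)) = dist x y powr (r - \<sigma> - n)"
              by (simp add: algebra_simps flip: powr_add)
            ultimately show ?thesis using True y g0[of x] A
              by (simp add: powr_mult mult_ac flip: ennreal_mult)
          qed simp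
        qed
        also have "\<dots> = ennreal (A powr r * g x) * (\<integral>\<^sup>+y\<in>ball x (2 * \<rho>'). ennreal (dist x y powr (r - \<sigma> - n)) \<partial>lborel)"
          by (rule nn_integral_cmult) measurable
        also have "\<dots> \<le> ennreal (A powr r * g x) * ennreal (C0 * (2 * \<rho>') powr (r - \<sigma>))"
          using \<rho> by (intro mult_left_mono pot) auto
        also have "\<dots> = ennreal (A powr r * C0 * (2 * \<rho>') powr (r - \<sigma>) * g x)"
          using g0[of x] C0 by (simp add: mult_ac flip: ennreal_mult)
        also have "A powr r * C0 * (2 * \<rho>') powr (r - \<sigma>) \<le> C * (\<rho>' / (\<rho>' - \<rho>)) powr (n + q) * \<rho>' powr (- \<sigma>)"
        proof -
          have "A powr r * C0 * (2 * \<rho>') powr (r - \<sigma>) = C * ((1 / (\<rho>' - \<rho>)) powr r * \<rho>' powr (r - \<sigma>))"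
          proof -
            have "A powr r = (2 * q) powr r * (1 / (\<rho>' - \<rho>)) powr r"
              by (simp add: A_def flip: powr_mult)
            then show ?thesis by (simp add: C_def powr_mult mult_ac)
          qed
          also have "(1 / (\<rho>' - \<rho>)) powr r * \<rho>' powr (r - \<sigma>) = (\<rho>' / (\<rho>' - \<rho>)) powr r * \<rho>' powr (- \<sigma>)"
          proof -
            have "\<rho>' powr (r - \<sigma>) = \<rho>' powr r * \<rho>' powr (- \<sigma>)" by (simp flip: powr_add)
            moreover have "(1 / (\<rho>' - \<rho>)) powr r * \<rho>' powr r = (\<rho>' / (\<rho>' - \<rho>)) powr r"
              by (simp flip: powr_mult)
            ultimately show ?thesis by simp
          qed
          also have "C * ((\<rho>' / (\<rho>' - \<rho>)) powr r * \<rho>' powr (- \<sigma>)) \<le> C * ((\<rho>' / (\<rho>' - \<rho>)) powr (n + q) * \<rho>' powr (- \<sigma>))"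
            using C n r \<rho> by (intro mult_left_mono mult_right_mono powr_mono) auto
          finally show ?thesis by (simp add: mult_ac)
        qed
        finally show ?thesis using True g0[of x] C
          by (auto simp: mult_ac simp flip: ennreal_mult intro: ennreal_leI mult_right_mono mult_left_mono)
      qed (auto simp: indicator_def)
    qed
    also have "\<dots> = ?r" by (rule nn_integral_cmult) measurable
    finally show ?thesis .
  qed
  then show ?thesis using C by blast
qed

text \<open>For \<open>x\<close> in the support of the cutoff and \<open>y\<close> outside the
  larger ball, \<open>dist x y\<close> is at least \<open>dist x0 y / X\<close> with
  \<open>X = 2 * \<rho>' / (\<rho>' - \<rho>)\<close>, so the inner integral becomes a tail centred
  at \<open>x0\<close>. The weight \<open>b\<close> is 1 for the first phase and a Borel version of
  the coefficient for the second. The latter agrees with the coefficient only almost everywhere;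
  therefore the tail bound is assumed for almost every \<open>x\<close>.\<close>

lemma truncation_error_far:
  fixes x0 :: "'a::euclidean_space" and T :: ennreal
  defines "n \<equiv> real DIM('a)"
  assumes r: "1 < r" and \<sigma>: "0 < \<sigma>" "\<sigma> \<le> q" and \<rho>: "0 < r0" "r0 \<le> \<rho>" "\<rho> < \<rho>'" "\<rho>' \<le> r1" and k: "0 \<le> k"
    and u[measurable]: "u \<in> borel_measurable borel"
    and b[measurable]: "b \<in> borel_measurable (borel \<Otimes>\<^sub>M borel)" and b0: "\<And>z. 0 \<le> b z"
    and T: "AE x in lborel. x \<in> ball x0 r1 \<longrightarrow>
      (\<integral>\<^sup>+y\<in>UNIV - ball x0 r0. ennreal (b (x, y) * (\<bar>u y\<bar> powr (r - 1) * dist x0 y powr (- (n + \<sigma>)))) \<partial>lborel) \<le> T"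
  defines "w \<equiv> \<lambda>x. max (u x - k) 0"
  shows "(\<integral>\<^sup>+z. ennreal (b z * (indicator (ball x0 ((\<rho> + \<rho>') / 2)) (fst z) * indicator (- ball x0 \<rho>') (snd z)
        * (r * w (fst z) * w (snd z) powr (r - 1)) * dist (fst z) (snd z) powr (- (n + \<sigma>)))) \<partial>lborel)
    \<le> ennreal (r * 2 powr (n + q) * (\<rho>' / (\<rho>' - \<rho>)) powr (n + q)) * (T * (\<integral>\<^sup>+x\<in>ball x0 \<rho>'. ennreal (w x) \<partial>lborel))"
    (is "?l \<le> ?r")
proof -
  have n: "1 \<le> n" by (simp add: n_def Suc_leI)
  define X where "X = 2 * \<rho>' / (\<rho>' - \<rho>)"
  have X: "1 \<le> X" using \<rho> by (simp add: X_def field_simps)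
  have w0: "0 \<le> w x" for x by (simp add: w_def)
  have [measurable]: "w \<in> borel_measurable borel" unfolding w_def by measurable
  have [measurable]: "UNIV - ball x0 r0 \<in> sets borel" by simp
  have "?l = (\<integral>\<^sup>+x. \<integral>\<^sup>+y. ennreal (b (x, y) * (indicator (ball x0 ((\<rho> + \<rho>') / 2)) x * indicator (- ball x0 \<rho>') y
        * (r * w x * w y powr (r - 1)) * dist x y powr (- (n + \<sigma>)))) \<partial>lborel \<partial>lborel)"
    by (subst nn_integral_lborel_pair) auto
  also have "\<dots> \<le> (\<integral>\<^sup>+x. ennreal (r * X powr (n + q)) * (T * (ennreal (w x) * indicator (ball x0 \<rho>') x)) \<partial>lborel)"
  proof (rule nn_integral_mono_AE, use T in eventually_elim)
    case (elim x)
    show ?case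
    proof (cases "x \<in> ball x0 ((\<rho> + \<rho>') / 2)")
      case True
      then have x: "x \<in> ball x0 \<rho>'" "x \<in> ball x0 r1" using \<rho> by (auto simp: field_simps)
      have "(\<integral>\<^sup>+y. ennreal (b (x, y) * (indicator (ball x0 ((\<rho> + \<rho>') / 2)) x * indicator (- ball x0 \<rho>') y
          * (r * w x * w y powr (r - 1)) * dist x y powr (- (n + \<sigma>)))) \<partial>lborel)
        \<le> (\<integral>\<^sup>+y. ennreal (r * X powr (n + q) * w x) *
            (ennreal (b (x, y) * (\<bar>u y\<bar> powr (r - 1) * dist x0 y powr (- (n + \<sigma>)))) * indicator (UNIV - ball x0 r0) y) \<partial>lborel)"
      proof (intro nn_integral_mono)
        fix y
        show "ennreal (b (x, y) * (indicator (ball x0 ((\<rho> + \<rho>') / 2)) x * indicator (- ball x0 \<rho>') y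
            * (r * w x * w y powr (r - 1)) * dist x y powr (- (n + \<sigma>))))
          \<le> ennreal (r * X powr (n + q) * w x) *
            (ennreal (b (x, y) * (\<bar>u y\<bar> powr (r - 1) * dist x0 y powr (- (n + \<sigma>)))) * indicator (UNIV - ball x0 r0) y)"
        proof (cases "y \<in> ball x0 \<rho>'")
          case False
          then have y: "\<rho>' \<le> dist x0 y" "y \<notin> ball x0 r0" using \<rho> by auto
          have "dist x0 y / X \<le> dist x y"
          proof -
            have "dist x0 y * (\<rho> + \<rho>') \<ge> \<rho>' * (\<rho> + \<rho>')"
              using y \<rho> by (intro mult_right_mono) auto
            then have "dist x0 y / X \<le> dist x0 y - (\<rho> + \<rho>') / 2"
              using \<rho> by (simp add: X_def field_simps)
            also have "\<dots> \<le> dist x y"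
              using True dist_triangle[of x0 y x] unfolding mem_ball by linarith
            finally show ?thesis .
          qed
          moreover have "0 < dist x0 y" using y \<rho> by linarith
          ultimately have "dist x y powr (- (n + \<sigma>)) \<le> (dist x0 y / X) powr (- (n + \<sigma>))"
            using n \<sigma> X by (intro powr_mono2') auto
          also have "\<dots> = dist x0 y powr (- (n + \<sigma>)) * X powr (n + \<sigma>)"
            unfolding powr_divide powr_minus[of X] by (simp add: divide_inverse)
          also have "\<dots> \<le> dist x0 y powr (- (n + \<sigma>)) * X powr (n + q)"
            using X \<sigma> by (intro mult_left_mono powr_mono) auto
          finally have 1: "dist x y powr (- (n + \<sigma>)) \<le> dist x0 y powr (- (n + \<sigma>)) * X powr (n + q)" .
          have 2: "w y powr (r - 1) \<le> \<bar>u y\<bar> powr (r - 1)"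
            using k r by (intro powr_mono2) (auto simp: w_def)
          have "b (x, y) * ((r * w x * w y powr (r - 1)) * dist x y powr (- (n + \<sigma>)))
              \<le> b (x, y) * ((r * w x * \<bar>u y\<bar> powr (r - 1)) * (dist x0 y powr (- (n + \<sigma>)) * X powr (n + q)))"
            using 1 2 r w0 b0 by (intro mult_left_mono mult_mono) auto
          then show ?thesis using True False y b0[of "(x,y)"] w0[of x] r
            by (auto simp: mult_ac simp flip: ennreal_mult intro: ennreal_leI)
        qed simp
      qed
      also have "\<dots> = ennreal (r * X powr (n + q) * w x) *
          (\<integral>\<^sup>+y\<in>UNIV - ball x0 r0. ennreal (b (x, y) * (\<bar>u y\<bar> powr (r - 1) * dist x0 y powr (- (n + \<sigma>)))) \<partial>lborel)"
        by (rule nn_integral_cmult) measurable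
      also have "\<dots> \<le> ennreal (r * X powr (n + q) * w x) * T"
        using elim x by (intro mult_left_mono) auto
      finally show ?thesis using x r w0[of x] by (simp add: ennreal_mult mult_ac)
    qed simp
  qed
  also have "\<dots> = ennreal (r * X powr (n + q)) * (T * (\<integral>\<^sup>+x\<in>ball x0 \<rho>'. ennreal (w x) \<partial>lborel))"
    by (simp add: nn_integral_cmult)
  also have "r * X powr (n + q) = r * 2 powr (n + q) * (\<rho>' / (\<rho>' - \<rho>)) powr (n + q)"
    by (simp add: X_def flip: powr_mult)
  finally show ?thesis .
qed

text \<open>\<open>P\<close> need not be measurable, so the exceptional set is first enlarged to a
  Borel null set, to which Tonelli's theorem applies.\<close>

lemma AE_lborel_swap:
  fixes P :: "'a::euclidean_space \<times> 'a \<Rightarrow> bool"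
  assumes "AE z in lborel. P z"
  shows "AE z in lborel. P (snd z, fst z)"
proof -
  obtain N where N0: "\<And>z. z \<in> space lborel - N \<Longrightarrow> P z" "N \<in> null_sets lborel"
    using AE_E3[OF assms] by metis
  then have N: "\<And>z. z \<notin> N \<Longrightarrow> P z" "N \<in> sets borel" "emeasure lborel N = 0" by auto
  then have [measurable]: "N \<in> sets (borel \<Otimes>\<^sub>M borel)" unfolding borel_prod by simp
  have "(\<integral>\<^sup>+z. indicator N (snd z, fst z) \<partial>lborel) = (\<integral>\<^sup>+z. indicator N z \<partial>(lborel :: ('a \<times> 'a) measure))"
    by (rule nn_integral_lborel_swap) measurable
  also have "\<dots> = 0" using N by simp
  finally have "AE z in lborel. (indicator N (snd z, fst z) :: ennreal) = 0"
    by (subst (asm) nn_integral_0_iff_AE) (auto simp: borel_prod[symmetric])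
  then show ?thesis by eventually_elim (use N in \<open>auto split: split_indicator_asm\<close>)
qed

text \<open>The coefficient enters only through its bounds \<open>am \<le> a \<le> a1\<close> on the ball of radius \<open>r1\<close>
  and through the bound \<open>T\<close> of the tails.\<close>

definition caccioppoli_class ::
    "real \<Rightarrow> real \<Rightarrow> real \<Rightarrow> real \<Rightarrow> real \<Rightarrow> real \<Rightarrow> real \<Rightarrow> real \<Rightarrow> real \<Rightarrow> real
      \<Rightarrow> 'a::euclidean_space \<Rightarrow> ('a \<Rightarrow> real) \<Rightarrow> bool" where
  "caccioppoli_class C p q \<sigma> \<tau> am a1 T r0 r1 x0 u \<longleftrightarrow>
     (\<forall>k \<rho> \<rho>'. 0 \<le> k \<longrightarrow> r0 \<le> \<rho> \<longrightarrow> \<rho> < \<rho>' \<longrightarrow> \<rho>' \<le> r1 \<longrightarrow>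
        (let n = real DIM('a); w = (\<lambda>x. max (u x - k) 0) in
          (\<integral>\<^sup>+x\<in>ball x0 \<rho>. (\<integral>\<^sup>+y\<in>ball x0 \<rho>.
              ennreal (\<bar>w x - w y\<bar> powr p * dist x y powr (- (n + \<sigma>))
                + am * (\<bar>w x - w y\<bar> powr q * dist x y powr (- (n + \<tau>)))) \<partial>lborel) \<partial>lborel)
          \<le> ennreal (C * (\<rho>' / (\<rho>' - \<rho>)) powr (n + q)) *
            ((\<integral>\<^sup>+x\<in>ball x0 \<rho>' - ball x0 \<rho>.
                ennreal (\<rho>' powr (- \<sigma>) * w x powr p + a1 * (\<rho>' powr (- \<tau>) * w x powr q)) \<partial>lborel)
              + ennreal T * (\<integral>\<^sup>+x\<in>ball x0 \<rho>'. ennreal (w x) \<partial>lborel))))"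

text \<open>Domain, kernels and coefficient are hidden behind an existential quantifier: a constant
  obtained for this predicate is uniform in them and can depend only on the leading
  parameters.\<close>

definition minimizer_data ::
    "real \<Rightarrow> real \<Rightarrow> real \<Rightarrow> real \<Rightarrow> real \<Rightarrow> (real^'n \<Rightarrow> real) \<Rightarrow> real^'n \<Rightarrow> real \<Rightarrow> real
      \<Rightarrow> real \<Rightarrow> real \<Rightarrow> real \<Rightarrow> bool" where
  "minimizer_data s t p q \<Lambda> u x0 r0 r1 T am a1 \<longleftrightarrow> (\<exists>\<Omega> Ksp Ktq a.
    open \<Omega> \<and> comparable_kernel \<Lambda> (s * p) Ksp \<and> comparable_kernel \<Lambda> (t * q) Ktq \<and>
    coefficient \<Omega> a \<and> u \<in> borel_measurable borel \<and> is_minimizer s t p q Ksp Ktq a \<Omega> u \<and>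
    0 < r0 \<and> ball x0 r1 \<subseteq> \<Omega> \<and> 0 \<le> am \<and>
    (\<forall>x\<in>ball x0 r1. \<forall>y\<in>ball x0 r1. am \<le> a x y \<and> a x y \<le> a1) \<and> 0 \<le> T \<and>
    (\<integral>\<^sup>+y\<in>UNIV - ball x0 r0. ennreal
      (\<bar>u y\<bar> powr (p - 1) / norm (y - x0) powr (real CARD('n) + s * p)) \<partial>lborel) \<le> ennreal T \<and>
    (\<forall>x\<in>ball x0 r1. (\<integral>\<^sup>+y\<in>UNIV - ball x0 r0. ennreal
      (a x y * (\<bar>u y\<bar> powr (q - 1) / norm (y - x0) powr (real CARD('n) + t * q))) \<partial>lborel) \<le> ennreal T))"

text \<open>In the gain \<open>a\<close> is replaced by its lower bound \<open>am\<close>, in the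
  near error by its upper bound \<open>a1\<close>, and in the far error it is absorbed into the tail
  bound \<open>T\<close>. No property of \<open>a\<close> other than these bounds and its symmetry
  enters, so the constant does not see it.\<close>

lemma minimizer_caccioppoli_class:
  fixes s t p q \<Lambda> :: real
  assumes A1: "0 < s" "s < 1" "0 < t" "t < 1" "1 < p" "p \<le> q" and \<Lambda>: "1 \<le> \<Lambda>"
  shows "\<exists>C>0. \<forall>(u :: real^'n \<Rightarrow> real) x0 r0 r1 T am a1.
    minimizer_data s t p q \<Lambda> u x0 r0 r1 T am a1 \<longrightarrow>
    caccioppoli_class C p q (s * p) (t * q) am a1 T r0 r1 x0 u"
proof -
  define n where "n = real CARD('n)"
  have n_DIM: "real DIM(real^'n) = n" by (simp add: n_def)
  have q1: "1 < q" using A1 by simp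
  have sp: "0 < s * p" "s * p < p" "s * p \<le> q" and tq: "0 < t * q" "t * q < q"
    using A1 by (auto intro: order.trans[of _ p] simp: mult_le_cancel_right1)
  obtain C1 where C1: "0 < C1" and near_p: "\<And>(x0::real^'n) \<rho> \<rho>' g. 0 < \<rho> \<Longrightarrow> \<rho> < \<rho>' \<Longrightarrow> g \<in> borel_measurable borel \<Longrightarrow> (\<forall>x. 0 \<le> g x) \<Longrightarrow>
    (\<integral>\<^sup>+z. ennreal (indicator (ball x0 \<rho>') (fst z) * indicator (ball x0 \<rho>') (snd z)
        * (2 * q / (\<rho>' - \<rho>) * dist (fst z) (snd z)) powr p
        * (indicator (- ball x0 \<rho>) (fst z) * g (fst z)) * dist (fst z) (snd z) powr (- (n + s * p))) \<partial>lborel)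
    \<le> ennreal (C1 * (\<rho>' / (\<rho>' - \<rho>)) powr (n + q)) *
      (\<integral>\<^sup>+x\<in>ball x0 \<rho>' - ball x0 \<rho>. ennreal (\<rho>' powr (- (s * p)) * g x) \<partial>lborel)"
    using truncation_error_near[of p q "s * p", where 'a="real^'n", unfolded n_DIM] A1 sp by auto
  obtain C2 where C2: "0 < C2" and near_q: "\<And>(x0::real^'n) \<rho> \<rho>' g. 0 < \<rho> \<Longrightarrow> \<rho> < \<rho>' \<Longrightarrow> g \<in> borel_measurable borel \<Longrightarrow> (\<forall>x. 0 \<le> g x) \<Longrightarrow>
    (\<integral>\<^sup>+z. ennreal (indicator (ball x0 \<rho>') (fst z) * indicator (ball x0 \<rho>') (snd z)
        * (2 * q / (\<rho>' - \<rho>) * dist (fst z) (snd z)) powr q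
        * (indicator (- ball x0 \<rho>) (fst z) * g (fst z)) * dist (fst z) (snd z) powr (- (n + t * q))) \<partial>lborel)
    \<le> ennreal (C2 * (\<rho>' / (\<rho>' - \<rho>)) powr (n + q)) *
      (\<integral>\<^sup>+x\<in>ball x0 \<rho>' - ball x0 \<rho>. ennreal (\<rho>' powr (- (t * q)) * g x) \<partial>lborel)"
    using truncation_error_near[of q q "t * q", where 'a="real^'n", unfolded n_DIM] q1 tq by auto
  define D where "D = C1 + C2 + (p + q) * 2 powr (n + q)"
  define C where "C = 2 * \<Lambda>\<^sup>2 * D"
  have D: "0 < D" using C1 C2 A1 by (simp add: D_def add_pos_nonneg)
  have C: "0 < C" using D \<Lambda> by (simp add: C_def)
  have main: "caccioppoli_class C p q (s * p) (t * q) am a1 T r0 r1 x0 u"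
    if \<Omega>: "open \<Omega>" and K: "comparable_kernel \<Lambda> (s * p) Ksp" "comparable_kernel \<Lambda> (t * q) Ktq"
    and a: "coefficient \<Omega> a" and u[measurable]: "u \<in> borel_measurable borel"
    and min: "is_minimizer s t p q Ksp Ktq a \<Omega> u"
    and r0: "0 < r0" and sub: "ball x0 r1 \<subseteq> \<Omega>" and am: "0 \<le> am"
    and ab: "\<And>x y. x \<in> ball x0 r1 \<Longrightarrow> y \<in> ball x0 r1 \<Longrightarrow> am \<le> a x y \<and> a x y \<le> a1" and T0: "0 \<le> T"
    and Tp: "(\<integral>\<^sup>+y\<in>UNIV - ball x0 r0. ennreal
      (\<bar>u y\<bar> powr (p - 1) / norm (y - x0) powr (real CARD('n) + s * p)) \<partial>lborel) \<le> ennreal T"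
    and Tq: "\<And>x. x \<in> ball x0 r1 \<Longrightarrow> (\<integral>\<^sup>+y\<in>UNIV - ball x0 r0. ennreal
      (a x y * (\<bar>u y\<bar> powr (q - 1) / norm (y - x0) powr (real CARD('n) + t * q))) \<partial>lborel) \<le> ennreal T"
    for \<Omega> Ksp Ktq a and u :: "real^'n \<Rightarrow> real" and x0 r0 r1 T am a1
  proof -
    have "(\<lambda>z. a (fst z) (snd z)) \<in> borel_measurable (completion lborel)"
      using a by (simp add: coefficient_def case_prod_unfold)
    from completion_ex_borel_measurable_real[OF this]
    obtain a'' where a''[measurable]: "a'' \<in> borel_measurable borel"
      and aa'': "AE z in lborel. a (fst z) (snd z) = a'' z" by auto
    \<comment> \<open>\<open>a\<close> is measurable only for the completed product measure, so
      Tonelli's theorem is applied to this nonnegative Borel version. It agrees with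
      \<open>a\<close>, and is symmetric, almost everywhere.\<close>
    define a' where "a' = (\<lambda>z. max 0 (a'' z))"
    have [measurable]: "a' \<in> borel_measurable (borel \<Otimes>\<^sub>M borel)"
      using a'' unfolding a'_def borel_prod by measurable
    have a'0: "0 \<le> a' z" for z by (simp add: a'_def)
    have a0: "0 \<le> a x y" for x y using a by (simp add: coefficient_def)
    have aa': "AE z in lborel. a' z = a (fst z) (snd z)"
      using aa''
    proof eventually_elim
      case (elim z)
      then show ?case using a0[of "fst z" "snd z"] by (simp add: a'_def)
    qed
    have asym: "AE z in lborel. a (fst z) (snd z) = a (snd z) (fst z)"
      using a by (simp add: coefficient_def case_prod_unfold AE_completion_iff)
    have a'sym: "AE z in lborel. a' (snd z, fst z) = a' z"
      using aa' AE_lborel_swap[OF aa'] asym by eventually_elim simp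
    have "AE z in lborel \<Otimes>\<^sub>M lborel. a' z = a (fst z) (snd z)" using aa' by (simp only: lborel_prod)
    from lborel_pair.AE_pair[OF this] have aa'2: "AE x in lborel. AE y in lborel. a' (x, y) = a x y" by simp
    have Tq': "AE x in lborel. x \<in> ball x0 r1 \<longrightarrow> (\<integral>\<^sup>+y\<in>UNIV - ball x0 r0. ennreal
        (a' (x, y) * (\<bar>u y\<bar> powr (q - 1) * dist x0 y powr (- (n + t * q)))) \<partial>lborel) \<le> ennreal T"
      using aa'2
    proof eventually_elim
      case (elim x)
      have "(\<integral>\<^sup>+y\<in>UNIV - ball x0 r0. ennreal (a' (x, y) * (\<bar>u y\<bar> powr (q - 1) * dist x0 y powr (- (n + t * q)))) \<partial>lborel)
        = (\<integral>\<^sup>+y\<in>UNIV - ball x0 r0. ennreal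
            (a x y * (\<bar>u y\<bar> powr (q - 1) / norm (y - x0) powr (real CARD('n) + t * q))) \<partial>lborel)"
        by (rule nn_integral_cong_AE, use elim in eventually_elim)
          (simp add: n_def dist_norm norm_minus_commute divide_inverse flip: powr_minus)
      then show ?case using Tq[of x] by simp
    qed
    have Tp': "AE x in lborel. x \<in> ball x0 r1 \<longrightarrow> (\<integral>\<^sup>+y\<in>UNIV - ball x0 r0. ennreal
        ((\<lambda>z. 1) (x, y) * (\<bar>u y\<bar> powr (p - 1) * dist x0 y powr (- (n + s * p)))) \<partial>lborel) \<le> ennreal T"
    proof -
      have "(\<integral>\<^sup>+y\<in>UNIV - ball x0 r0. ennreal (1 * (\<bar>u y\<bar> powr (p - 1) * dist x0 y powr (- (n + s * p)))) \<partial>lborel)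
        = (\<integral>\<^sup>+y\<in>UNIV - ball x0 r0. ennreal
            (\<bar>u y\<bar> powr (p - 1) / norm (y - x0) powr (real CARD('n) + s * p)) \<partial>lborel)"
        by (intro nn_integral_cong)
          (simp add: n_def dist_norm norm_minus_commute divide_inverse flip: powr_minus)
      then show ?thesis using Tp by simp
    qed
    show ?thesis
      unfolding caccioppoli_class_def Let_def n_DIM
    proof (intro allI impI)
      fix k \<rho> \<rho>' :: real
      assume k: "0 \<le> k" and \<rho>: "r0 \<le> \<rho>" "\<rho> < \<rho>'" "\<rho>' \<le> r1"
      define w where "w = (\<lambda>x. max (u x - k) 0)"
      have w0: "0 \<le> w x" for x by (simp add: w_def)
      have [measurable]: "w \<in> borel_measurable borel" unfolding w_def by measurable
      have [measurable]: "ball x0 \<rho>' - ball x0 \<rho> \<in> sets borel" by simp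
      define X where "X = (\<rho>' / (\<rho>' - \<rho>)) powr (n + q)"
      have X: "0 \<le> X" by (simp add: X_def)
      have \<rho>0: "0 < \<rho>" using \<rho> r0 by simp
      define P where "P = (\<lambda>z::(real^'n) \<times> (real^'n). dist (fst z) (snd z) powr (- (n + s * p)))"
      define Q where "Q = (\<lambda>z::(real^'n) \<times> (real^'n). dist (fst z) (snd z) powr (- (n + t * q)))"
      define N where "N = (\<lambda>r (z::(real^'n) \<times> (real^'n)). indicator (ball x0 \<rho>') (fst z) * indicator (ball x0 \<rho>') (snd z)
        * (2 * q / (\<rho>' - \<rho>) * dist (fst z) (snd z)) powr r
        * (indicator (- ball x0 \<rho>) (fst z) * w (fst z) powr r))"
      define Fa where "Fa = (\<lambda>r (z::(real^'n) \<times> (real^'n)). indicator (ball x0 ((\<rho> + \<rho>') / 2)) (fst z) * indicator (- ball x0 \<rho>') (snd z)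
        * (r * w (fst z) * w (snd z) powr (r - 1)))"
      have [measurable]: "P \<in> borel_measurable (borel \<Otimes>\<^sub>M borel)" "Q \<in> borel_measurable (borel \<Otimes>\<^sub>M borel)"
        unfolding P_def Q_def by measurable
      have [measurable]: "N r \<in> borel_measurable (borel \<Otimes>\<^sub>M borel)" for r
        unfolding N_def by measurable
      have [measurable]: "Fa r \<in> borel_measurable (borel \<Otimes>\<^sub>M borel)" for r
        unfolding Fa_def by measurable
      have nn: "0 \<le> P z" "0 \<le> Q z" "0 \<le> N r z" "0 \<le> r \<Longrightarrow> 0 \<le> Fa r z" for r z
        using w0 by (auto simp: P_def Q_def N_def Fa_def)
      have PQ_sym: "P (snd z, fst z) = P z" "Q (snd z, fst z) = Q z" for z
        by (auto simp: P_def Q_def dist_commute)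
      \<comment> \<open>\<open>N\<close> and \<open>Fa\<close> are the near and far errors charged
        to the first variable. By symmetry of the kernels and of \<open>a'\<close> the swapped
        copies have the same integral, which accounts for a factor 2 in \<open>C\<close>.\<close>
      have TE: "truncation_error q x0 \<rho> \<rho>' w r (fst z) (snd z) = N r z + N r (snd z, fst z) + Fa r z + Fa r (snd z, fst z)" for r z
        by (simp add: truncation_error_def N_def Fa_def dist_commute distrib_left mult_ac)
      let ?sw = "\<lambda>z::(real^'n) \<times> (real^'n). (snd z, fst z)"
      define Ip where "Ip = (\<integral>\<^sup>+x\<in>ball x0 \<rho>' - ball x0 \<rho>. ennreal (\<rho>' powr (- (s * p)) * w x powr p) \<partial>lborel)"
      define Iq where "Iq = (\<integral>\<^sup>+x\<in>ball x0 \<rho>' - ball x0 \<rho>. ennreal (\<rho>' powr (- (t * q)) * w x powr q) \<partial>lborel)"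
      define I1 where "I1 = (\<integral>\<^sup>+x\<in>ball x0 \<rho>'. ennreal (w x) \<partial>lborel)"
      have x0in: "x0 \<in> ball x0 r1" using \<rho> \<rho>0 by simp
      have a1: "0 \<le> a1" using ab[OF x0in x0in] am by simp
      have NP: "(\<integral>\<^sup>+z. ennreal (N p z * P z) \<partial>lborel) \<le> ennreal (C1 * X) * Ip"
        unfolding N_def P_def X_def Ip_def by (rule near_p) (use \<rho> \<rho>0 in auto)
      have NQ: "(\<integral>\<^sup>+z. ennreal (N q z * Q z) \<partial>lborel) \<le> ennreal (C2 * X) * Iq"
        unfolding N_def Q_def X_def Iq_def by (rule near_q) (use \<rho> \<rho>0 in auto)
      have FP: "(\<integral>\<^sup>+z. ennreal (Fa p z * P z) \<partial>lborel) \<le> ennreal (p * 2 powr (n + q) * X) * (ennreal T * I1)"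
        using truncation_error_far[where b="\<lambda>z. 1" and r=p and \<sigma>="s * p" and q=q and T="ennreal T",
            OF _ _ _ r0 \<rho> k u, unfolded n_DIM, OF _ _ _ _ _ Tp'] A1 sp
        unfolding Fa_def P_def X_def I1_def w_def by simp
      have FQ: "(\<integral>\<^sup>+z. ennreal (a' z * (Fa q z * Q z)) \<partial>lborel) \<le> ennreal (q * 2 powr (n + q) * X) * (ennreal T * I1)"
        using truncation_error_far[where b=a' and r=q and \<sigma>="t * q" and q=q and T="ennreal T",
            OF _ _ _ r0 \<rho> k u, unfolded n_DIM, OF _ _ _ _ _ Tq'] q1 tq a'0
        unfolding Fa_def Q_def X_def I1_def w_def by simp
      have a'le: "AE z in lborel. fst z \<in> ball x0 \<rho>' \<longrightarrow> snd z \<in> ball x0 \<rho>' \<longrightarrow> a' z \<le> a1"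
        using aa' by eventually_elim (use ab \<rho> in auto)
      define A where "A = (\<integral>\<^sup>+z. ennreal (truncation_error q x0 \<rho> \<rho>' w p (fst z) (snd z) * P z
          + a (fst z) (snd z) * (truncation_error q x0 \<rho> \<rho>' w q (fst z) (snd z) * Q z)) \<partial>lborel)"
      define f where "f = (\<lambda>z. ennreal (N p z * P z) + ennreal (Fa p z * P z)
          + ennreal a1 * ennreal (N q z * Q z) + ennreal (a' z * (Fa q z * Q z)))"
      have [measurable]: "f \<in> borel_measurable (borel \<Otimes>\<^sub>M borel)" unfolding f_def by measurable
      have "A \<le> (\<integral>\<^sup>+z. f z + f (?sw z) \<partial>lborel)"
        unfolding A_def
      proof (rule nn_integral_mono_AE)
        show "AE z in lborel. ennreal (truncation_error q x0 \<rho> \<rho>' w p (fst z) (snd z) * P z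
          + a (fst z) (snd z) * (truncation_error q x0 \<rho> \<rho>' w q (fst z) (snd z) * Q z)) \<le> f z + f (?sw z)"
          using a'le aa' a'sym
        proof eventually_elim
          case (elim z)
          have "a' z * N q z \<le> a1 * N q z"
            using elim(1) nn(3)[of q z] by (cases "fst z \<in> ball x0 \<rho>' \<and> snd z \<in> ball x0 \<rho>'")
              (auto simp: N_def intro: mult_right_mono)
          then have 1: "a' z * N q z * Q z \<le> a1 * N q z * Q z" by (rule mult_right_mono[OF _ nn(2)])
          have "a' z * N q (?sw z) \<le> a1 * N q (?sw z)"
            using elim(1) nn(3)[of q z] by (cases "fst z \<in> ball x0 \<rho>' \<and> snd z \<in> ball x0 \<rho>'")
              (auto simp: N_def intro: mult_right_mono)
          then have 2: "a' z * N q (?sw z) * Q z \<le> a1 * N q (?sw z) * Q z" by (rule mult_right_mono[OF _ nn(2)])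
          define fr where "fr = (\<lambda>z. N p z * P z + Fa p z * P z + a1 * (N q z * Q z) + a' z * (Fa q z * Q z))"
          have fr0: "0 \<le> fr z" for z
            using nn[where z=z] A1 q1 a1 a'0[of z] by (simp add: fr_def)
          have f_eq: "f z = ennreal (fr z)" for z
            using nn[where z=z] A1 q1 a1 a'0[of z]
            by (simp add: f_def fr_def flip: ennreal_plus ennreal_mult)
          have "truncation_error q x0 \<rho> \<rho>' w p (fst z) (snd z) * P z
              + a (fst z) (snd z) * (truncation_error q x0 \<rho> \<rho>' w q (fst z) (snd z) * Q z)
            \<le> (N p z * P z + Fa p z * P z + a1 * (N q z * Q z) + a' z * (Fa q z * Q z))
              + (N p (?sw z) * P z + Fa p (?sw z) * P z + a1 * (N q (?sw z) * Q z) + a' z * (Fa q (?sw z) * Q z))"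
            using 1 2 unfolding TE elim(2)[symmetric] by (simp add: algebra_simps)
          also have "\<dots> = fr z + fr (?sw z)" by (simp add: fr_def PQ_sym elim(3))
          finally show ?case using fr0 by (simp add: f_eq ennreal_leI flip: ennreal_plus)
        qed
      qed
      also have "\<dots> = (\<integral>\<^sup>+z. f z \<partial>lborel) + (\<integral>\<^sup>+z. f (?sw z) \<partial>lborel)"
        by (rule nn_integral_add) (auto simp: borel_prod[symmetric])
      also have "\<dots> = 2 * (\<integral>\<^sup>+z. f z \<partial>lborel)"
        using nn_integral_lborel_swap[of f] by (simp add: mult_2)
      finally have Af: "A \<le> 2 * (\<integral>\<^sup>+z. f z \<partial>lborel)" .
      have "(\<integral>\<^sup>+z. f z \<partial>lborel) = (\<integral>\<^sup>+z. ennreal (N p z * P z) \<partial>lborel) + (\<integral>\<^sup>+z. ennreal (Fa p z * P z) \<partial>lborel)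
          + ennreal a1 * (\<integral>\<^sup>+z. ennreal (N q z * Q z) \<partial>lborel) + (\<integral>\<^sup>+z. ennreal (a' z * (Fa q z * Q z)) \<partial>lborel)"
        unfolding f_def lborel_prod[symmetric] by (simp add: nn_integral_add nn_integral_cmult)
      also have "\<dots> \<le> ennreal (C1 * X) * Ip + ennreal (p * 2 powr (n + q) * X) * (ennreal T * I1)
          + ennreal a1 * (ennreal (C2 * X) * Iq) + ennreal (q * 2 powr (n + q) * X) * (ennreal T * I1)"
        (is "_ \<le> ?S")
        using NP FP NQ FQ by (intro add_mono mult_left_mono) auto
      also have "?S \<le> ennreal (D * X) * ((Ip + ennreal a1 * Iq) + ennreal T * I1)"
      proof -
        have "ennreal (C1 * X) * Ip \<le> ennreal (D * X) * Ip"
          using C1 C2 A1 X by (intro mult_right_mono ennreal_leI) (auto simp: D_def)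
        moreover have "ennreal a1 * (ennreal (C2 * X) * Iq) \<le> ennreal a1 * (ennreal (D * X) * Iq)"
          using C1 C2 A1 X by (intro mult_left_mono mult_right_mono ennreal_leI) (auto simp: D_def)
        moreover have "ennreal (p * 2 powr (n + q) * X) * (ennreal T * I1) + ennreal (q * 2 powr (n + q) * X) * (ennreal T * I1)
            \<le> ennreal (D * X) * (ennreal T * I1)"
        proof -
          have "ennreal (p * 2 powr (n + q) * X) + ennreal (q * 2 powr (n + q) * X) = ennreal ((p + q) * 2 powr (n + q) * X)"
            using A1 X by (simp add: distrib_right flip: ennreal_plus)
          also have "\<dots> \<le> ennreal (D * X)"
            using C1 C2 A1 X by (intro mult_right_mono ennreal_leI) (auto simp: D_def)
          finally show ?thesis by (simp add: mult_right_mono flip: distrib_right)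
        qed
        ultimately have "ennreal (C1 * X) * Ip + ennreal a1 * (ennreal (C2 * X) * Iq)
            + (ennreal (p * 2 powr (n + q) * X) * (ennreal T * I1) + ennreal (q * 2 powr (n + q) * X) * (ennreal T * I1))
            \<le> ennreal (D * X) * Ip + ennreal a1 * (ennreal (D * X) * Iq) + ennreal (D * X) * (ennreal T * I1)"
          by (intro add_mono)
        then show ?thesis by (simp add: distrib_left mult_ac add_ac)
      qed
      finally have "2 * (\<integral>\<^sup>+z. f z \<partial>lborel) \<le> 2 * (ennreal (D * X) * ((Ip + ennreal a1 * Iq) + ennreal T * I1))"
        by (intro mult_left_mono) auto
      then have "A \<le> 2 * (ennreal (D * X) * ((Ip + ennreal a1 * Iq) + ennreal T * I1))"
        by (rule order_trans[OF Af])
      also have "\<dots> = ennreal (2 * D * X) * ((Ip + ennreal a1 * Iq) + ennreal T * I1)"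
        using D X by (simp add: ennreal_mult mult.assoc)
      finally have A_le: "A \<le> ennreal (2 * D * X) * ((Ip + ennreal a1 * Iq) + ennreal T * I1)" .
      have Ipq: "Ip + ennreal a1 * Iq = (\<integral>\<^sup>+x\<in>ball x0 \<rho>' - ball x0 \<rho>.
          ennreal (\<rho>' powr (- (s * p)) * w x powr p + a1 * (\<rho>' powr (- (t * q)) * w x powr q)) \<partial>lborel)"
      proof -
        have "Ip + ennreal a1 * Iq = (\<integral>\<^sup>+x. ennreal (\<rho>' powr (- (s * p)) * w x powr p) * indicator (ball x0 \<rho>' - ball x0 \<rho>) x
          + ennreal a1 * (ennreal (\<rho>' powr (- (t * q)) * w x powr q) * indicator (ball x0 \<rho>' - ball x0 \<rho>) x) \<partial>lborel)"
          unfolding Ip_def Iq_def by (subst nn_integral_add) (auto simp: nn_integral_cmult)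
        also have "\<dots> = (\<integral>\<^sup>+x\<in>ball x0 \<rho>' - ball x0 \<rho>.
          ennreal (\<rho>' powr (- (s * p)) * w x powr p + a1 * (\<rho>' powr (- (t * q)) * w x powr q)) \<partial>lborel)"
          using a1 by (intro nn_integral_cong) (auto split: split_indicator simp: ennreal_plus ennreal_mult)
        finally show ?thesis .
      qed
      have "(\<integral>\<^sup>+x\<in>ball x0 \<rho>. (\<integral>\<^sup>+y\<in>ball x0 \<rho>.
              ennreal (\<bar>w x - w y\<bar> powr p * dist x y powr (- (n + s * p))
                + am * (\<bar>w x - w y\<bar> powr q * dist x y powr (- (n + t * q)))) \<partial>lborel) \<partial>lborel)
        = (\<integral>\<^sup>+z. ennreal (indicator (ball x0 \<rho>) (fst z) * indicator (ball x0 \<rho>) (snd z) *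
            (\<bar>w (fst z) - w (snd z)\<bar> powr p * P z + am * (\<bar>w (fst z) - w (snd z)\<bar> powr q * Q z))) \<partial>lborel)"
      proof -
        have "(\<integral>\<^sup>+z. ennreal (indicator (ball x0 \<rho>) (fst z) * indicator (ball x0 \<rho>) (snd z) *
            (\<bar>w (fst z) - w (snd z)\<bar> powr p * P z + am * (\<bar>w (fst z) - w (snd z)\<bar> powr q * Q z))) \<partial>lborel)
          = (\<integral>\<^sup>+x. \<integral>\<^sup>+y. ennreal (indicator (ball x0 \<rho>) x * indicator (ball x0 \<rho>) y *
            (\<bar>w x - w y\<bar> powr p * P (x, y) + am * (\<bar>w x - w y\<bar> powr q * Q (x, y)))) \<partial>lborel \<partial>lborel)"
          by (subst nn_integral_lborel_pair) auto
        also have "\<dots> = (\<integral>\<^sup>+x\<in>ball x0 \<rho>. (\<integral>\<^sup>+y\<in>ball x0 \<rho>.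
              ennreal (\<bar>w x - w y\<bar> powr p * dist x y powr (- (n + s * p))
                + am * (\<bar>w x - w y\<bar> powr q * dist x y powr (- (n + t * q)))) \<partial>lborel) \<partial>lborel)"
          unfolding P_def Q_def
          by (intro nn_integral_cong) (auto split: split_indicator intro!: nn_integral_cong)
        finally show ?thesis ..
      qed
      also have "\<dots> \<le> (\<integral>\<^sup>+z. ennreal (indicator (ball x0 \<rho>) (fst z) * indicator (ball x0 \<rho>) (snd z) *
            (\<bar>w (fst z) - w (snd z)\<bar> powr p * P z
              + a (fst z) (snd z) * (\<bar>w (fst z) - w (snd z)\<bar> powr q * Q z))) \<partial>lborel)"
      proof (intro nn_integral_mono ennreal_leI)
        fix z
        show "indicator (ball x0 \<rho>) (fst z) * indicator (ball x0 \<rho>) (snd z) *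
            (\<bar>w (fst z) - w (snd z)\<bar> powr p * P z + am * (\<bar>w (fst z) - w (snd z)\<bar> powr q * Q z))
          \<le> indicator (ball x0 \<rho>) (fst z) * indicator (ball x0 \<rho>) (snd z) *
            (\<bar>w (fst z) - w (snd z)\<bar> powr p * P z + a (fst z) (snd z) * (\<bar>w (fst z) - w (snd z)\<bar> powr q * Q z))"
          using ab[of "fst z" "snd z"] \<rho> nn(2)[of z]
          by (auto simp: indicator_def intro!: mult_right_mono)
      qed
      also have "\<dots> \<le> ennreal (\<Lambda>\<^sup>2) * A"
      proof -
        have "ball x0 \<rho>' \<subseteq> \<Omega>" using sub \<rho> by (auto simp: subset_iff)
        from minimizer_truncation[OF A1 \<Lambda> \<Omega> K a u min k \<rho>(2) this]
        show ?thesis unfolding A_def P_def Q_def w_def n_def by (simp add: dist_norm)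
      qed
      also have "\<dots> \<le> ennreal (\<Lambda>\<^sup>2) * (ennreal (2 * D * X) * ((Ip + ennreal a1 * Iq) + ennreal T * I1))"
        using A_le by (intro mult_left_mono) auto
      also have "\<dots> = ennreal (C * X) * ((Ip + ennreal a1 * Iq) + ennreal T * I1)"
      proof -
        have "ennreal (\<Lambda>\<^sup>2) * ennreal (2 * D * X) = ennreal (C * X)"
          using D X by (simp add: C_def mult_ac flip: ennreal_mult)
        then show ?thesis by (simp add: mult.assoc[symmetric])
      qed
      finally show "(\<integral>\<^sup>+x\<in>ball x0 \<rho>. (\<integral>\<^sup>+y\<in>ball x0 \<rho>.
              ennreal (\<bar>max (u x - k) 0 - max (u y - k) 0\<bar> powr p * dist x y powr (- (n + s * p))
                + am * (\<bar>max (u x - k) 0 - max (u y - k) 0\<bar> powr q * dist x y powr (- (n + t * q)))) \<partial>lborel) \<partial>lborel)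
          \<le> ennreal (C * (\<rho>' / (\<rho>' - \<rho>)) powr (n + q)) *
            ((\<integral>\<^sup>+x\<in>ball x0 \<rho>' - ball x0 \<rho>.
                ennreal (\<rho>' powr (- (s * p)) * max (u x - k) 0 powr p + a1 * (\<rho>' powr (- (t * q)) * max (u x - k) 0 powr q)) \<partial>lborel)
              + ennreal T * (\<integral>\<^sup>+x\<in>ball x0 \<rho>'. ennreal (max (u x - k) 0) \<partial>lborel))"
        unfolding Ipq I1_def X_def w_def .
    qed
  qed
  show ?thesis
    unfolding minimizer_data_def
    by (intro exI[of _ C] conjI allI impI, rule C, elim exE conjE, rule main, (assumption | blast)+)
qed

section \<open>Local boundedness\<close>

lemma AE_le_if_nn_integral_powr_eq_0:
  fixes u :: "'a::euclidean_space \<Rightarrow> real"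
  assumes [measurable]: "u \<in> borel_measurable borel" and A[measurable]: "A \<in> sets borel"
    and "(\<integral>\<^sup>+x\<in>A. ennreal (max (u x - c) 0 powr r) \<partial>lborel) = 0"
  shows "AE x in lborel. x \<in> A \<longrightarrow> u x \<le> c"
proof -
  have "AE x in lborel. ennreal (max (u x - c) 0 powr r) * indicator A x = 0"
    using assms(3) by (subst (asm) nn_integral_0_iff_AE) auto
  then show ?thesis
    by eventually_elim (auto simp: indicator_def max_def split: if_splits)
qed

lemma nn_integral_above_level_tendsto_0:
  fixes u :: "'a::euclidean_space \<Rightarrow> real"
  assumes [measurable]: "u \<in> borel_measurable borel" "A \<in> sets borel" and r: "0 < r" and k0: "0 \<le> k0"
    and fin: "(\<integral>\<^sup>+x\<in>A. ennreal (max (u x - k0) 0 powr r) \<partial>lborel) < \<infinity>" and e: "0 < e"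
  shows "\<exists>K\<ge>k0. 1 \<le> K \<and> (\<integral>\<^sup>+x\<in>A. ennreal (max (u x - K) 0 powr r) \<partial>lborel) < ennreal e"
proof -
  have "(\<lambda>i. \<integral>\<^sup>+x\<in>A. ennreal (max (u x - (k0 + real i)) 0 powr r) \<partial>lborel) \<longlonglongrightarrow> (\<integral>\<^sup>+x. 0 \<partial>(lborel :: 'a measure))"
  proof (rule nn_integral_dominated_convergence)
    show "AE x in lborel. ennreal (max (u x - (k0 + real i)) 0 powr r) * indicator A x
        \<le> ennreal (max (u x - k0) 0 powr r) * indicator A x" for i
      using r by (intro AE_I2 mult_right_mono ennreal_leI powr_mono2) auto
    show "AE x in lborel. (\<lambda>i. ennreal (max (u x - (k0 + real i)) 0 powr r) * indicator A x) \<longlonglongrightarrow> 0"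
    proof (intro AE_I2 tendsto_eventually)
      fix x
      obtain N where "u x - k0 \<le> real N" using real_arch_simple by blast
      then have "max (u x - (k0 + real i)) 0 = 0" if "N \<le> i" for i using that by auto
      then show "\<forall>\<^sub>F i in sequentially. ennreal (max (u x - (k0 + real i)) 0 powr r) * indicator A x = 0"
        unfolding eventually_sequentially by (intro exI[of _ N]) simp
    qed
  qed (use fin in auto)
  then have "\<forall>\<^sub>F i in sequentially. (\<integral>\<^sup>+x\<in>A. ennreal (max (u x - (k0 + real i)) 0 powr r) \<partial>lborel) < ennreal e"
    using e by (intro order_tendstoD(2)) auto
  then obtain N where N: "\<And>i. N \<le> i \<Longrightarrow> (\<integral>\<^sup>+x\<in>A. ennreal (max (u x - (k0 + real i)) 0 powr r) \<partial>lborel) < ennreal e"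
    unfolding eventually_sequentially by blast
  show ?thesis
    using N[of "Suc N"] k0 by (intro exI[of _ "k0 + real (Suc N)"]) auto
qed

lemma emeasure_above_level_small:
  fixes u :: "'a::euclidean_space \<Rightarrow> real"
  assumes [measurable]: "u \<in> borel_measurable borel" and e: "0 < e"
  shows "\<exists>K\<ge>0. emeasure lborel {x \<in> ball x0 r. K < u x} \<le> ennreal e"
proof -
  define A where "A = (\<lambda>i::nat. {x \<in> ball x0 r. real i < u x})"
  have "(\<lambda>i. emeasure lborel (A i)) \<longlonglongrightarrow> emeasure lborel (\<Inter>i. A i)"
  proof (rule Lim_emeasure_decseq)
    show "range A \<subseteq> sets lborel" unfolding A_def by auto
    show "decseq A" unfolding A_def decseq_def by auto
    fix i
    have "emeasure lborel (A i) \<le> emeasure lborel (ball x0 r)" unfolding A_def by (intro emeasure_mono) auto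
    also have "\<dots> < \<infinity>" by (rule emeasure_lborel_ball_finite)
    finally show "emeasure lborel (A i) \<noteq> \<infinity>" by simp
  qed
  also have "(\<Inter>i. A i) = {}"
  proof -
    have "\<exists>i::nat. x \<notin> A i" for x
      using real_arch_simple[of "u x"] by (auto simp: A_def not_less)
    then show ?thesis by auto
  qed
  finally have "(\<lambda>i. emeasure lborel (A i)) \<longlonglongrightarrow> 0" by simp
  then have "\<forall>\<^sub>F i in sequentially. emeasure lborel (A i) < ennreal e"
    using e by (intro order_tendstoD(2)) auto
  then obtain N where "emeasure lborel (A N) < ennreal e"
    unfolding eventually_sequentially by blast
  then show ?thesis unfolding A_def by (intro exI[of _ "real N"]) auto
qed

text \<open>\<open>fractional_sobolev_small_support\<close> presupposes that the integral of
  \<open>w powr \<kappa>\<close> is finite. It is therefore applied to the bounded truncations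
  \<open>min w i\<close>, whose energy does not exceed that of \<open>u\<close>; it bounds them
  independently of \<open>i\<close>, and monotone convergence removes the truncation.\<close>

lemma fractional_sobolev_finite:
  fixes p \<kappa> \<sigma> r :: real and u :: "'a::euclidean_space \<Rightarrow> real"
  defines "n \<equiv> real DIM('a)"
  assumes r: "0 < r" and p: "0 < p" "p < \<kappa>" and \<sigma>: "n * ((\<kappa> - p) / \<kappa>) \<le> \<sigma>"
    and u[measurable]: "u \<in> borel_measurable borel"
    and E: "(\<integral>\<^sup>+x\<in>ball x0 r. (\<integral>\<^sup>+y\<in>ball x0 r.
      ennreal (\<bar>u x - u y\<bar> powr p * dist x y powr (- (n + \<sigma>))) \<partial>lborel) \<partial>lborel) < \<infinity>"
  shows "\<exists>k\<ge>0. (\<integral>\<^sup>+x\<in>ball x0 r. ennreal (max (u x - k) 0 powr \<kappa>) \<partial>lborel) < \<infinity>"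
proof -
  define \<beta> where "\<beta> = (\<kappa> - p) / \<kappa>"
  have \<beta>: "0 < \<beta>" "\<beta> < 1" "1 - \<beta> = p / \<kappa>" using p by (auto simp: \<beta>_def field_simps)
  define En where "En = (\<lambda>w::'a \<Rightarrow> real. \<integral>\<^sup>+x\<in>ball x0 r. (\<integral>\<^sup>+y\<in>ball x0 r.
      ennreal (\<bar>w x - w y\<bar> powr p * dist x y powr (- (n + \<sigma>))) \<partial>lborel) \<partial>lborel)"
  obtain C where C: "0 < C" and sob: "\<And>(w::'a \<Rightarrow> real) x0 \<rho> I. w \<in> borel_measurable borel \<Longrightarrow> (\<forall>y. 0 \<le> w y) \<Longrightarrow> 0 < \<rho> \<Longrightarrow> \<rho> \<le> r \<Longrightarrow>
    emeasure lborel {y \<in> ball x0 \<rho>. 0 < w y} \<le> ennreal (unit_ball_vol n * \<rho> powr n / 2 powr (n + 1)) \<Longrightarrow>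
    0 \<le> I \<Longrightarrow> (\<integral>\<^sup>+x\<in>ball x0 \<rho>. ennreal (w x powr \<kappa>) \<partial>lborel) = ennreal I \<Longrightarrow>
    ennreal I \<le> ennreal (C * I powr \<beta>) *
      (\<integral>\<^sup>+x\<in>ball x0 \<rho>. (\<integral>\<^sup>+y\<in>ball x0 \<rho>. ennreal (\<bar>w x - w y\<bar> powr p * dist x y powr (- (n + \<sigma>))) \<partial>lborel) \<partial>lborel)"
    using fractional_sobolev_small_support[OF r p, where 'a='a and \<sigma>=\<sigma>] \<sigma> unfolding n_def \<beta>_def by blast
  obtain k where k: "0 \<le> k" and small: "emeasure lborel {x \<in> ball x0 r. k < u x} \<le> ennreal (unit_ball_vol n * r powr n / 2 powr (n + 1))"
    using emeasure_above_level_small[OF u, of "unit_ball_vol n * r powr n / 2 powr (n + 1)" x0 r] r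
    by (auto simp: n_def)
  define e where "e = enn2real (En u)"
  have Ee: "En u = ennreal e" "0 \<le> e" using E by (auto simp: e_def En_def)
  \<comment> \<open>The largest \<open>I\<close> compatible with
    \<open>I \<le> C * I powr \<beta> * e\<close>, as
    \<open>1 - \<beta> = p / \<kappa>\<close>.\<close>
  define J where "J = (C * e) powr (\<kappa> / p)"
  define w where "w = (\<lambda>(i::nat) x. min (max (u x - k) 0) (real i))"
  have w0: "0 \<le> w i x" for i x by (simp add: w_def)
  have [measurable]: "w i \<in> borel_measurable borel" for i unfolding w_def by measurable
  have bound: "(\<integral>\<^sup>+x\<in>ball x0 r. ennreal (w i x powr \<kappa>) \<partial>lborel) \<le> ennreal J" for i
  proof -
    have "(\<integral>\<^sup>+x\<in>ball x0 r. ennreal (w i x powr \<kappa>) \<partial>lborel) \<le> (\<integral>\<^sup>+x\<in>ball x0 r. ennreal (real i powr \<kappa>) \<partial>lborel)"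
      using p w0 by (intro nn_integral_mono mult_right_mono ennreal_leI powr_mono2) (auto simp: w_def)
    also have "\<dots> < \<infinity>"
      using emeasure_lborel_ball_finite[of x0 r] by (simp add: nn_integral_cmult_indicator ennreal_mult_less_top)
    finally obtain I where I: "0 \<le> I" "(\<integral>\<^sup>+x\<in>ball x0 r. ennreal (w i x powr \<kappa>) \<partial>lborel) = ennreal I"
      by (metis ennreal_enn2real enn2real_nonneg infinity_ennreal_def)
    have "emeasure lborel {y \<in> ball x0 r. 0 < w i y} \<le> emeasure lborel {x \<in> ball x0 r. k < u x}"
      by (intro emeasure_mono) (auto simp: w_def)
    then have "ennreal I \<le> ennreal (C * I powr \<beta>) * En (w i)"
      unfolding En_def using small r w0 I by (intro sob) auto
    also have "\<dots> \<le> ennreal (C * I powr \<beta>) * En u"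
    proof (rule mult_left_mono)
      have "\<bar>w i x - w i y\<bar> \<le> \<bar>u x - u y\<bar>" for x y unfolding w_def by linarith
      then show "En (w i) \<le> En u"
        unfolding En_def using p
        by (intro nn_integral_mono mult_right_mono ennreal_leI powr_mono2) auto
    qed simp
    also have "\<dots> = ennreal (C * I powr \<beta> * e)" using C Ee by (simp add: ennreal_mult)
    finally have le: "I \<le> C * I powr \<beta> * e" using C Ee by (subst (asm) ennreal_le_iff) auto
    have "I \<le> J"
    proof (cases "I = 0")
      case False
      then have Ip: "0 < I" using I by simp
      have "I powr (p / \<kappa>) = I / I powr \<beta>" using Ip \<beta>(3) by (metis powr_diff powr_one order_less_imp_le)
      also have "\<dots> \<le> C * e" using le Ip by (simp add: field_simps)
      finally have "(I powr (p / \<kappa>)) powr (\<kappa> / p) \<le> J"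
        unfolding J_def using p by (intro powr_mono2) auto
      then show ?thesis using p Ip by (simp add: powr_powr)
    qed (simp add: J_def)
    then show ?thesis using I by (simp add: ennreal_leI)
  qed
  have "(\<integral>\<^sup>+x\<in>ball x0 r. ennreal (max (u x - k) 0 powr \<kappa>) \<partial>lborel)
      = (\<integral>\<^sup>+x. (SUP i. ennreal (w i x powr \<kappa>) * indicator (ball x0 r) x) \<partial>lborel)"
  proof (intro nn_integral_cong antisym)
    fix x
    obtain N where "max (u x - k) 0 \<le> real N" using real_arch_simple by blast
    then have "w N x = max (u x - k) 0" by (simp add: w_def)
    then show "ennreal (max (u x - k) 0 powr \<kappa>) * indicator (ball x0 r) x
        \<le> (SUP i. ennreal (w i x powr \<kappa>) * indicator (ball x0 r) x)"
      by (intro SUP_upper2[of N]) auto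
    show "(SUP i. ennreal (w i x powr \<kappa>) * indicator (ball x0 r) x)
        \<le> ennreal (max (u x - k) 0 powr \<kappa>) * indicator (ball x0 r) x"
      using p w0 by (intro SUP_least mult_right_mono ennreal_leI powr_mono2) (auto simp: w_def)
  qed
  also have "\<dots> = (SUP i. \<integral>\<^sup>+x\<in>ball x0 r. ennreal (w i x powr \<kappa>) \<partial>lborel)"
  proof (rule nn_integral_monotone_convergence_SUP)
    show "incseq (\<lambda>i x. ennreal (w i x powr \<kappa>) * indicator (ball x0 r) x)"
      using p w0 by (intro incseq_SucI le_funI mult_right_mono ennreal_leI powr_mono2) (auto simp: w_def)
  qed measurable
  also have "\<dots> \<le> ennreal J" using bound by (intro SUP_least)
  finally show ?thesis using k by (intro exI[of _ k]) (auto intro: le_less_trans)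
qed

text \<open>De Giorgi iteration for the integrals of \<open>w powr \<kappa>\<close>, with levels
  rising from \<open>K\<close> to \<open>2 * K\<close> and radii shrinking from \<open>r1\<close> to
  \<open>r0\<close>. The condition \<open>q \<le> \<kappa>\<close> is what lets a single power
  control the errors of both phases. \<open>K\<close> depends on \<open>u\<close> through absolute
  continuity of an integral, so the bound is qualitative.\<close>

lemma caccioppoli_class_bounded_above:
  fixes p q \<sigma> \<tau> \<kappa> r0 r1 :: real and u :: "'a::euclidean_space \<Rightarrow> real"
  defines "n \<equiv> real DIM('a)"
  assumes cl: "caccioppoli_class C p q \<sigma> \<tau> am a1 T r0 r1 x0 u" and C: "0 < C"
    and r: "0 < r0" "r0 < r1" and p: "1 < p" "p \<le> q" "q \<le> \<kappa>" "p < \<kappa>"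
    and \<sigma>: "n * ((\<kappa> - p) / \<kappa>) \<le> \<sigma>" and \<tau>: "0 \<le> \<tau>"
    and am: "0 \<le> am" and a1: "0 \<le> a1" and T: "0 \<le> T"
    and u[measurable]: "u \<in> borel_measurable borel"
    and E: "(\<integral>\<^sup>+x\<in>ball x0 r1. (\<integral>\<^sup>+y\<in>ball x0 r1.
      ennreal (\<bar>u x - u y\<bar> powr p * dist x y powr (- (n + \<sigma>))) \<partial>lborel) \<partial>lborel) < \<infinity>"
  shows "\<exists>M. AE x in lborel. x \<in> ball x0 r0 \<longrightarrow> u x \<le> M"
proof -
  define \<beta> where "\<beta> = (\<kappa> - p) / \<kappa>"
  have \<beta>: "0 < \<beta>" using p by (simp add: \<beta>_def)
  have n: "1 \<le> n" by (simp add: n_def Suc_leI)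
  have \<sigma>0: "0 \<le> \<sigma>" using \<sigma> \<beta> n unfolding \<beta>_def
    by (meson order_trans less_imp_le mult_nonneg_nonneg zero_le_one)
  define V where "V = unit_ball_vol n"
  have V: "0 < V" by (simp add: V_def n_def)
  define m0 where "m0 = V * r0 powr n / 2 powr (n + 1)"
  have m0: "0 < m0" using V r by (simp add: m0_def)
  obtain S where S: "0 < S" and sob: "\<And>(w::'a \<Rightarrow> real) x0 \<rho> I. w \<in> borel_measurable borel \<Longrightarrow> (\<forall>y. 0 \<le> w y) \<Longrightarrow> 0 < \<rho> \<Longrightarrow> \<rho> \<le> r1 \<Longrightarrow>
    emeasure lborel {y \<in> ball x0 \<rho>. 0 < w y} \<le> ennreal (V * \<rho> powr n / 2 powr (n + 1)) \<Longrightarrow>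
    0 \<le> I \<Longrightarrow> (\<integral>\<^sup>+x\<in>ball x0 \<rho>. ennreal (w x powr \<kappa>) \<partial>lborel) = ennreal I \<Longrightarrow>
    ennreal I \<le> ennreal (S * I powr \<beta>) *
      (\<integral>\<^sup>+x\<in>ball x0 \<rho>. (\<integral>\<^sup>+y\<in>ball x0 \<rho>. ennreal (\<bar>w x - w y\<bar> powr p * dist x y powr (- (n + \<sigma>))) \<partial>lborel) \<partial>lborel)"
    using fractional_sobolev_small_support[of r1 p \<kappa>, where 'a='a and \<sigma>=\<sigma>] \<sigma> r p unfolding n_def \<beta>_def V_def by auto
  define H where "H = r0 powr (- \<sigma>) + a1 * r0 powr (- \<tau>) + T"
  have H: "0 < H" using r a1 T by (simp add: H_def add_pos_nonneg)
  define c2 where "c2 = C * (2 * r1 / (r1 - r0)) powr (n + q) * (H * 2 powr \<kappa>)"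
  have c2: "0 < c2" using C H r by (simp add: c2_def)
  define b where "b = 2 powr (n + q) * 2 powr \<kappa>"
  have b: "1 < b" using n p by (simp add: b_def flip: powr_add)
  define \<epsilon> where "\<epsilon> = (S * c2) powr (- 1 / \<beta>) * b powr (- 1 / \<beta>\<^sup>2)"
  have \<epsilon>: "0 < \<epsilon>" using S c2 b by (simp add: \<epsilon>_def)
  obtain ka where ka: "0 \<le> ka" "(\<integral>\<^sup>+x\<in>ball x0 r1. ennreal (max (u x - ka) 0 powr \<kappa>) \<partial>lborel) < \<infinity>"
    using fractional_sobolev_finite[OF _ _ _ _ u E[unfolded n_def], of \<kappa>] r p \<sigma> unfolding n_def by auto
  obtain kb where kb: "0 \<le> kb" "emeasure lborel {x \<in> ball x0 r1. kb < u x} \<le> ennreal m0"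
    using emeasure_above_level_small[OF u m0] by blast
  have "(\<integral>\<^sup>+x\<in>ball x0 r1. ennreal (max (u x - max ka kb) 0 powr \<kappa>) \<partial>lborel)
      \<le> (\<integral>\<^sup>+x\<in>ball x0 r1. ennreal (max (u x - ka) 0 powr \<kappa>) \<partial>lborel)"
    using p by (intro nn_integral_mono mult_right_mono ennreal_leI powr_mono2) auto
  then have "(\<integral>\<^sup>+x\<in>ball x0 r1. ennreal (max (u x - max ka kb) 0 powr \<kappa>) \<partial>lborel) < \<infinity>"
    using ka(2) by (rule le_less_trans)
  \<comment> \<open>The level is taken so large that the excess integral is below the threshold of
    the recursion and the level set below the support threshold of the Sobolev inequality.
    \<open>K \<ge> 1\<close> serves to compare powers of \<open>w\<close>.\<close>
  then obtain K where K: "max ka kb \<le> K" "1 \<le> K"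
      "(\<integral>\<^sup>+x\<in>ball x0 r1. ennreal (max (u x - K) 0 powr \<kappa>) \<partial>lborel) < ennreal \<epsilon>"
  proof -
    assume "\<And>K. max ka kb \<le> K \<Longrightarrow> 1 \<le> K \<Longrightarrow>
      (\<integral>\<^sup>+x\<in>ball x0 r1. ennreal (max (u x - K) 0 powr \<kappa>) \<partial>lborel) < ennreal \<epsilon> \<Longrightarrow> thesis"
    moreover assume "(\<integral>\<^sup>+x\<in>ball x0 r1. ennreal (max (u x - max ka kb) 0 powr \<kappa>) \<partial>lborel) < \<infinity>"
    moreover have "0 \<le> max ka kb" "0 < \<kappa>" "ball x0 r1 \<in> sets borel" using ka p by auto
    ultimately show thesis
      using nn_integral_above_level_tendsto_0[OF u _ _ _ _ \<epsilon>, of "ball x0 r1" \<kappa> "max ka kb"] by blast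
  qed
  define kk where "kk = (\<lambda>j::nat. 2 * K - K / 2 ^ j)"
  define \<rho> where "\<rho> = (\<lambda>j::nat. r0 + (r1 - r0) / 2 ^ j)"
  define w where "w = (\<lambda>j x. max (u x - kk j) 0)"
  define I where "I = (\<lambda>j. \<integral>\<^sup>+x\<in>ball x0 (\<rho> j). ennreal (w j x powr \<kappa>) \<partial>lborel)"
  define Y where "Y = (\<lambda>j. enn2real (I j))"
  have [measurable]: "w j \<in> borel_measurable borel" for j unfolding w_def by measurable
  have w0: "0 \<le> w j x" for j x by (simp add: w_def)
  have \<rho>: "r0 < \<rho> j" "\<rho> j \<le> r1" for j
  proof -
    have "(r1 - r0) / 2 ^ j \<le> (r1 - r0) / 1" using r by (intro divide_left_mono) auto
    then show "r0 < \<rho> j" "\<rho> j \<le> r1" using r by (auto simp: \<rho>_def)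
  qed
  have \<rho>S: "\<rho> (Suc j) < \<rho> j" for j using r by (simp add: \<rho>_def field_simps)
  have kkK: "K \<le> kk j" for j
    using K mult_left_mono[of 1 "2 ^ j" K] by (simp add: kk_def field_simps)
  have kk2: "kk j \<le> 2 * K" for j using K by (simp add: kk_def)
  have gap: "kk (Suc j) = kk j + K / 2 ^ Suc j" for j by (simp add: kk_def field_simps)
  have kkS: "kk j \<le> kk (Suc j)" for j using K by (simp add: gap)
  have wS: "w (Suc j) x \<le> w j x" for j x using kkS[of j] by (auto simp: w_def)
  have Idec: "I (Suc j) \<le> I j" for j
    unfolding I_def using wS[of j] w0 \<rho>S[of j] p
    by (intro nn_integral_mono mult_mono ennreal_leI powr_mono2) (auto split: split_indicator)
  have I0: "I 0 < ennreal \<epsilon>" using K(3) by (simp add: I_def w_def kk_def \<rho>_def)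
  have Ile: "I j \<le> I 0" for j by (induction j) (use Idec order_trans in blast)+
  have IY: "I j = ennreal (Y j)" "0 \<le> Y j" for j
  proof -
    have "I j < \<infinity>" using Ile[of j] I0 by (metis ennreal_less_top infinity_ennreal_def le_less_trans less_trans)
    then show "I j = ennreal (Y j)" "0 \<le> Y j" by (auto simp: Y_def)
  qed
  have Ydec: "Y (Suc j) \<le> Y j" for j using Idec[of j] IY by simp
  have rec: "Y (Suc j) \<le> (S * c2) * b ^ j * Y j powr (1 + \<beta>)" for j
  proof -
    define En where "En = (\<integral>\<^sup>+x\<in>ball x0 (\<rho> (Suc j)). (\<integral>\<^sup>+y\<in>ball x0 (\<rho> (Suc j)).
        ennreal (\<bar>w (Suc j) x - w (Suc j) y\<bar> powr p * dist x y powr (- (n + \<sigma>))) \<partial>lborel) \<partial>lborel)"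
    define A where "A = 2 powr \<kappa> * (2 powr \<kappa>) ^ j"
    have A: "A = (2 ^ Suc j) powr \<kappa>"
    proof -
      have "(2 ^ Suc j :: real) powr \<kappa> = (2 powr \<kappa>) ^ Suc j"
        by (rule two_power_powr)
      then show ?thesis by (simp add: A_def)
    qed
    \<comment> \<open>Where \<open>w (Suc j)\<close> is positive, \<open>2 ^ Suc j * w j x\<close>
      is at least \<open>K \<ge> 1\<close>, so exponents may be raised. This covers
      \<open>i = p\<close>, \<open>q\<close> and 1, the powers in the Caccioppoli
      inequality.\<close>
    have pw: "w (Suc j) x powr i \<le> A * w j x powr \<kappa>" if i: "0 < i" "i \<le> \<kappa>" for i x
    proof (cases "w (Suc j) x = 0")
      case False
      then have "kk (Suc j) < u x" by (simp add: w_def max_def split: if_splits)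
      then have "K / 2 ^ Suc j \<le> w j x" unfolding gap w_def by simp
      then have ge1: "1 \<le> 2 ^ Suc j * w j x" using K(2) by (simp add: field_simps)
      have "w (Suc j) x powr i \<le> (2 ^ Suc j * w j x) powr i"
      proof (intro powr_mono2)
        have "w j x \<le> 2 ^ Suc j * w j x" 
          using w0[of j x] mult_right_mono[of 1 "2 ^ Suc j" "w j x"] one_le_power[of "2::real" "Suc j"] by simp
        then show "w (Suc j) x \<le> 2 ^ Suc j * w j x" using wS[of j x] by linarith
      qed (use w0 i in auto)
      also have "\<dots> \<le> (2 ^ Suc j * w j x) powr \<kappa>" using ge1 i by (intro powr_mono) auto
      also have "\<dots> = A * w j x powr \<kappa>" by (simp only: A powr_mult)
      finally show ?thesis .
    qed (use i in \<open>simp add: A_def\<close>)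
    have A0: "0 \<le> A" by (simp add: A_def)
    have "En \<le> (\<integral>\<^sup>+x\<in>ball x0 (\<rho> (Suc j)). (\<integral>\<^sup>+y\<in>ball x0 (\<rho> (Suc j)).
              ennreal (\<bar>w (Suc j) x - w (Suc j) y\<bar> powr p * dist x y powr (- (n + \<sigma>))
                + am * (\<bar>w (Suc j) x - w (Suc j) y\<bar> powr q * dist x y powr (- (n + \<tau>)))) \<partial>lborel) \<partial>lborel)"
      unfolding En_def using am by (intro nn_integral_mono mult_right_mono ennreal_leI) auto
    also have "\<dots> \<le> ennreal (C * (\<rho> j / (\<rho> j - \<rho> (Suc j))) powr (n + q)) *
            ((\<integral>\<^sup>+x\<in>ball x0 (\<rho> j) - ball x0 (\<rho> (Suc j)).
                ennreal (\<rho> j powr (- \<sigma>) * w (Suc j) x powr p + a1 * (\<rho> j powr (- \<tau>) * w (Suc j) x powr q)) \<partial>lborel)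
              + ennreal T * (\<integral>\<^sup>+x\<in>ball x0 (\<rho> j). ennreal (w (Suc j) x) \<partial>lborel))"
    proof -
      have "0 \<le> kk (Suc j)" using kkK[of "Suc j"] K by linarith
      moreover have "r0 \<le> \<rho> (Suc j)" using \<rho>(1)[of "Suc j"] by simp
      ultimately show ?thesis
        using cl \<rho>S[of j] \<rho>(2)[of j] unfolding caccioppoli_class_def Let_def w_def n_def by blast
    qed
    also have "\<dots> \<le> ennreal (C * ((2 * r1 / (r1 - r0)) powr (n + q) * (2 powr (n + q)) ^ j)) * (ennreal (H * A) * I j)"
    proof (rule mult_mono)
      have "\<rho> j / (\<rho> j - \<rho> (Suc j)) = \<rho> j * 2 ^ Suc j / (r1 - r0)"
        using r by (simp add: \<rho>_def field_simps)
      also have "\<dots> \<le> r1 * 2 ^ Suc j / (r1 - r0)"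
        using r \<rho>(2)[of j] by (intro divide_right_mono mult_right_mono) auto
      finally have "\<rho> j / (\<rho> j - \<rho> (Suc j)) \<le> (2 * r1 / (r1 - r0)) * 2 ^ j" by (simp add: mult_ac)
      then have "(\<rho> j / (\<rho> j - \<rho> (Suc j))) powr (n + q) \<le> ((2 * r1 / (r1 - r0)) * 2 ^ j) powr (n + q)"
        using n p r \<rho>(1)[of j] \<rho>S[of j] by (intro powr_mono2) auto
      also have "\<dots> = (2 * r1 / (r1 - r0)) powr (n + q) * (2 powr (n + q)) ^ j"
      proof -
        have "(2 ^ j :: real) powr (n + q) = (2 powr (n + q)) ^ j"
          by (rule two_power_powr)
        then show ?thesis by (simp only: powr_mult)
      qed
      finally show "ennreal (C * (\<rho> j / (\<rho> j - \<rho> (Suc j))) powr (n + q))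
          \<le> ennreal (C * ((2 * r1 / (r1 - r0)) powr (n + q) * (2 powr (n + q)) ^ j))"
        using C by (intro ennreal_leI mult_left_mono) auto
      have [measurable]: "ball x0 (\<rho> j) - ball x0 (\<rho> (Suc j)) \<in> sets borel" by simp
      have "(\<integral>\<^sup>+x\<in>ball x0 (\<rho> j) - ball x0 (\<rho> (Suc j)).
                ennreal (\<rho> j powr (- \<sigma>) * w (Suc j) x powr p + a1 * (\<rho> j powr (- \<tau>) * w (Suc j) x powr q)) \<partial>lborel)
              + ennreal T * (\<integral>\<^sup>+x\<in>ball x0 (\<rho> j). ennreal (w (Suc j) x) \<partial>lborel)
        = (\<integral>\<^sup>+x. ennreal (\<rho> j powr (- \<sigma>) * w (Suc j) x powr p + a1 * (\<rho> j powr (- \<tau>) * w (Suc j) x powr q))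
              * indicator (ball x0 (\<rho> j) - ball x0 (\<rho> (Suc j))) x
            + ennreal T * (ennreal (w (Suc j) x) * indicator (ball x0 (\<rho> j)) x) \<partial>lborel)"
        by (subst nn_integral_add) (auto simp: nn_integral_cmult)
      also have "\<dots> \<le> (\<integral>\<^sup>+x. ennreal (H * A) * (ennreal (w j x powr \<kappa>) * indicator (ball x0 (\<rho> j)) x) \<partial>lborel)"
      proof (intro nn_integral_mono)
        fix x
        show "ennreal (\<rho> j powr (- \<sigma>) * w (Suc j) x powr p + a1 * (\<rho> j powr (- \<tau>) * w (Suc j) x powr q))
              * indicator (ball x0 (\<rho> j) - ball x0 (\<rho> (Suc j))) x
            + ennreal T * (ennreal (w (Suc j) x) * indicator (ball x0 (\<rho> j)) x)
          \<le> ennreal (H * A) * (ennreal (w j x powr \<kappa>) * indicator (ball x0 (\<rho> j)) x)"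
        proof (cases "x \<in> ball x0 (\<rho> j)")
          case True
          have "\<rho> j powr (- \<sigma>) * w (Suc j) x powr p \<le> r0 powr (- \<sigma>) * (A * w j x powr \<kappa>)"
            using \<rho>(1)[of j] r \<sigma>0 pw[of p x] p by (intro mult_mono powr_mono2') auto
          moreover have "a1 * (\<rho> j powr (- \<tau>) * w (Suc j) x powr q) \<le> a1 * (r0 powr (- \<tau>) * (A * w j x powr \<kappa>))"
            using \<rho>(1)[of j] r \<tau> pw[of q x] p a1 by (intro mult_left_mono mult_mono powr_mono2') auto
          moreover have "T * w (Suc j) x \<le> T * (A * w j x powr \<kappa>)"
            using pw[of 1 x] w0[of "Suc j" x] p T by (intro mult_left_mono) auto
          ultimately have real_le: "\<rho> j powr (- \<sigma>) * w (Suc j) x powr p + a1 * (\<rho> j powr (- \<tau>) * w (Suc j) x powr q) + T * w (Suc j) x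
              \<le> H * A * w j x powr \<kappa>"
            by (simp add: H_def algebra_simps)
          have "ennreal (\<rho> j powr (- \<sigma>) * w (Suc j) x powr p + a1 * (\<rho> j powr (- \<tau>) * w (Suc j) x powr q))
              * indicator (ball x0 (\<rho> j) - ball x0 (\<rho> (Suc j))) x
            \<le> ennreal (\<rho> j powr (- \<sigma>) * w (Suc j) x powr p + a1 * (\<rho> j powr (- \<tau>) * w (Suc j) x powr q))"
            by (auto split: split_indicator)
          then have "ennreal (\<rho> j powr (- \<sigma>) * w (Suc j) x powr p + a1 * (\<rho> j powr (- \<tau>) * w (Suc j) x powr q))
              * indicator (ball x0 (\<rho> j) - ball x0 (\<rho> (Suc j))) x + ennreal T * ennreal (w (Suc j) x)
            \<le> ennreal (\<rho> j powr (- \<sigma>) * w (Suc j) x powr p + a1 * (\<rho> j powr (- \<tau>) * w (Suc j) x powr q)) + ennreal (T * w (Suc j) x)"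
            using T w0[of "Suc j" x] by (simp add: ennreal_mult add_right_mono)
          also have "\<dots> = ennreal (\<rho> j powr (- \<sigma>) * w (Suc j) x powr p + a1 * (\<rho> j powr (- \<tau>) * w (Suc j) x powr q) + T * w (Suc j) x)"
            using T a1 w0[of "Suc j" x] by (intro ennreal_plus[symmetric]) auto
          also have "\<dots> \<le> ennreal (H * A * w j x powr \<kappa>)" using real_le by (rule ennreal_leI)
          finally show ?thesis using True H A0 by (simp flip: ennreal_mult)
        qed auto
      qed
      also have "\<dots> = ennreal (H * A) * I j" unfolding I_def by (rule nn_integral_cmult) measurable
      finally show "(\<integral>\<^sup>+x\<in>ball x0 (\<rho> j) - ball x0 (\<rho> (Suc j)).
                ennreal (\<rho> j powr (- \<sigma>) * w (Suc j) x powr p + a1 * (\<rho> j powr (- \<tau>) * w (Suc j) x powr q)) \<partial>lborel)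
              + ennreal T * (\<integral>\<^sup>+x\<in>ball x0 (\<rho> j). ennreal (w (Suc j) x) \<partial>lborel) \<le> ennreal (H * A) * I j" .
    qed auto
    also have "\<dots> = ennreal (c2 * b ^ j * Y j)"
      using C H IY[of j] by (simp add: A_def c2_def b_def power_mult_distrib mult_ac flip: ennreal_mult)
    finally have En: "En \<le> ennreal (c2 * b ^ j * Y j)" .
    have "emeasure lborel {y \<in> ball x0 (\<rho> (Suc j)). 0 < w (Suc j) y} \<le> emeasure lborel {x \<in> ball x0 r1. kb < u x}"
    proof (intro emeasure_mono subsetI)
      fix y assume "y \<in> {y \<in> ball x0 (\<rho> (Suc j)). 0 < w (Suc j) y}"
      then show "y \<in> {x \<in> ball x0 r1. kb < u x}"
        using kkK[of "Suc j"] K(1) \<rho>(2)[of "Suc j"] by (auto simp: w_def)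
    qed measurable
    also have "\<dots> \<le> ennreal m0" by (rule kb)
    also have "\<dots> \<le> ennreal (V * \<rho> (Suc j) powr n / 2 powr (n + 1))"
      unfolding m0_def using r \<rho>(1)[of "Suc j"] V n
      by (intro ennreal_leI divide_right_mono mult_left_mono powr_mono2) auto
    finally have small: "emeasure lborel {y \<in> ball x0 (\<rho> (Suc j)). 0 < w (Suc j) y}
      \<le> ennreal (V * \<rho> (Suc j) powr n / 2 powr (n + 1))" .
    have "0 < \<rho> (Suc j)" using r \<rho>(1)[of "Suc j"] by linarith
    then have "ennreal (Y (Suc j)) \<le> ennreal (S * Y (Suc j) powr \<beta>) * En"
      unfolding En_def using \<rho>(2)[of "Suc j"] small IY[of "Suc j"] w0
      by (intro sob) (auto simp: I_def)
    also have "\<dots> \<le> ennreal (S * Y j powr \<beta>) * ennreal (c2 * b ^ j * Y j)"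
      using En Ydec[of j] IY \<beta> S by (intro mult_mono ennreal_leI mult_left_mono powr_mono2) auto
    also have "\<dots> = ennreal (S * Y j powr \<beta> * (c2 * b ^ j * Y j))"
      using S by (intro ennreal_mult[symmetric]) (use c2 b IY in auto)
    finally have "Y (Suc j) \<le> S * Y j powr \<beta> * (c2 * b ^ j * Y j)"
      using S c2 b IY by (subst (asm) ennreal_le_iff) auto
    also have "\<dots> = (S * c2) * b ^ j * Y j powr (1 + \<beta>)"
      using IY(2)[of j] by (simp add: powr_add powr_one mult_ac)
    finally show ?thesis .
  qed
  have "Y 0 \<le> \<epsilon>"
  proof -
    have "ennreal (Y 0) \<le> ennreal \<epsilon>" using I0 IY(1)[of 0] by simp
    then show ?thesis using \<epsilon> by simp
  qed
  then have "Y \<longlonglongrightarrow> 0"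
    using fast_geometric_convergence[of Y "S * c2" b \<beta>] IY S c2 b \<beta> rec by (simp add: \<epsilon>_def)
  then have "(\<lambda>j. ennreal (Y j)) \<longlonglongrightarrow> 0" using tendsto_ennrealI by fastforce
  moreover have "(\<integral>\<^sup>+x\<in>ball x0 r0. ennreal (max (u x - 2 * K) 0 powr \<kappa>) \<partial>lborel) \<le> ennreal (Y j)" for j
    unfolding IY(1)[symmetric] I_def using kk2[of j] \<rho>(1)[of j] p
    by (intro nn_integral_mono mult_mono ennreal_leI powr_mono2) (auto simp: w_def split: split_indicator)
  ultimately have "(\<integral>\<^sup>+x\<in>ball x0 r0. ennreal (max (u x - 2 * K) 0 powr \<kappa>) \<partial>lborel) \<le> 0"
    by (intro LIMSEQ_le_const) auto
  then have "AE x in lborel. x \<in> ball x0 r0 \<longrightarrow> u x \<le> 2 * K"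
    by (intro AE_le_if_nn_integral_powr_eq_0[where r=\<kappa>]) auto
  then show ?thesis by blast
qed

section \<open>Sup bound by the tail\<close>

text \<open>The setting of the sup estimate, detached from minimizers. \<open>T_le\<close> expresses
  that \<open>T\<close> is at most the function h of radius 2R at \<open>k\<close>;
  \<open>a1_le\<close> absorbs the excess of the coefficient into the first phase;
  \<open>density\<close> is Chebyshev's inequality for the tail on the annulus. \<open>M\<close>
  only limits the heights for which \<open>a1_le\<close> holds, so the constants defined below
  depend on it through \<open>Cb\<close> alone.\<close>

locale caccioppoli_tail =
  fixes p q \<sigma> \<tau> C Cb am a1 T R M k :: real and x0 :: "'a::euclidean_space" and u :: "'a \<Rightarrow> real"
  assumes p: "1 < p" "p \<le> q" and \<sigma>: "0 < \<sigma>" "\<sigma> \<le> q" and \<tau>: "0 < \<tau>" "\<tau> \<le> q"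
    and C: "0 < C" and Cb: "0 \<le> Cb" and am: "0 \<le> am" and a1: "0 \<le> a1" and R: "0 < R" and T: "0 \<le> T" and k: "0 < k"
    and u[measurable]: "u \<in> borel_measurable borel"
    and cacc: "caccioppoli_class C p q \<sigma> \<tau> am a1 T (R / 4) (R / 2) x0 u"
    and a1_le: "\<And>N. 0 < N \<Longrightarrow> N \<le> M \<Longrightarrow>
      a1 * (N powr q * (2 * R) powr (- \<tau>)) \<le> am * (N powr q * (2 * R) powr (- \<tau>)) + Cb * (N powr p * (2 * R) powr (- \<sigma>))"
    and T_le: "T \<le> k powr (p - 1) * (2 * R) powr (- \<sigma>) + am * (k powr (q - 1) * (2 * R) powr (- \<tau>))"
    and density: "\<And>c. 0 < c \<Longrightarrow>
      ennreal (c powr (p - 1) * (R / 2) powr (- (real DIM('a) + \<sigma>)) + am * (c powr (q - 1) * (R / 2) powr (- (real DIM('a) + \<tau>))))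
        * emeasure lborel {x \<in> ball x0 (R / 2) - ball x0 (R / 4). c < u x} \<le> ennreal (2 * T)"
begin

section \<open>Energy and tail in a common unit\<close>

definition n :: real where "n = real DIM('a)"
definition V :: real where "V = unit_ball_vol n"
text \<open>\<open>N\<close> times the function h of radius 2R at \<open>N\<close>, if
  \<open>am\<close> is the infimum of the coefficient: the two-phase energy of a jump of height
  \<open>N\<close> at scale \<open>R\<close>, up to the factor \<open>R powr (- n)\<close>. Gains
  and losses below are multiples of it, and it cancels.\<close>

definition G :: "real \<Rightarrow> real" where
  "G N = N powr p * (2 * R) powr (- \<sigma>) + am * (N powr q * (2 * R) powr (- \<tau>))"

lemma n_ge_1: "1 \<le> n" by (simp add: n_def Suc_leI)
lemma V_pos: "0 < V" by (simp add: V_def n_def)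
lemma G_pos: "0 < N \<Longrightarrow> 0 < G N" using R am by (simp add: G_def add_pos_nonneg)

text \<open>Passing from \<open>k\<close> to \<open>N \<ge> k\<close>, the first phase gains the
  factor \<open>(k / N) powr (p - 1)\<close> and the second the even smaller
  \<open>(k / N) powr (q - 1)\<close>, because \<open>p \<le> q\<close>.\<close>

lemma T_le_G:
  assumes "k \<le> N"
  shows "T * N \<le> (k / N) powr (p - 1) * G N"
proof -
  have N: "0 < N" using assms k by linarith
  define \<epsilon> where "\<epsilon> = (k / N) powr (p - 1)"
  have "k powr (p - 1) = \<epsilon> * N powr (p - 1)" using N by (simp add: \<epsilon>_def flip: powr_mult)
  moreover have "k powr (q - 1) \<le> \<epsilon> * N powr (q - 1)"
  proof -
    have "(k / N) powr (q - 1) \<le> \<epsilon>"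
      unfolding \<epsilon>_def using k N assms p by (intro powr_mono') auto
    then have "(k / N) powr (q - 1) * N powr (q - 1) \<le> \<epsilon> * N powr (q - 1)" by (intro mult_right_mono) auto
    then show ?thesis using N by (simp flip: powr_mult)
  qed
  ultimately have "T \<le> \<epsilon> * N powr (p - 1) * (2 * R) powr (- \<sigma>) + am * (\<epsilon> * N powr (q - 1) * (2 * R) powr (- \<tau>))"
    using T_le am mult_right_mono[of "k powr (q - 1)" "\<epsilon> * N powr (q - 1)" "(2 * R) powr (- \<tau>)"]
    by (smt (verit) mult_left_mono powr_ge_zero)
  then have "T * N \<le> (\<epsilon> * N powr (p - 1) * (2 * R) powr (- \<sigma>) + am * (\<epsilon> * N powr (q - 1) * (2 * R) powr (- \<tau>))) * N"
    using N by (intro mult_right_mono) auto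
  also have "\<dots> = \<epsilon> * ((N * N powr (p - 1)) * (2 * R) powr (- \<sigma>) + am * ((N * N powr (q - 1)) * (2 * R) powr (- \<tau>)))"
    by (simp add: algebra_simps)
  also have "\<dots> = \<epsilon> * G N" using N by (simp add: G_def powr_mult_base)
  finally show ?thesis by (simp add: \<epsilon>_def)
qed

text \<open>Chebyshev's inequality at the level \<open>N / 8\<close>, combined with
  \<open>T_le_G\<close>: the tail is so small in comparison with \<open>G N / N\<close> that
  \<open>u\<close> is below \<open>N / 8\<close> on most of the annulus. This level lies under the
  truncation level \<open>N / 4\<close> used in \<open>absorption\<close>.\<close>

lemma emeasure_annulus_le:
  assumes "k \<le> N"
  shows "emeasure lborel {x \<in> ball x0 (R / 2) - ball x0 (R / 4). N / 8 < u x}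
    \<le> ennreal (2 * 8 powr (q - 1) * (k / N) powr (p - 1) * R powr n)"
proof -
  have N: "0 < N" using assms k by linarith
  let ?Z = "{x \<in> ball x0 (R / 2) - ball x0 (R / 4). N / 8 < u x}"
  define \<epsilon> where "\<epsilon> = (k / N) powr (p - 1)"
  define d where "d = 8 powr (1 - q) * (R powr (- n) * (G N / N))"
  have G: "0 < G N" using G_pos[OF N] .
  have d: "0 < d" using N R G by (simp add: d_def)
  have scale: "R powr (- n) * (2 * R) powr (- c) \<le> (R / 2) powr (- (n + c))" if "0 \<le> c" for c
  proof -
    have "R powr (- n) * (2 * R) powr (- c) \<le> (R / 2) powr (- n) * (R / 2) powr (- c)"
      using R that n_ge_1 by (intro mult_mono powr_mono2') auto
    then show ?thesis by (simp flip: powr_add)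
  qed
  have pw: "8 powr (1 - q) * N powr (c - 1) \<le> (N / 8) powr (c - 1)" if "c \<le> q" for c
  proof -
    have "8 powr (1 - q) * N powr (c - 1) \<le> 8 powr (1 - c) * N powr (c - 1)"
      using that by (intro mult_right_mono powr_mono) auto
    also have "8 powr (1 - c) = 1 / 8 powr (c - 1)" using powr_minus_divide[of 8 "c - 1"] by simp
    finally show ?thesis by (simp add: powr_divide)
  qed
  have "d = 8 powr (1 - q) * N powr (p - 1) * (R powr (- n) * (2 * R) powr (- \<sigma>))
      + am * (8 powr (1 - q) * N powr (q - 1) * (R powr (- n) * (2 * R) powr (- \<tau>)))"
  proof -
    have "G N / N = N powr (p - 1) * (2 * R) powr (- \<sigma>) + am * (N powr (q - 1) * (2 * R) powr (- \<tau>))"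
      using N by (simp add: G_def powr_diff add_divide_distrib)
    then show ?thesis by (simp add: d_def algebra_simps)
  qed
  also have "\<dots> \<le> (N / 8) powr (p - 1) * (R / 2) powr (- (n + \<sigma>)) + am * ((N / 8) powr (q - 1) * (R / 2) powr (- (n + \<tau>)))"
    using scale[of \<sigma>] scale[of \<tau>] pw[of p] pw[of q] p \<sigma> \<tau> am
    by (intro add_mono mult_mono mult_left_mono) auto
  finally have "ennreal d * emeasure lborel ?Z
    \<le> ennreal ((N / 8) powr (p - 1) * (R / 2) powr (- (n + \<sigma>)) + am * ((N / 8) powr (q - 1) * (R / 2) powr (- (n + \<tau>)))) * emeasure lborel ?Z"
    by (intro mult_right_mono ennreal_leI) auto
  also have "\<dots> \<le> ennreal (2 * T)" using density[of "N / 8"] N by (simp add: n_def)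
  also have "2 * T \<le> 2 * (\<epsilon> * (G N / N))"
    using T_le_G[OF assms] N by (simp add: \<epsilon>_def field_simps)
  finally have "ennreal d * emeasure lborel ?Z \<le> ennreal (2 * (\<epsilon> * (G N / N)))" by (simp add: ennreal_leI)
  then have "ennreal (1 / d) * (ennreal d * emeasure lborel ?Z) \<le> ennreal (1 / d) * ennreal (2 * (\<epsilon> * (G N / N)))"
    by (intro mult_left_mono) auto
  also have "\<dots> = ennreal (2 * 8 powr (q - 1) * \<epsilon> * R powr n)"
  proof -
    have "1 / d * (2 * (\<epsilon> * (G N / N))) = 2 * 8 powr (q - 1) * \<epsilon> * R powr n"
    proof -
      have "d * (8 powr (q - 1) * R powr n) = (8 powr (1 - q) * 8 powr (q - 1)) * (R powr (- n) * R powr n) * (G N / N)"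
        by (simp add: d_def)
      also have "\<dots> = G N / N" using R by (simp flip: powr_add)
      finally have "G N / N = d * (8 powr (q - 1) * R powr n)" by simp
      then show ?thesis using d by simp
    qed
    moreover have "ennreal (1 / d) * ennreal (2 * (\<epsilon> * (G N / N))) = ennreal (1 / d * (2 * (\<epsilon> * (G N / N))))"
      using d by (intro ennreal_mult[symmetric]) (use G N in \<open>auto simp: \<epsilon>_def\<close>)
    ultimately show ?thesis by (simp only:)
  qed
  also have "ennreal (1 / d) * (ennreal d * emeasure lborel ?Z) = emeasure lborel ?Z"
    using d by (simp add: mult.assoc[symmetric] flip: ennreal_mult)
  finally show ?thesis by (simp add: \<epsilon>_def)
qed

definition C1 :: real where "C1 = C * (8 powr q * (1 + Cb))"

lemma C1_pos: "0 < C1" using C Cb by (simp add: C1_def)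

definition energy :: "real \<Rightarrow> real \<Rightarrow> ennreal" where
  "energy \<rho> c = (\<integral>\<^sup>+x\<in>ball x0 \<rho>. (\<integral>\<^sup>+y\<in>ball x0 \<rho>.
      ennreal (\<bar>max (u x - c) 0 - max (u y - c) 0\<bar> powr p * dist x y powr (- (n + \<sigma>))
        + am * (\<bar>max (u x - c) 0 - max (u y - c) 0\<bar> powr q * dist x y powr (- (n + \<tau>)))) \<partial>lborel) \<partial>lborel)"

text \<open>On the annulus \<open>w \<le> N\<close>, so the local error is at most \<open>H\<close>,
  a multiple of \<open>G N\<close>, times the measure of the level set there. The tail error is
  bounded by \<open>T * N\<close>, which has the factor \<open>(k / N) powr (p - 1)\<close>. Only
  the local error lacks this factor, and it sees only the annulus.\<close>

lemma energy_le:
  assumes c: "0 \<le> c" and \<rho>: "R / 4 \<le> \<rho>1" "\<rho>1 < \<rho>2" "\<rho>2 \<le> R / 2"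
    and N: "k \<le> N" "N \<le> M" and uN: "AE x in lborel. x \<in> ball x0 \<rho>2 \<longrightarrow> u x \<le> N"
  shows "energy \<rho>1 c \<le> ennreal (C1 * (R / (\<rho>2 - \<rho>1)) powr (n + q) * G N)
    * (emeasure lborel {x \<in> ball x0 \<rho>2 - ball x0 \<rho>1. c < u x}
       + ennreal ((k / N) powr (p - 1)) * emeasure lborel {x \<in> ball x0 \<rho>2. c < u x})"
proof -
  define \<epsilon> where "\<epsilon> = (k / N) powr (p - 1)"
  have N0: "0 < N" using N k by linarith
  have G: "0 < G N" using G_pos[OF N0] .
  define w where "w = (\<lambda>x. max (u x - c) 0)"
  have [measurable]: "w \<in> borel_measurable borel" unfolding w_def by measurable
  have w0: "0 \<le> w x" for x by (simp add: w_def)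
  have R0: "0 < \<rho>2" using \<rho> R by linarith
  have [measurable]: "ball x0 \<rho>2 - ball x0 \<rho>1 \<in> sets borel" by simp
  define H where "H = 8 powr q * (1 + Cb) * G N"
  have H: "0 \<le> H" using Cb G by (simp add: H_def)
  \<comment> \<open>The factor \<open>8 powr q\<close> converts powers of \<open>\<rho>2\<close>,
    which exceeds \<open>R / 4 = 2 * R / 8\<close>, into powers of \<open>2 * R\<close>.\<close>
  have sc: "\<rho>2 powr (- c) \<le> 8 powr q * (2 * R) powr (- c)" if "0 \<le> c" "c \<le> q" for c
  proof -
    have "\<rho>2 powr (- c) \<le> (2 * R / 8) powr (- c)" using that \<rho> R by (intro powr_mono2') auto
    also have "\<dots> = 8 powr c * (2 * R) powr (- c)"
      unfolding powr_divide powr_minus[of 8] by (simp add: divide_inverse)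
    also have "\<dots> \<le> 8 powr q * (2 * R) powr (- c)" using that by (intro mult_right_mono powr_mono) auto
    finally show ?thesis .
  qed
  have first: "\<rho>2 powr (- \<sigma>) * N powr p + a1 * (\<rho>2 powr (- \<tau>) * N powr q) \<le> H"
  proof -
    have "\<rho>2 powr (- \<sigma>) * N powr p + a1 * (\<rho>2 powr (- \<tau>) * N powr q)
        \<le> 8 powr q * (2 * R) powr (- \<sigma>) * N powr p + a1 * (8 powr q * (2 * R) powr (- \<tau>) * N powr q)"
      using sc[of \<sigma>] sc[of \<tau>] \<sigma> \<tau> a1 by (intro add_mono mult_right_mono mult_left_mono) auto
    also have "\<dots> = 8 powr q * (N powr p * (2 * R) powr (- \<sigma>) + a1 * (N powr q * (2 * R) powr (- \<tau>)))"
      by (simp add: algebra_simps)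
    also have "\<dots> \<le> 8 powr q * ((1 + Cb) * G N)"
    proof (rule mult_left_mono)
      have "0 \<le> Cb * (am * (N powr q * (2 * R) powr (- \<tau>)))" using Cb am by simp
      then show "N powr p * (2 * R) powr (- \<sigma>) + a1 * (N powr q * (2 * R) powr (- \<tau>)) \<le> (1 + Cb) * G N"
        using a1_le[OF N0 N(2)] by (simp add: G_def algebra_simps)
    qed simp
    finally show ?thesis by (simp add: H_def mult.assoc)
  qed
  have "energy \<rho>1 c \<le> ennreal (C * (\<rho>2 / (\<rho>2 - \<rho>1)) powr (n + q)) *
      ((\<integral>\<^sup>+x\<in>ball x0 \<rho>2 - ball x0 \<rho>1.
          ennreal (\<rho>2 powr (- \<sigma>) * w x powr p + a1 * (\<rho>2 powr (- \<tau>) * w x powr q)) \<partial>lborel)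
        + ennreal T * (\<integral>\<^sup>+x\<in>ball x0 \<rho>2. ennreal (w x) \<partial>lborel))"
    using cacc c \<rho> unfolding caccioppoli_class_def Let_def energy_def w_def n_def by blast
  also have "\<dots> \<le> ennreal (C * (R / (\<rho>2 - \<rho>1)) powr (n + q)) *
      (ennreal H * (emeasure lborel {x \<in> ball x0 \<rho>2 - ball x0 \<rho>1. c < u x} + ennreal \<epsilon> * emeasure lborel {x \<in> ball x0 \<rho>2. c < u x}))"
  proof (rule mult_mono)
    show "ennreal (C * (\<rho>2 / (\<rho>2 - \<rho>1)) powr (n + q)) \<le> ennreal (C * (R / (\<rho>2 - \<rho>1)) powr (n + q))"
      using C \<rho> R R0 n_ge_1 p by (intro ennreal_leI mult_left_mono powr_mono2 divide_right_mono) auto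
    have "(\<integral>\<^sup>+x\<in>ball x0 \<rho>2 - ball x0 \<rho>1.
          ennreal (\<rho>2 powr (- \<sigma>) * w x powr p + a1 * (\<rho>2 powr (- \<tau>) * w x powr q)) \<partial>lborel)
        \<le> (\<integral>\<^sup>+x. ennreal H * indicator {x \<in> ball x0 \<rho>2 - ball x0 \<rho>1. c < u x} x \<partial>lborel)"
    proof (rule nn_integral_mono_AE, use uN in eventually_elim)
      case (elim x)
      show ?case
      proof (cases "x \<in> ball x0 \<rho>2 - ball x0 \<rho>1 \<and> c < u x")
        case True
        then have wN: "w x \<le> N" using elim c N0 by (auto simp: w_def)
        have "\<rho>2 powr (- \<sigma>) * w x powr p + a1 * (\<rho>2 powr (- \<tau>) * w x powr q)
            \<le> \<rho>2 powr (- \<sigma>) * N powr p + a1 * (\<rho>2 powr (- \<tau>) * N powr q)"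
          using wN w0 p a1 by (intro add_mono mult_left_mono powr_mono2) auto
        then show ?thesis using first True by (auto intro!: ennreal_leI)
      next
        case False
        then have "w x = 0 \<or> x \<notin> ball x0 \<rho>2 - ball x0 \<rho>1" by (auto simp: w_def)
        then show ?thesis using p by auto
      qed
    qed
    also have "\<dots> = ennreal H * emeasure lborel {x \<in> ball x0 \<rho>2 - ball x0 \<rho>1. c < u x}"
      by (subst nn_integral_cmult_indicator) auto
    finally have A: "(\<integral>\<^sup>+x\<in>ball x0 \<rho>2 - ball x0 \<rho>1.
          ennreal (\<rho>2 powr (- \<sigma>) * w x powr p + a1 * (\<rho>2 powr (- \<tau>) * w x powr q)) \<partial>lborel)
        \<le> ennreal H * emeasure lborel {x \<in> ball x0 \<rho>2 - ball x0 \<rho>1. c < u x}" .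
    have "(\<integral>\<^sup>+x\<in>ball x0 \<rho>2. ennreal (w x) \<partial>lborel) \<le> (\<integral>\<^sup>+x. ennreal N * indicator {x \<in> ball x0 \<rho>2. c < u x} x \<partial>lborel)"
    proof (rule nn_integral_mono_AE, use uN in eventually_elim)
      case (elim x)
      then show ?case using c N0 by (auto simp: w_def indicator_def max_def intro!: ennreal_leI)
    qed
    also have "\<dots> = ennreal N * emeasure lborel {x \<in> ball x0 \<rho>2. c < u x}"
      by (subst nn_integral_cmult_indicator) auto
    finally have "ennreal T * (\<integral>\<^sup>+x\<in>ball x0 \<rho>2. ennreal (w x) \<partial>lborel)
        \<le> ennreal T * (ennreal N * emeasure lborel {x \<in> ball x0 \<rho>2. c < u x})"
      by (intro mult_left_mono) auto
    also have "\<dots> = ennreal (T * N) * emeasure lborel {x \<in> ball x0 \<rho>2. c < u x}"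
      using T N0 by (simp add: ennreal_mult mult.assoc)
    also have "\<dots> \<le> ennreal (H * \<epsilon>) * emeasure lborel {x \<in> ball x0 \<rho>2. c < u x}"
    proof (intro mult_right_mono ennreal_leI)
      have "1 \<le> 8 powr q * (1 + Cb)"
        using Cb p ge_one_powr_ge_zero[of 8 q] mult_mono[of 1 "8 powr q" 1 "1 + Cb"] by simp
      then have "G N \<le> H" using G mult_right_mono[of 1 "8 powr q * (1 + Cb)" "G N"] by (simp add: H_def)
      then have "\<epsilon> * G N \<le> \<epsilon> * H" by (intro mult_left_mono) (auto simp: \<epsilon>_def)
      then show "T * N \<le> H * \<epsilon>" using T_le_G[OF N(1)] by (simp add: \<epsilon>_def mult.commute)
    qed simp
    also have "\<dots> = ennreal H * (ennreal \<epsilon> * emeasure lborel {x \<in> ball x0 \<rho>2. c < u x})"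
      using H by (simp add: ennreal_mult \<epsilon>_def mult.assoc)
    finally show "(\<integral>\<^sup>+x\<in>ball x0 \<rho>2 - ball x0 \<rho>1.
          ennreal (\<rho>2 powr (- \<sigma>) * w x powr p + a1 * (\<rho>2 powr (- \<tau>) * w x powr q)) \<partial>lborel)
        + ennreal T * (\<integral>\<^sup>+x\<in>ball x0 \<rho>2. ennreal (w x) \<partial>lborel)
      \<le> ennreal H * (emeasure lborel {x \<in> ball x0 \<rho>2 - ball x0 \<rho>1. c < u x} + ennreal \<epsilon> * emeasure lborel {x \<in> ball x0 \<rho>2. c < u x})"
      using A by (simp add: distrib_left add_mono)
  qed auto
  also have "\<dots> = ennreal (C1 * (R / (\<rho>2 - \<rho>1)) powr (n + q) * G N) *
      (emeasure lborel {x \<in> ball x0 \<rho>2 - ball x0 \<rho>1. c < u x} + ennreal \<epsilon> * emeasure lborel {x \<in> ball x0 \<rho>2. c < u x})"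
  proof -
    have "ennreal (C * (R / (\<rho>2 - \<rho>1)) powr (n + q)) * ennreal H = ennreal (C1 * (R / (\<rho>2 - \<rho>1)) powr (n + q) * G N)"
      using C H by (simp add: C1_def H_def mult_ac flip: ennreal_mult)
    then show ?thesis by (simp only: mult.assoc[symmetric])
  qed
  finally show ?thesis by (simp add: \<epsilon>_def)
qed


section \<open>Smallness of the set where u exceeds N/2\<close>

definition C2 :: real where "C2 = 2 * 8 powr (q - 1)"
definition C3 :: real where "C3 = 4 powr q * (2 / V) * 2 powr n * C1 * 2 powr (n + q) * (C2 + V)"

lemma C2_pos: "0 < C2" by (simp add: C2_def)
lemma C3_pos: "0 < C3" using V_pos C1_pos C2_pos by (simp add: C3_def)

lemma emeasure_ball_V: "0 \<le> r \<Longrightarrow> emeasure lborel (ball (y::'a) r) = ennreal (V * r powr n)"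
  by (cases "r = 0") (simp_all add: emeasure_ball V_def n_def powr_realpow)

text \<open>Every point with \<open>u > N / 2\<close> sees the set \<open>B\<close> in the annulus,
  where \<open>u \<le> N / 8\<close>, at distance less than \<open>R\<close>. The truncation at
  \<open>N / 4\<close> jumps by at least \<open>N / 4\<close> between them, which costs energy
  \<open>g * (v / 2)\<close> per unit volume. The Caccioppoli inequality from the intermediate
  radius \<open>m\<close> to \<open>\<rho>'\<close> bounds the total energy by
  \<open>(k / N) powr (p - 1) * G N\<close> times a constant, since both the annular level set and
  the tail carry this factor. The hypothesis \<open>small\<close> leaves \<open>B\<close> at least
  half of the volume \<open>v\<close>.\<close>

lemma absorption:
  assumes \<rho>: "R / 4 \<le> \<rho>" "\<rho> < \<rho>'" "\<rho>' \<le> R / 2"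
    and N: "k \<le> N" "N \<le> M" and uN: "AE x in lborel. x \<in> ball x0 \<rho>' \<longrightarrow> u x \<le> N"
    and small: "C2 * (k / N) powr (p - 1) * R powr n \<le> V * ((\<rho>' - \<rho>) / 2) powr n / 2"
  shows "emeasure lborel {x \<in> ball x0 ((\<rho> + \<rho>') / 2). N / 2 < u x}
    \<le> ennreal (C3 * (R / (\<rho>' - \<rho>)) powr (2 * n + q) * (k / N) powr (p - 1) * R powr n)"
proof -
  define \<epsilon> where "\<epsilon> = (k / N) powr (p - 1)"
  have N0: "0 < N" using N k by linarith
  have G: "0 < G N" using G_pos[OF N0] .
  define D where "D = \<rho>' - \<rho>"
  have D: "0 < D" using \<rho> by (simp add: D_def)
  define m where "m = (\<rho> + \<rho>') / 2"
  have m: "\<rho> < m" "m < \<rho>'" "m - \<rho> = D / 2" "\<rho>' - m = D / 2" "R / 4 \<le> m" using \<rho> by (auto simp: m_def D_def field_simps)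
  have \<rho>0: "0 < \<rho>" using \<rho> R by linarith
  define Z where "Z = {x \<in> ball x0 (R / 2) - ball x0 (R / 4). N / 8 < u x}"
  define B where "B = ball x0 m - ball x0 \<rho> - Z"
  define A where "A = {x \<in> ball x0 m. N / 2 < u x}"
  have [measurable]: "Z \<in> sets borel" unfolding Z_def by measurable
  have [measurable]: "B \<in> sets borel" "A \<in> sets borel" unfolding B_def A_def by measurable
  define v where "v = V * (D / 2) powr n"
  have v: "0 < v" using D V_pos by (simp add: v_def)
  have Zle: "emeasure lborel Z \<le> ennreal (v / 2)"
    using emeasure_annulus_le[OF N(1)] small unfolding Z_def C2_def v_def D_def
    by (meson ennreal_leI order_trans)
  have "ennreal v \<le> emeasure lborel (ball x0 m - ball x0 \<rho>)"
  proof -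
    have "emeasure lborel (ball x0 m - ball x0 \<rho>) = emeasure lborel (ball x0 m) - emeasure lborel (ball x0 \<rho>)"
      using m emeasure_lborel_ball_finite[of x0 \<rho>] by (intro emeasure_Diff) (auto simp: subset_iff)
    also have "\<dots> = ennreal (V * m powr n - V * \<rho> powr n)"
      using \<rho>0 m V_pos by (simp add: emeasure_ball_V ennreal_minus)
    \<comment> \<open>By superadditivity of the power \<open>n\<close>, an annulus of width
      \<open>D / 2\<close> has at least the volume of a ball of radius \<open>D / 2\<close>.\<close>
    also have "ennreal v \<le> \<dots>"
    proof (rule ennreal_leI)
      have "(D / 2) powr n + \<rho> powr n \<le> (D / 2 + \<rho>) powr n"
        using D \<rho>0 n_ge_1 by (intro powr_superadditive) auto
      moreover have "D / 2 + \<rho> = m" using m by simp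
      ultimately have "(D / 2) powr n + \<rho> powr n \<le> m powr n" by simp
      then have "V * ((D / 2) powr n + \<rho> powr n) \<le> V * m powr n"
        using V_pos by (intro mult_left_mono) auto
      then show "v \<le> V * m powr n - V * \<rho> powr n" by (simp add: v_def algebra_simps)
    qed
    finally show ?thesis .
  qed
  also have "\<dots> \<le> emeasure lborel (B \<union> Z)"
    by (intro emeasure_mono) (auto simp: B_def)
  also have "\<dots> \<le> emeasure lborel B + emeasure lborel Z" by (intro emeasure_subadditive) auto
  also have "\<dots> \<le> emeasure lborel B + ennreal (v / 2)" using Zle by (intro add_left_mono)
  finally have "ennreal (v / 2) + ennreal (v / 2) \<le> ennreal (v / 2) + emeasure lborel B"
    using v by (simp add: add.commute flip: ennreal_plus)
  then have B: "ennreal (v / 2) \<le> emeasure lborel B" by (simp add: ennreal_add_left_cancel_le)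
  define g where "g = 4 powr (- q) * (R powr (- n) * G N)"
  have g: "0 < g" using G R by (simp add: g_def)
  let ?w = "\<lambda>x. max (u x - N / 4) 0"
  have point: "g \<le> \<bar>?w x - ?w y\<bar> powr p * dist x y powr (- (n + \<sigma>)) + am * (\<bar>?w x - ?w y\<bar> powr q * dist x y powr (- (n + \<tau>)))"
    if x: "x \<in> A" and y: "y \<in> B" for x y
  proof -
    have uy: "u y \<le> N / 8" using y \<rho> m unfolding B_def Z_def by auto
    have ux: "N / 2 < u x" using x by (simp add: A_def)
    have wd: "N / 4 \<le> \<bar>?w x - ?w y\<bar>" using ux uy N0 by (auto simp: max_def)
    have "dist x y < R"
    proof -
      have "dist x0 x < m" "dist x0 y < m" using x y by (auto simp: A_def B_def)
      then show ?thesis using dist_triangle[of x y x0] m \<rho> by (simp add: dist_commute)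
    qed
    moreover have "x \<noteq> y" using ux uy N0 by auto
    ultimately have d: "R powr (- n) * (2 * R) powr (- c) \<le> dist x y powr (- (n + c))" if "0 \<le> c" for c
    proof -
      have "R powr (- n) * (2 * R) powr (- c) \<le> R powr (- n) * R powr (- c)"
        using that R by (intro mult_left_mono powr_mono2') auto
      also have "\<dots> = R powr (- (n + c))" by (simp flip: powr_add)
      also have "\<dots> \<le> dist x y powr (- (n + c))"
        using \<open>dist x y < R\<close> \<open>x \<noteq> y\<close> that n_ge_1 by (intro powr_mono2') auto
      finally show ?thesis .
    qed
    have w: "4 powr (- q) * N powr r \<le> \<bar>?w x - ?w y\<bar> powr r" if "0 \<le> r" "r \<le> q" for r
    proof -
      have "4 powr (- q) * N powr r \<le> 4 powr (- r) * N powr r"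
        using that by (intro mult_right_mono powr_mono) auto
      also have "\<dots> = (N / 4) powr r" unfolding powr_divide powr_minus by (simp add: divide_inverse)
      also have "\<dots> \<le> \<bar>?w x - ?w y\<bar> powr r" using wd N0 that by (intro powr_mono2) auto
      finally show ?thesis .
    qed
    have "g = 4 powr (- q) * N powr p * (R powr (- n) * (2 * R) powr (- \<sigma>))
        + am * (4 powr (- q) * N powr q * (R powr (- n) * (2 * R) powr (- \<tau>)))"
      by (simp add: g_def G_def algebra_simps)
    also have "\<dots> \<le> \<bar>?w x - ?w y\<bar> powr p * dist x y powr (- (n + \<sigma>)) + am * (\<bar>?w x - ?w y\<bar> powr q * dist x y powr (- (n + \<tau>)))"
      using p \<sigma> \<tau> am by (intro add_mono mult_mono mult_left_mono w d) auto
    finally show ?thesis .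
  qed
  have inner: "ennreal (g * (v / 2)) \<le> (\<integral>\<^sup>+y\<in>ball x0 m.
      ennreal (\<bar>?w x - ?w y\<bar> powr p * dist x y powr (- (n + \<sigma>))
        + am * (\<bar>?w x - ?w y\<bar> powr q * dist x y powr (- (n + \<tau>)))) \<partial>lborel)" if "x \<in> A" for x
  proof -
    have "ennreal (g * (v / 2)) = ennreal g * ennreal (v / 2)"
      using g v by (intro ennreal_mult) auto
    also have "\<dots> \<le> ennreal g * emeasure lborel B" using B by (intro mult_left_mono) auto
    also have "\<dots> \<le> (\<integral>\<^sup>+y\<in>ball x0 m.
      ennreal (\<bar>?w x - ?w y\<bar> powr p * dist x y powr (- (n + \<sigma>))
        + am * (\<bar>?w x - ?w y\<bar> powr q * dist x y powr (- (n + \<tau>)))) \<partial>lborel)"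
    proof (rule emeasure_mult_le_nn_integral)
      fix y assume y: "y \<in> B"
      then have "y \<in> ball x0 m" by (auto simp: B_def)
      then show "ennreal g \<le> ennreal (\<bar>?w x - ?w y\<bar> powr p * dist x y powr (- (n + \<sigma>))
        + am * (\<bar>?w x - ?w y\<bar> powr q * dist x y powr (- (n + \<tau>)))) * indicator (ball x0 m) y"
        using point[OF that y] by (simp add: ennreal_leI)
    qed measurable
    finally show ?thesis .
  qed
  have "ennreal (g * (v / 2)) * emeasure lborel A \<le> energy m (N / 4)"
    unfolding energy_def
  proof (rule emeasure_mult_le_nn_integral)
    fix x assume x: "x \<in> A"
    then have "x \<in> ball x0 m" by (auto simp: A_def)
    then show "ennreal (g * (v / 2)) \<le> (\<integral>\<^sup>+y\<in>ball x0 m.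
      ennreal (\<bar>?w x - ?w y\<bar> powr p * dist x y powr (- (n + \<sigma>))
        + am * (\<bar>?w x - ?w y\<bar> powr q * dist x y powr (- (n + \<tau>)))) \<partial>lborel) * indicator (ball x0 m) x"
      using inner[OF x] by simp
  qed measurable
  also have "\<dots> \<le> ennreal (C1 * (R / (\<rho>' - m)) powr (n + q) * G N)
    * (emeasure lborel {x \<in> ball x0 \<rho>' - ball x0 m. N / 4 < u x}
       + ennreal \<epsilon> * emeasure lborel {x \<in> ball x0 \<rho>'. N / 4 < u x})"
    unfolding \<epsilon>_def using N0 by (intro energy_le m \<rho> N uN) auto
  also have "\<dots> \<le> ennreal (C1 * (R / (\<rho>' - m)) powr (n + q) * G N)
    * (ennreal (C2 * \<epsilon> * R powr n) + ennreal \<epsilon> * ennreal (V * R powr n))"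
  proof (intro mult_left_mono add_mono)
    have "emeasure lborel {x \<in> ball x0 \<rho>' - ball x0 m. N / 4 < u x} \<le> emeasure lborel Z"
      using m \<rho> N0 by (intro emeasure_mono) (auto simp: Z_def)
    then show "emeasure lborel {x \<in> ball x0 \<rho>' - ball x0 m. N / 4 < u x} \<le> ennreal (C2 * \<epsilon> * R powr n)"
      using emeasure_annulus_le[OF N(1)] unfolding Z_def C2_def \<epsilon>_def by (rule order_trans)
    have "emeasure lborel {x \<in> ball x0 \<rho>'. N / 4 < u x} \<le> emeasure lborel (ball x0 R)"
      using \<rho> R by (intro emeasure_mono) auto
    then show "emeasure lborel {x \<in> ball x0 \<rho>'. N / 4 < u x} \<le> ennreal (V * R powr n)"
      using R by (simp add: emeasure_ball_V)
  qed auto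
  also have "\<dots> = ennreal (C1 * (R / (\<rho>' - m)) powr (n + q) * G N * ((C2 + V) * \<epsilon> * R powr n))"
    using C1_pos C2_pos V_pos G
    by (simp add: \<epsilon>_def algebra_simps flip: ennreal_mult ennreal_plus)
  finally have le: "ennreal (g * (v / 2)) * emeasure lborel A
    \<le> ennreal (C1 * (R / (\<rho>' - m)) powr (n + q) * G N * ((C2 + V) * \<epsilon> * R powr n))" .
  have "emeasure lborel A = ennreal (1 / (g * (v / 2))) * (ennreal (g * (v / 2)) * emeasure lborel A)"
    using g v by (simp add: mult.assoc[symmetric] flip: ennreal_mult)
  also have "\<dots> \<le> ennreal (1 / (g * (v / 2))) * ennreal (C1 * (R / (\<rho>' - m)) powr (n + q) * G N * ((C2 + V) * \<epsilon> * R powr n))"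
    using le by (intro mult_left_mono) auto
  also have "\<dots> = ennreal (1 / (g * (v / 2)) * (C1 * (R / (\<rho>' - m)) powr (n + q) * G N * ((C2 + V) * \<epsilon> * R powr n)))"
    using g v by (intro ennreal_mult[symmetric]) (use C1_pos C2_pos V_pos G in \<open>auto simp: \<epsilon>_def\<close>)
  also have "1 / (g * (v / 2)) * (C1 * (R / (\<rho>' - m)) powr (n + q) * G N * ((C2 + V) * \<epsilon> * R powr n))
      = C3 * (R / D) powr (2 * n + q) * \<epsilon> * R powr n"
  proof -
    have e1: "1 / g = 4 powr q * R powr n / G N"
      using R G by (simp add: g_def powr_minus field_simps)
    have e2: "1 / (v / 2) = 2 / V * 2 powr n / D powr n"
      using D V_pos by (simp add: v_def powr_divide field_simps)
    have e3: "(R / (\<rho>' - m)) powr (n + q) = 2 powr (n + q) * (R / D) powr (n + q)"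
    proof -
      have "R / (\<rho>' - m) = 2 * (R / D)" unfolding m(4) by simp
      then show ?thesis by (simp only: powr_mult)
    qed
    have e4: "(R / D) powr (2 * n + q) = R powr n / D powr n * (R / D) powr (n + q)"
      by (simp flip: powr_divide powr_add)
    have "1 / (g * (v / 2)) * (C1 * (R / (\<rho>' - m)) powr (n + q) * G N * ((C2 + V) * \<epsilon> * R powr n))
      = (1 / g) * (1 / (v / 2)) * (C1 * (R / (\<rho>' - m)) powr (n + q) * G N * ((C2 + V) * \<epsilon> * R powr n))"
      by simp
    also have "\<dots> = C3 * (R / D) powr (2 * n + q) * \<epsilon> * R powr n"
      unfolding e1 e2 e3 e4 C3_def using G by simp
    finally show ?thesis .
  qed
  finally show ?thesis by (simp add: A_def m_def D_def \<epsilon>_def)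
qed


section \<open>De Giorgi iteration\<close>

definition \<gamma> :: real where "\<gamma> = min \<sigma> \<tau> / n"
text \<open>The smaller of the constants in \<open>nn_integral_dist_powr_Diff_ge\<close> for the
  orders \<open>\<sigma>\<close> and \<open>\<tau>\<close>, just as \<open>\<gamma>\<close> is the
  smaller of the exponents gained there: one lower bound thus serves both phases.\<close>

definition C5 :: real where
  "C5 = min ((2 powr (n + 1) / V) powr (- 1 - \<sigma> / n)) ((2 powr (n + 1) / V) powr (- 1 - \<tau> / n))"
definition C6 :: real where "C6 = 2 * C1 * 4 powr (n + q) * 8 powr q / C5"
definition b :: real where "b = 2 powr (n + q) * 2 powr q"

lemma \<gamma>: "0 < \<gamma>" "\<gamma> \<le> \<sigma> / n" "\<gamma> \<le> \<tau> / n"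
  using \<sigma> \<tau> n_ge_1 by (auto simp: \<gamma>_def min_def divide_right_mono)
lemma C5_pos: "0 < C5" using V_pos by (simp add: C5_def)
lemma C6_pos: "0 < C6" using C1_pos C5_pos by (simp add: C6_def)
lemma b_gt_1: "1 < b" using n_ge_1 p by (simp add: b_def flip: powr_add)

text \<open>The set where \<open>u > c\<close> has proportion at most \<open>\<alpha>\<close>, so
  each point with \<open>u > c'\<close> sees its complement with a kernel integral of order
  \<open>\<alpha> powr (- \<gamma>)\<close>, and the jump is at least \<open>c' - c\<close>. Since
  \<open>\<alpha> \<le> 1\<close>, lowering the exponents \<open>\<sigma> / n\<close> and
  \<open>\<tau> / n\<close> to \<open>\<gamma>\<close> is harmless. The powers of 8 and 2 come from
  the size \<open>N / 8 / 2 ^ j\<close> of the gap between levels.\<close>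

lemma energy_ge:
  assumes \<rho>: "R / 4 \<le> \<rho>" and c: "c \<le> c'" and N: "0 < N" and j: "c' - c = N / 8 / 2 ^ j"
    and \<alpha>: "0 < \<alpha>" "\<alpha> \<le> 1" "\<alpha> \<le> V / (4 powr n * 2 powr (n + 1))"
    and small: "emeasure lborel {x \<in> ball x0 \<rho>. c < u x} \<le> ennreal (\<alpha> * R powr n)"
  shows "ennreal (C5 * (8 powr (- q) * (2 powr (- q)) ^ j * \<alpha> powr (- \<gamma>) * G N)) * emeasure lborel {x \<in> ball x0 \<rho>. c' < u x}
    \<le> energy \<rho> c"
proof -
  define h where "h = c' - c"
  have h: "0 < h" "h = N / 8 / 2 ^ j" using j N by (auto simp: h_def)
  define S where "S = {y. c < u y}"
  have [measurable]: "S \<in> sets borel" unfolding S_def by measurable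
  define m where "m = \<alpha> * R powr n"
  have m: "0 < m" using \<alpha> R by (simp add: m_def)
  have mV: "m \<le> V * \<rho> powr n / 2 powr (n + 1)"
  proof -
    have "m \<le> V / (4 powr n * 2 powr (n + 1)) * R powr n"
      unfolding m_def using \<alpha> by (intro mult_right_mono) auto
    also have "\<dots> = V * (R / 4) powr n / 2 powr (n + 1)" by (simp add: powr_divide)
    also have "\<dots> \<le> V * \<rho> powr n / 2 powr (n + 1)"
      using \<rho> R V_pos n_ge_1 by (intro divide_right_mono mult_left_mono powr_mono2) auto
    finally show ?thesis .
  qed
  have Sm: "emeasure lborel (ball x0 \<rho> \<inter> S) \<le> ennreal m"
  proof -
    have "ball x0 \<rho> \<inter> S = {x \<in> ball x0 \<rho>. c < u x}" by (auto simp: S_def)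
    then show ?thesis using small by (simp add: m_def)
  qed
  let ?w = "\<lambda>x. max (u x - c) 0"
  have iso: "ennreal (C5 * (\<alpha> powr (- \<gamma>) * (2 * R) powr (- e)))
      \<le> (\<integral>\<^sup>+y\<in>ball x0 \<rho> - S. ennreal (dist x y powr (- (n + e))) \<partial>lborel)"
    if e: "0 \<le> e" "\<gamma> \<le> e / n" and C5e: "C5 \<le> (2 powr (n + 1) / V) powr (- 1 - e / n)" and x: "x \<in> ball x0 \<rho>" for e x
  proof -
    have "m powr (- e / n) = \<alpha> powr (- e / n) * R powr (- e)"
      using n_ge_1 by (simp add: m_def powr_mult powr_powr)
    moreover have "\<alpha> powr (- \<gamma>) * (2 * R) powr (- e) \<le> \<alpha> powr (- e / n) * R powr (- e)"
      using \<alpha> e R by (intro mult_mono powr_mono' powr_mono2') auto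
    ultimately have "C5 * (\<alpha> powr (- \<gamma>) * (2 * R) powr (- e)) \<le> (2 powr (n + 1) / V) powr (- 1 - e / n) * m powr (- e / n)"
      using C5e C5_pos by (intro mult_mono) auto
    then have "ennreal (C5 * (\<alpha> powr (- \<gamma>) * (2 * R) powr (- e))) \<le> ennreal ((2 powr (n + 1) / V) powr (- 1 - e / n) * m powr (- e / n))"
      by (rule ennreal_leI)
    also have "\<dots> \<le> (\<integral>\<^sup>+y\<in>ball x0 \<rho> - S. ennreal (dist x y powr (- (n + e))) \<partial>lborel)"
      using nn_integral_dist_powr_Diff_ge[OF x _ Sm m _ e(1)] mV by (simp add: V_def n_def)
    finally show ?thesis .
  qed
  have hp: "8 powr (- q) * (2 powr (- q)) ^ j * N powr r \<le> h powr r" if r: "0 \<le> r" "r \<le> q" for r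
  proof -
    have "(1::real) \<le> 8 * 2 ^ j" using one_le_power[of "2::real" j] by linarith
    then have "(8 * 2 ^ j) powr (- q) * N powr r \<le> (8 * 2 ^ j) powr (- r) * N powr r"
      using r by (intro mult_right_mono powr_mono) auto
    also have "\<dots> = (N / (8 * 2 ^ j)) powr r" unfolding powr_divide powr_minus by (simp add: divide_inverse)
    finally have "(8 * 2 ^ j) powr (- q) * N powr r \<le> h powr r" by (simp add: h)
    moreover have "(8 * 2 ^ j :: real) powr (- q) = 8 powr (- q) * (2 powr (- q)) ^ j"
      by (simp only: powr_mult two_power_powr)
    ultimately show ?thesis by simp
  qed
  define A where "A = {x \<in> ball x0 \<rho>. c' < u x}"
  have [measurable]: "A \<in> sets borel" unfolding A_def by measurable
  have inner: "ennreal (C5 * (8 powr (- q) * (2 powr (- q)) ^ j * \<alpha> powr (- \<gamma>) * G N)) \<le> (\<integral>\<^sup>+y\<in>ball x0 \<rho>.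
      ennreal (\<bar>?w x - ?w y\<bar> powr p * dist x y powr (- (n + \<sigma>))
        + am * (\<bar>?w x - ?w y\<bar> powr q * dist x y powr (- (n + \<tau>)))) \<partial>lborel)" if x: "x \<in> A" for x
  proof -
    have xB: "x \<in> ball x0 \<rho>" using x by (simp add: A_def)
    define t where "t = 8 powr (- q) * (2 powr (- q)) ^ j"
    have t: "0 \<le> t" by (simp add: t_def)
    have "C5 * (t * \<alpha> powr (- \<gamma>) * G N)
        = (t * N powr p) * (C5 * (\<alpha> powr (- \<gamma>) * (2 * R) powr (- \<sigma>)))
          + am * (t * N powr q) * (C5 * (\<alpha> powr (- \<gamma>) * (2 * R) powr (- \<tau>)))"
      by (simp add: G_def algebra_simps)
    also have "\<dots> \<le> h powr p * (C5 * (\<alpha> powr (- \<gamma>) * (2 * R) powr (- \<sigma>)))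
          + am * h powr q * (C5 * (\<alpha> powr (- \<gamma>) * (2 * R) powr (- \<tau>)))"
      using hp[of p] hp[of q] p am C5_pos unfolding t_def by (intro add_mono mult_right_mono mult_left_mono) auto
    finally have "ennreal (C5 * (t * \<alpha> powr (- \<gamma>) * G N))
      \<le> ennreal (h powr p * (C5 * (\<alpha> powr (- \<gamma>) * (2 * R) powr (- \<sigma>)))
          + am * h powr q * (C5 * (\<alpha> powr (- \<gamma>) * (2 * R) powr (- \<tau>))))"
      by (rule ennreal_leI)
    also have "\<dots> = ennreal (h powr p) * ennreal (C5 * (\<alpha> powr (- \<gamma>) * (2 * R) powr (- \<sigma>)))
          + ennreal (am * h powr q) * ennreal (C5 * (\<alpha> powr (- \<gamma>) * (2 * R) powr (- \<tau>)))"
      using C5_pos am by (subst ennreal_plus) (auto simp: ennreal_mult)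
    also have "\<dots> \<le> ennreal (h powr p) * (\<integral>\<^sup>+y\<in>ball x0 \<rho> - S. ennreal (dist x y powr (- (n + \<sigma>))) \<partial>lborel)
          + ennreal (am * h powr q) * (\<integral>\<^sup>+y\<in>ball x0 \<rho> - S. ennreal (dist x y powr (- (n + \<tau>))) \<partial>lborel)"
      using \<sigma> \<tau> \<gamma> xB by (intro add_mono mult_left_mono iso) (auto simp: C5_def)
    also have "\<dots> = (\<integral>\<^sup>+y. ennreal (h powr p) * (ennreal (dist x y powr (- (n + \<sigma>))) * indicator (ball x0 \<rho> - S) y)
          + ennreal (am * h powr q) * (ennreal (dist x y powr (- (n + \<tau>))) * indicator (ball x0 \<rho> - S) y) \<partial>lborel)"
      by (subst nn_integral_add) (auto simp: nn_integral_cmult)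
    also have "\<dots> \<le> (\<integral>\<^sup>+y\<in>ball x0 \<rho>.
      ennreal (\<bar>?w x - ?w y\<bar> powr p * dist x y powr (- (n + \<sigma>))
        + am * (\<bar>?w x - ?w y\<bar> powr q * dist x y powr (- (n + \<tau>)))) \<partial>lborel)"
    proof (intro nn_integral_mono)
      fix y
      show "ennreal (h powr p) * (ennreal (dist x y powr (- (n + \<sigma>))) * indicator (ball x0 \<rho> - S) y)
          + ennreal (am * h powr q) * (ennreal (dist x y powr (- (n + \<tau>))) * indicator (ball x0 \<rho> - S) y)
        \<le> ennreal (\<bar>?w x - ?w y\<bar> powr p * dist x y powr (- (n + \<sigma>))
        + am * (\<bar>?w x - ?w y\<bar> powr q * dist x y powr (- (n + \<tau>)))) * indicator (ball x0 \<rho>) y"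
      proof (cases "y \<in> ball x0 \<rho> - S")
        case True
        then have "u y \<le> c" by (auto simp: S_def)
        moreover have "c' < u x" using x by (simp add: A_def)
        ultimately have "h \<le> \<bar>?w x - ?w y\<bar>" using c by (auto simp: h_def max_def)
        then have "h powr p * dist x y powr (- (n + \<sigma>)) + am * (h powr q * dist x y powr (- (n + \<tau>)))
            \<le> \<bar>?w x - ?w y\<bar> powr p * dist x y powr (- (n + \<sigma>)) + am * (\<bar>?w x - ?w y\<bar> powr q * dist x y powr (- (n + \<tau>)))"
          using h p am by (intro add_mono mult_left_mono mult_right_mono powr_mono2) auto
        moreover have "ennreal (h powr p) * ennreal (dist x y powr (- (n + \<sigma>))) + ennreal (am * h powr q) * ennreal (dist x y powr (- (n + \<tau>)))
            = ennreal (h powr p * dist x y powr (- (n + \<sigma>)) + am * (h powr q * dist x y powr (- (n + \<tau>))))"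
          using am by (subst ennreal_plus) (auto simp: ennreal_mult mult.assoc)
        ultimately show ?thesis using True by (simp add: ennreal_leI)
      qed simp
    qed
    finally show ?thesis by (simp add: t_def)
  qed
  have "ennreal (C5 * (8 powr (- q) * (2 powr (- q)) ^ j * \<alpha> powr (- \<gamma>) * G N)) * emeasure lborel A \<le> energy \<rho> c"
    unfolding energy_def
  proof (rule emeasure_mult_le_nn_integral)
    fix x assume x: "x \<in> A"
    then have "x \<in> ball x0 \<rho>" by (auto simp: A_def)
    then show "ennreal (C5 * (8 powr (- q) * (2 powr (- q)) ^ j * \<alpha> powr (- \<gamma>) * G N)) \<le> (\<integral>\<^sup>+y\<in>ball x0 \<rho>.
      ennreal (\<bar>?w x - ?w y\<bar> powr p * dist x y powr (- (n + \<sigma>))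
        + am * (\<bar>?w x - ?w y\<bar> powr q * dist x y powr (- (n + \<tau>)))) \<partial>lborel) * indicator (ball x0 \<rho>) x"
      using inner[OF x] by simp
  qed measurable
  then show ?thesis by (simp add: A_def)
qed

text \<open>Levels rise from \<open>N / 2\<close> to \<open>3 / 4 * N\<close> while radii shrink
  from the midpoint to \<open>\<rho>\<close>. Lower and upper bound of the energy at the same level
  and radius give a superlinear recursion for the proportions \<open>\<alpha> j\<close>. Of the
  factor \<open>(k / N) powr (p - 1)\<close> only that it is at most 1 enters here; it was spent on
  making the initial proportion small.\<close>

lemma de_giorgi_iteration:
  assumes \<rho>: "R / 4 \<le> \<rho>" "\<rho> < \<rho>'" "\<rho>' \<le> R / 2"
    and N: "k \<le> N" "N \<le> M" and uN: "AE x in lborel. x \<in> ball x0 \<rho>' \<longrightarrow> u x \<le> N"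
    and small: "emeasure lborel {x \<in> ball x0 ((\<rho> + \<rho>') / 2). N / 2 < u x} \<le> ennreal (\<kappa> * R powr n)"
    and \<kappa>: "0 \<le> \<kappa>" "\<kappa> \<le> 1" "\<kappa> \<le> V / (4 powr n * 2 powr (n + 1))"
      "\<kappa> \<le> (C6 * (R / (\<rho>' - \<rho>)) powr (n + q)) powr (- 1 / \<gamma>) * b powr (- 1 / \<gamma>\<^sup>2)"
  shows "AE x in lborel. x \<in> ball x0 \<rho> \<longrightarrow> u x \<le> 3 / 4 * N"
proof -
  define D where "D = \<rho>' - \<rho>"
  have D: "0 < D" using \<rho> by (simp add: D_def)
  have N0: "0 < N" using N k by linarith
  have G: "0 < G N" using G_pos[OF N0] .
  define r where "r = (\<lambda>j::nat. \<rho> + D / 2 / 2 ^ j)"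
  define c where "c = (\<lambda>j::nat. 3 / 4 * N - N / 4 / 2 ^ j)"
  have r0: "r 0 = (\<rho> + \<rho>') / 2" by (simp add: r_def D_def field_simps)
  have r_gt: "\<rho> < r j" for j using D by (simp add: r_def)
  have r_dec: "r (Suc j) < r j" for j using D by (simp add: r_def field_simps)
  have r_diff: "r j - r (Suc j) = D / 4 / 2 ^ j" for j by (simp add: r_def field_simps)
  have r_le: "r j \<le> \<rho>'" for j
  proof -
    have "D / 2 / 2 ^ j \<le> D / 2 / 1" using D by (intro divide_left_mono) auto
    then show ?thesis using D D_def unfolding r_def by linarith
  qed
  have c_diff: "c (Suc j) - c j = N / 8 / 2 ^ j" for j by (simp add: c_def field_simps)
  have c_inc: "c j \<le> c (Suc j)" for j using c_diff[of j] N0 by (smt (verit) divide_pos_pos zero_less_power)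
  have c_nonneg: "0 \<le> c j" for j
  proof -
    have "N / 4 / 2 ^ j \<le> N / 4 / 1" using N0 by (intro divide_left_mono) auto
    then show ?thesis using N0 by (simp add: c_def)
  qed
  define A where "A = (\<lambda>j. {x \<in> ball x0 (r j). c j < u x})"
  have [measurable]: "A j \<in> sets borel" for j unfolding A_def by measurable
  define \<alpha> where "\<alpha> = (\<lambda>j. measure lborel (A j) / R powr n)"
  have A_fin: "emeasure lborel (A j) < \<infinity>" for j
  proof -
    have "emeasure lborel (A j) \<le> emeasure lborel (ball x0 (r j))" by (intro emeasure_mono) (auto simp: A_def)
    then show ?thesis using emeasure_lborel_ball_finite[of x0 "r j"] by (rule le_less_trans)
  qed
  have Rn: "0 < R powr n" using R by simp
  have A_eq: "emeasure lborel (A j) = ennreal (\<alpha> j * R powr n)" for j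
    using A_fin[of j] Rn by (simp add: \<alpha>_def emeasure_eq_ennreal_measure less_top)
  have \<alpha>0: "0 \<le> \<alpha> j" for j by (simp add: \<alpha>_def)
  have A_dec: "A (Suc j) \<subseteq> A j" for j
    using r_dec[of j] c_inc[of j] by (auto simp: A_def)
  have \<alpha>_dec: "\<alpha> (Suc j) \<le> \<alpha> j" for j
  proof -
    have "ennreal (\<alpha> (Suc j) * R powr n) \<le> ennreal (\<alpha> j * R powr n)"
      unfolding A_eq[symmetric] using A_dec by (intro emeasure_mono) auto
    then show ?thesis using Rn \<alpha>0 by (simp add: mult_nonneg_nonneg)
  qed
  have \<alpha>\<kappa>: "\<alpha> j \<le> \<kappa>" for j
  proof (induction j)
    case 0
    have "ennreal (\<alpha> 0 * R powr n) \<le> ennreal (\<kappa> * R powr n)"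
      using small unfolding A_eq[symmetric] by (simp add: A_def r0 c_def)
    then show ?case using Rn \<kappa>(1) by simp
  next
    case (Suc j)
    then show ?case using \<alpha>_dec[of j] by linarith
  qed
  define X where "X = (R / D) powr (n + q)"
  have X: "0 < X" using R D by (simp add: X_def)
  have rec: "\<alpha> (Suc j) \<le> (C6 * X) * b ^ j * \<alpha> j powr (1 + \<gamma>)" for j
  proof (cases "\<alpha> j = 0")
    case True
    then show ?thesis using \<alpha>_dec[of j] \<alpha>0[of "Suc j"] by simp
  next
    case False
    then have \<alpha>p: "0 < \<alpha> j" using \<alpha>0[of j] by simp
    define t where "t = 8 powr (- q) * (2 powr (- q)) ^ j"
    have t: "0 < t" by (simp add: t_def)
    have \<rho>j: "R / 4 \<le> r (Suc j)" "r j \<le> R / 2" using r_gt[of "Suc j"] r_le[of j] \<rho> by auto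
    have "emeasure lborel {x \<in> ball x0 (r (Suc j)). c j < u x} \<le> emeasure lborel (A j)"
      using r_dec[of j] by (intro emeasure_mono) (auto simp: A_def)
    then have sm: "emeasure lborel {x \<in> ball x0 (r (Suc j)). c j < u x} \<le> ennreal (\<alpha> j * R powr n)" by (simp add: A_eq)
    have "ennreal (C5 * (t * \<alpha> j powr (- \<gamma>) * G N)) * emeasure lborel (A (Suc j)) \<le> energy (r (Suc j)) (c j)"
      using energy_ge[OF \<rho>j(1) c_inc N0 c_diff \<alpha>p _ _ sm] \<alpha>\<kappa>[of j] \<kappa> by (simp add: A_def t_def)
    also have "\<dots> \<le> ennreal (C1 * (R / (r j - r (Suc j))) powr (n + q) * G N)
      * (emeasure lborel {x \<in> ball x0 (r j) - ball x0 (r (Suc j)). c j < u x}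
         + ennreal ((k / N) powr (p - 1)) * emeasure lborel {x \<in> ball x0 (r j). c j < u x})"
    proof (rule energy_le[OF c_nonneg \<rho>j(1) r_dec \<rho>j(2) N])
      show "AE x in lborel. x \<in> ball x0 (r j) \<longrightarrow> u x \<le> N"
        using uN by eventually_elim (use r_le[of j] in auto)
    qed
    also have "\<dots> \<le> ennreal (C1 * (R / (r j - r (Suc j))) powr (n + q) * G N) * (ennreal (\<alpha> j * R powr n) + 1 * ennreal (\<alpha> j * R powr n))"
    proof (intro mult_left_mono add_mono mult_mono)
      show "emeasure lborel {x \<in> ball x0 (r j) - ball x0 (r (Suc j)). c j < u x} \<le> ennreal (\<alpha> j * R powr n)"
        unfolding A_eq[symmetric] by (intro emeasure_mono) (auto simp: A_def)
      show "emeasure lborel {x \<in> ball x0 (r j). c j < u x} \<le> ennreal (\<alpha> j * R powr n)"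
        unfolding A_eq[symmetric] by (simp add: A_def)
      have "(k / N) powr (p - 1) \<le> 1" using k N N0 p by (intro powr_le1) auto
      then show "ennreal ((k / N) powr (p - 1)) \<le> 1" by simp
    qed auto
    also have "\<dots> = ennreal (C1 * (R / (r j - r (Suc j))) powr (n + q) * G N * (2 * (\<alpha> j * R powr n)))"
      using C1_pos G \<alpha>p R by (simp flip: ennreal_mult ennreal_plus)
    finally have "ennreal (C5 * (t * \<alpha> j powr (- \<gamma>) * G N) * (\<alpha> (Suc j) * R powr n))
        \<le> ennreal (C1 * (R / (r j - r (Suc j))) powr (n + q) * G N * (2 * (\<alpha> j * R powr n)))"
      unfolding A_eq using C5_pos t G \<alpha>0 by (simp add: ennreal_mult)
    then have "C5 * (t * \<alpha> j powr (- \<gamma>) * G N) * (\<alpha> (Suc j) * R powr n)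
        \<le> C1 * (R / (r j - r (Suc j))) powr (n + q) * G N * (2 * (\<alpha> j * R powr n))"
      using C1_pos G \<alpha>0 by (subst (asm) ennreal_le_iff) auto
    \<comment> \<open>\<open>G N\<close> and \<open>R powr n\<close> cancel: what remains involves
      neither the height nor the scale nor the coefficient.\<close>
    then have "C5 * t * \<alpha> j powr (- \<gamma>) * \<alpha> (Suc j) \<le> 2 * C1 * (R / (r j - r (Suc j))) powr (n + q) * \<alpha> j"
      using G Rn by (simp add: mult_ac)
    moreover have "\<alpha> j powr (- \<gamma>) = 1 / \<alpha> j powr \<gamma>" by (rule powr_minus_divide)
    ultimately have "\<alpha> (Suc j) \<le> 2 * C1 * (R / (r j - r (Suc j))) powr (n + q) * \<alpha> j * \<alpha> j powr \<gamma> / (C5 * t)"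
      using C5_pos t \<alpha>p by (simp add: field_simps)
    also have "(R / (r j - r (Suc j))) powr (n + q) = 4 powr (n + q) * X * (2 powr (n + q)) ^ j"
    proof -
      have "R / (r j - r (Suc j)) = 4 * (R / D) * 2 ^ j" using D by (simp add: r_diff)
      moreover have "(2 ^ j :: real) powr (n + q) = (2 powr (n + q)) ^ j"
        by (rule two_power_powr)
      ultimately show ?thesis by (simp only: powr_mult X_def)
    qed
    also have "2 * C1 * (4 powr (n + q) * X * (2 powr (n + q)) ^ j) * \<alpha> j * \<alpha> j powr \<gamma> / (C5 * t)
        = (C6 * X) * b ^ j * \<alpha> j powr (1 + \<gamma>)"
    proof -
      have "1 / t = 8 powr q * (2 powr q) ^ j"
        by (simp add: t_def powr_minus_divide power_divide field_simps)
      moreover have "\<alpha> j * \<alpha> j powr \<gamma> = \<alpha> j powr (1 + \<gamma>)" using \<alpha>p by (simp add: powr_add)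
      moreover have "2 * C1 * (4 powr (n + q) * X * (2 powr (n + q)) ^ j) * \<alpha> j * \<alpha> j powr \<gamma> / (C5 * t)
        = 2 * C1 * 4 powr (n + q) / C5 * X * (2 powr (n + q)) ^ j * (\<alpha> j * \<alpha> j powr \<gamma>) * (1 / t)" by simp
      ultimately show ?thesis by (simp add: C6_def b_def power_mult_distrib)
    qed
    finally show ?thesis .
  qed
  have "\<alpha> \<longlonglongrightarrow> 0"
    using \<alpha>0 C6_pos X b_gt_1 \<gamma> rec \<alpha>\<kappa>[of 0] \<kappa>(4)
    by (intro fast_geometric_convergence[of \<alpha> "C6 * X" b \<gamma>]) (auto simp: X_def D_def)
  then have "(\<lambda>j. ennreal (\<alpha> j * R powr n)) \<longlonglongrightarrow> ennreal (0 * R powr n)"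
    by (intro tendsto_ennrealI tendsto_intros)
  moreover have "emeasure lborel {x \<in> ball x0 \<rho>. 3 / 4 * N < u x} \<le> ennreal (\<alpha> j * R powr n)" for j
  proof -
    have "c j \<le> 3 / 4 * N" using N0 by (simp add: c_def)
    then show ?thesis unfolding A_eq[symmetric] using r_gt[of j] by (intro emeasure_mono) (auto simp: A_def)
  qed
  ultimately have "emeasure lborel {x \<in> ball x0 \<rho>. 3 / 4 * N < u x} \<le> 0"
    by (intro LIMSEQ_le_const) auto
  then have "AE x in lborel. x \<notin> {x \<in> ball x0 \<rho>. 3 / 4 * N < u x}"
    by (intro AE_not_in null_setsI) auto
  then show ?thesis by eventually_elim auto
qed


section \<open>Decay over nested balls\<close>

definition E :: real where "E = 2 * n + q + (n + q) / \<gamma>"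
text \<open>The first minimum serves the hypothesis \<open>small\<close> of
  \<open>absorption\<close>, the second the three conditions on \<open>\<kappa>\<close> in
  \<open>de_giorgi_iteration\<close>, divided by the constant \<open>C3\<close> that
  \<open>absorption\<close> puts in front. Likewise \<open>E\<close> adds the power
  \<open>2 * n + q\<close> lost in \<open>absorption\<close> to the power
  \<open>(n + q) / \<gamma>\<close> in the threshold of the iteration.\<close>

definition \<delta> :: real where
  "\<delta> = min (min 1 (V / (2 * 2 powr n * C2)))
    (min (min 1 (V / (4 powr n * 2 powr (n + 1)))) (C6 powr (- 1 / \<gamma>) * b powr (- 1 / \<gamma>\<^sup>2)) / C3)"

lemma E_pos: "n \<le> E" using n_ge_1 p \<gamma>(1) by (simp add: E_def)

lemma \<delta>: "0 < \<delta>" "\<delta> \<le> 1"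
  using V_pos C2_pos C3_pos C6_pos b_gt_1 by (auto simp: \<delta>_def)

lemma decay_step:
  assumes \<rho>: "R / 4 \<le> \<rho>" "\<rho> < \<rho>'" "\<rho>' \<le> R / 2"
    and N: "k \<le> N" "N \<le> M" and uN: "AE x in lborel. x \<in> ball x0 \<rho>' \<longrightarrow> u x \<le> N"
    and \<epsilon>: "(k / N) powr (p - 1) \<le> \<delta> * (R / (\<rho>' - \<rho>)) powr (- E)"
  shows "AE x in lborel. x \<in> ball x0 \<rho> \<longrightarrow> u x \<le> 3 / 4 * N"
proof -
  define \<epsilon>' where "\<epsilon>' = (k / N) powr (p - 1)"
  have e0: "0 \<le> \<epsilon>'" by (simp add: \<epsilon>'_def)
  define D where "D = \<rho>' - \<rho>"
  have D: "0 < D" "D \<le> R" using \<rho> R by (auto simp: D_def)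
  define X where "X = R / D"
  have X: "1 \<le> X" using D by (simp add: X_def)
  have e_le: "\<epsilon>' \<le> \<delta> * X powr (- E)" using \<epsilon> by (simp add: \<epsilon>'_def X_def D_def)
  have small: "C2 * \<epsilon>' * R powr n \<le> V * (D / 2) powr n / 2"
  proof -
    have "\<epsilon>' \<le> (V / (2 * 2 powr n * C2)) * X powr (- n)"
    proof -
      have "\<delta> \<le> V / (2 * 2 powr n * C2)"
        unfolding \<delta>_def by (rule order_trans[OF min.cobounded1 min.cobounded2])
      then have "\<delta> * X powr (- E) \<le> (V / (2 * 2 powr n * C2)) * X powr (- n)"
        using E_pos X V_pos C2_pos by (intro mult_mono powr_mono) auto
      then show ?thesis using e_le by linarith
    qed
    then have "C2 * \<epsilon>' * R powr n \<le> C2 * ((V / (2 * 2 powr n * C2)) * X powr (- n)) * R powr n"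
      using C2_pos by (intro mult_right_mono mult_left_mono) auto
    also have "\<dots> = V / (2 * 2 powr n) * (X powr (- n) * R powr n)" using C2_pos by simp
    also have "X powr (- n) * R powr n = D powr n"
      using R D by (simp add: X_def powr_minus powr_divide)
    also have "V / (2 * 2 powr n) * D powr n = V * (D / 2) powr n / 2" by (simp add: powr_divide)
    finally show ?thesis .
  qed
  define \<kappa> where "\<kappa> = C3 * X powr (2 * n + q) * \<epsilon>'"
  have abs: "emeasure lborel {x \<in> ball x0 ((\<rho> + \<rho>') / 2). N / 2 < u x} \<le> ennreal (\<kappa> * R powr n)"
    using absorption[OF \<rho> N uN] small by (simp add: \<kappa>_def X_def D_def \<epsilon>'_def)
  have "\<kappa> \<le> C3 * X powr (2 * n + q) * (\<delta> * X powr (- E))"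
    unfolding \<kappa>_def using e_le C3_pos by (intro mult_left_mono) auto
  also have "\<dots> = (C3 * \<delta>) * (X powr (2 * n + q) * X powr (- E))" by simp
  also have "X powr (2 * n + q) * X powr (- E) = X powr (- ((n + q) / \<gamma>))"
    by (simp add: E_def flip: powr_add)
  finally have \<kappa>_le: "\<kappa> \<le> (C3 * \<delta>) * X powr (- ((n + q) / \<gamma>))" .
  have "\<delta> \<le> min (min 1 (V / (4 powr n * 2 powr (n + 1)))) (C6 powr (- 1 / \<gamma>) * b powr (- 1 / \<gamma>\<^sup>2)) / C3"
    by (simp add: \<delta>_def)
  then have C3\<delta>: "C3 * \<delta> \<le> 1" "C3 * \<delta> \<le> V / (4 powr n * 2 powr (n + 1))"
    "C3 * \<delta> \<le> C6 powr (- 1 / \<gamma>) * b powr (- 1 / \<gamma>\<^sup>2)"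
    using C3_pos by (auto simp: field_simps)
  have X1: "X powr (- ((n + q) / \<gamma>)) \<le> 1"
    using X n_ge_1 p \<gamma>(1) powr_mono[of "- ((n + q) / \<gamma>)" 0 X] by simp
  have "(C3 * \<delta>) * X powr (- ((n + q) / \<gamma>)) \<le> (C3 * \<delta>) * 1"
    using X1 C3_pos \<delta> by (intro mult_left_mono) auto
  then have \<kappa>C: "\<kappa> \<le> C3 * \<delta>" using \<kappa>_le by simp
  show ?thesis
  proof (rule de_giorgi_iteration[OF \<rho> N uN abs])
    show "0 \<le> \<kappa>" using C3_pos e0 by (simp add: \<kappa>_def)
    show "\<kappa> \<le> 1" "\<kappa> \<le> V / (4 powr n * 2 powr (n + 1))" using \<kappa>C C3\<delta> by linarith+
    have "(C3 * \<delta>) * X powr (- ((n + q) / \<gamma>)) \<le> C6 powr (- 1 / \<gamma>) * b powr (- 1 / \<gamma>\<^sup>2) * X powr (- ((n + q) / \<gamma>))"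
      using C3\<delta> by (intro mult_right_mono) auto
    also have "\<dots> = (C6 * X powr (n + q)) powr (- 1 / \<gamma>) * b powr (- 1 / \<gamma>\<^sup>2)"
      by (simp add: powr_mult powr_powr)
    finally show "\<kappa> \<le> (C6 * (R / (\<rho>' - \<rho>)) powr (n + q)) powr (- 1 / \<gamma>) * b powr (- 1 / \<gamma>\<^sup>2)"
      using \<kappa>_le by (simp add: X_def D_def)
  qed
qed

text \<open>With \<open>m\<close> below, \<open>N \<ge> L * k * X powr m\<close> amounts to
  \<open>(k / N) powr (p - 1) \<le> \<delta> * X powr (- E)\<close>, the condition of
  \<open>decay_step\<close> solved for \<open>N\<close>.\<close>

definition L :: real where "L = \<delta> powr (- 1 / (p - 1))"
definition m :: real where "m = E / (p - 1)"

lemma L_ge_1: "1 \<le> L"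
proof -
  have "1 powr (- 1 / (p - 1)) \<le> L" unfolding L_def using \<delta> p by (intro powr_mono2') auto
  then show ?thesis by simp
qed

lemma m_pos: "0 < m" using E_pos n_ge_1 p by (simp add: m_def)

text \<open>A dichotomy: either the height is large enough for \<open>decay_step\<close>, or it is
  itself bounded by the added term. The height is first cut down to \<open>min N M\<close>, since
  only heights up to \<open>M\<close> admit the absorption of the coefficient.\<close>

lemma decay_step':
  assumes \<rho>: "R / 4 \<le> \<rho>" "\<rho> < \<rho>'" "\<rho>' \<le> R / 2"
    and uM: "AE x in lborel. x \<in> ball x0 (R / 2) \<longrightarrow> u x \<le> M"
    and uN: "AE x in lborel. x \<in> ball x0 \<rho>' \<longrightarrow> u x \<le> N"
    and N: "0 \<le> N" and M: "0 \<le> M"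
  shows "AE x in lborel. x \<in> ball x0 \<rho> \<longrightarrow> u x \<le> 3 / 4 * N + L * k * (R / (\<rho>' - \<rho>)) powr m"
proof -
  define N' where "N' = min N M"
  define X where "X = R / (\<rho>' - \<rho>)"
  have X: "1 \<le> X" using \<rho> R by (simp add: X_def)
  have Xm: "1 \<le> X powr m" using X m_pos ge_one_powr_ge_zero[of X m] by simp
  have uN': "AE x in lborel. x \<in> ball x0 \<rho>' \<longrightarrow> u x \<le> N'"
    using uM uN by eventually_elim (use \<rho> in \<open>auto simp: N'_def\<close>)
  show ?thesis
  proof (cases "L * k * X powr m \<le> N'")
    case True
    have Lk: "k \<le> L * k * X powr m" "0 < L * k * X powr m"
    proof -
      have "1 * 1 \<le> L * X powr m" using L_ge_1 Xm by (intro mult_mono) auto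
      then show "k \<le> L * k * X powr m" using k mult_right_mono[of 1 "L * X powr m" k] by (simp add: mult_ac)
      then show "0 < L * k * X powr m" using k by linarith
    qed
    then have kN: "k \<le> N'" "0 < N'" using True by linarith+
    have "k / N' \<le> k / (L * k * X powr m)"
      using k by (intro divide_left_mono[OF True _ mult_pos_pos[OF kN(2) Lk(2)]]) auto
    also have "\<dots> = 1 / (L * X powr m)" using k by simp
    finally have "(k / N') powr (p - 1) \<le> (1 / (L * X powr m)) powr (p - 1)"
      using k kN p by (intro powr_mono2) auto
    also have "\<dots> = \<delta> * X powr (- E)"
    proof -
      have "L powr (p - 1) = 1 / \<delta>" using \<delta> p unfolding L_def powr_powr by (simp add: powr_minus_divide)
      moreover have "(X powr m) powr (p - 1) = X powr E" using p unfolding powr_powr m_def by simp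
      ultimately show ?thesis using \<delta> by (simp add: powr_divide powr_mult powr_minus_divide)
    qed
    finally have "(k / N') powr (p - 1) \<le> \<delta> * (R / (\<rho>' - \<rho>)) powr (- E)" by (simp add: X_def)
    from decay_step[OF \<rho> kN(1) _ uN' this]
    have "AE x in lborel. x \<in> ball x0 \<rho> \<longrightarrow> u x \<le> 3 / 4 * N'" by (simp add: N'_def)
    then show ?thesis
    proof eventually_elim
      case (elim x)
      have "3 / 4 * N' \<le> 3 / 4 * N" by (simp add: N'_def)
      then show ?case using elim Lk(2) by (auto simp: X_def)
    qed
  next
    case False
    show ?thesis
      using uN' by eventually_elim (use False N \<rho> in \<open>auto simp: X_def\<close>)
  qed
qed

text \<open>The gaps between radii shrink by the factor \<open>\<theta>\<close>, so the added term
  grows by \<open>1 / \<theta> powr m = 7 / 6\<close> per step, slower than the gain: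
  \<open>3 / 4 * (7 / 6) = 7 / 8\<close>. The factor 8 in \<open>H\<close> closes the induction,
  because \<open>7 / 8 * H + H / 8 = H\<close>.\<close>

definition \<theta> :: real where "\<theta> = (6 / 7) powr (1 / m)"
definition H :: real where "H = 8 * L * (4 / (1 - \<theta>)) powr m"

lemma \<theta>: "0 < \<theta>" "\<theta> < 1"
  using m_pos powr_less_mono2[of "1 / m" "6 / 7" 1] by (auto simp: \<theta>_def)

lemma H_ge_1: "1 \<le> H"
proof -
  have "1 \<le> (4 / (1 - \<theta>)) powr m" using \<theta> m_pos by (intro ge_one_powr_ge_zero) auto
  then have "1 * 1 \<le> L * (4 / (1 - \<theta>)) powr m" using L_ge_1 by (intro mult_mono) auto
  then show ?thesis by (simp add: H_def)
qed

text \<open>Starting \<open>i\<close> radii further out with the crude bound \<open>M\<close> and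
  stepping inward multiplies \<open>M\<close> by \<open>(3 / 4) ^ i\<close>, while the added terms
  stay summable. All starting points lie in the ball of radius \<open>R / 2\<close>, so
  \<open>i\<close> can tend to infinity and \<open>M\<close> disappears.\<close>

theorem bounded_by_tail:
  assumes uM: "AE x in lborel. x \<in> ball x0 (R / 2) \<longrightarrow> u x \<le> M" and M: "0 \<le> M"
  shows "AE x in lborel. x \<in> ball x0 (R / 4) \<longrightarrow> u x \<le> H * k"
proof -
  define r where "r = (\<lambda>j::nat. R / 4 + (1 - \<theta> ^ j) * (R / 4))"
  have r: "R / 4 \<le> r j" "r j \<le> R / 2" "r j < r (Suc j)" for j
  proof -
    have "0 < \<theta> ^ j" "\<theta> ^ j \<le> 1" using \<theta> by (auto intro: power_le_one)
    then have "0 \<le> (1 - \<theta> ^ j) * (R / 4)" "(1 - \<theta> ^ j) * (R / 4) \<le> 1 * (R / 4)"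
      using R by (auto intro!: mult_nonneg_nonneg mult_right_mono simp del: mult_1)
    then show "R / 4 \<le> r j" "r j \<le> R / 2" using R unfolding r_def by linarith+
    have "\<theta> * \<theta> ^ j < 1 * \<theta> ^ j" using \<theta> \<open>0 < \<theta> ^ j\<close> by (intro mult_strict_right_mono) auto
    then show "r j < r (Suc j)" using R by (simp add: r_def)
  qed
  have r_ratio: "(R / (r (Suc j) - r j)) powr m = (4 / (1 - \<theta>)) powr m * (7 / 6) ^ j" for j
  proof -
    have "r (Suc j) - r j = \<theta> ^ j * (1 - \<theta>) * (R / 4)" by (simp add: r_def algebra_simps)
    moreover have "R / (\<theta> ^ j * (1 - \<theta>) * (R / 4)) = (4 / (1 - \<theta>)) * (1 / \<theta>) ^ j"
      using R \<theta> by (simp add: power_divide)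
    ultimately have "R / (r (Suc j) - r j) = (4 / (1 - \<theta>)) * (1 / \<theta>) ^ j" by (simp only:)
    moreover have "((1 / \<theta>) ^ i) powr m = ((1 / \<theta>) powr m) ^ i" for i :: nat
      by (induction i) (simp_all add: powr_mult powr_divide)
    moreover have "(1 / \<theta>) powr m = 7 / 6"
      using m_pos by (simp add: \<theta>_def powr_divide powr_powr)
    ultimately show ?thesis by (simp only: powr_mult)
  qed
  \<comment> \<open>The induction on \<open>i\<close> uses the statement at the next larger radius;
    hence \<open>j\<close> is arbitrary.\<close>
  have claim: "AE x in lborel. x \<in> ball x0 (r j) \<longrightarrow> u x \<le> (3 / 4) ^ i * M + H * k * (7 / 6) ^ j" for i j
  proof (induction i arbitrary: j)
    case 0
    have "0 \<le> H * k * (7 / 6) ^ j" using H_ge_1 k by simp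
    with uM show ?case using r[of j] by (auto elim!: eventually_mono)
  next
    case (Suc i)
    have "0 \<le> (3 / 4) ^ i * M + H * k * (7 / 6) ^ Suc j" using H_ge_1 k M by simp
    from decay_step'[OF r(1) r(3) r(2) uM Suc.IH this M]
    have "AE x in lborel. x \<in> ball x0 (r j) \<longrightarrow>
      u x \<le> 3 / 4 * ((3 / 4) ^ i * M + H * k * (7 / 6) ^ Suc j) + L * k * (R / (r (Suc j) - r j)) powr m" .
    also have "3 / 4 * ((3 / 4) ^ i * M + H * k * (7 / 6) ^ Suc j) + L * k * (R / (r (Suc j) - r j)) powr m
        = (3 / 4) ^ Suc i * M + H * k * (7 / 6) ^ j"
      unfolding r_ratio by (simp add: H_def algebra_simps)
    finally show ?case .
  qed
  have "AE x in lborel. \<forall>i. x \<in> ball x0 (R / 4) \<longrightarrow> u x \<le> (3 / 4) ^ i * M + H * k"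
    unfolding AE_all_countable using claim[of 0] by (simp add: r_def)
  then show ?thesis
  proof eventually_elim
    case (elim x)
    show ?case
    proof
      assume "x \<in> ball x0 (R / 4)"
      then have "u x \<le> (3 / 4) ^ i * M + H * k" for i using elim by blast
      moreover have "(\<lambda>i. (3 / 4) ^ i * M + H * k) \<longlonglongrightarrow> 0 * M + H * k"
        by (intro tendsto_intros LIMSEQ_power_zero) auto
      ultimately show "u x \<le> H * k" by (intro LIMSEQ_le_const[of _ "H * k"]) auto
    qed
  qed
qed

end

section \<open>The supercritical case\<close>

text \<open>Counts only the jumps from \<open>A\<close> to the complement of \<open>S\<close>. It
  starts the level-set recursion in \<open>morrey_bound\<close>, with \<open>S\<close> the set of
  values above \<open>c0\<close>, and drives each of its steps, with \<open>S\<close> a superlevel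
  set.\<close>

lemma seminorm_gap_le:
  fixes u :: "'a::euclidean_space \<Rightarrow> real" and A S :: "'a set"
  assumes [measurable]: "u \<in> borel_measurable borel" "A \<in> sets borel" "S \<in> sets borel"
    and A: "A \<subseteq> B" and B[measurable]: "B \<in> sets borel" and g: "0 \<le> g" "0 \<le> p"
    and gap: "\<And>x y. x \<in> A \<Longrightarrow> y \<in> B - S \<Longrightarrow> g \<le> \<bar>u x - u y\<bar>"
    and lower: "\<And>x. x \<in> A \<Longrightarrow> ennreal c \<le> (\<integral>\<^sup>+y\<in>B - S. ennreal (dist x y powr e) \<partial>lborel)" and c: "0 \<le> c"
  shows "ennreal (g powr p * c) * emeasure lborel A
    \<le> (\<integral>\<^sup>+x\<in>B. (\<integral>\<^sup>+y\<in>B. ennreal (\<bar>u x - u y\<bar> powr p * dist x y powr e) \<partial>lborel) \<partial>lborel)"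
proof (rule emeasure_mult_le_nn_integral)
  fix x assume x: "x \<in> A"
  have "ennreal (g powr p * c) = ennreal (g powr p) * ennreal c" using c by (simp add: ennreal_mult)
  also have "\<dots> \<le> ennreal (g powr p) * (\<integral>\<^sup>+y\<in>B - S. ennreal (dist x y powr e) \<partial>lborel)"
    using lower[OF x] by (intro mult_left_mono) auto
  also have "\<dots> = (\<integral>\<^sup>+y. ennreal (g powr p) * (ennreal (dist x y powr e) * indicator (B - S) y) \<partial>lborel)"
    by (rule nn_integral_cmult[symmetric]) measurable
  also have "\<dots> \<le> (\<integral>\<^sup>+y\<in>B. ennreal (\<bar>u x - u y\<bar> powr p * dist x y powr e) \<partial>lborel)"
  proof (intro nn_integral_mono)
    fix y
    show "ennreal (g powr p) * (ennreal (dist x y powr e) * indicator (B - S) y)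
      \<le> ennreal (\<bar>u x - u y\<bar> powr p * dist x y powr e) * indicator B y"
    proof (cases "y \<in> B - S")
      case True
      have "g powr p * dist x y powr e \<le> \<bar>u x - u y\<bar> powr p * dist x y powr e"
        using gap[OF x True] g by (intro mult_right_mono powr_mono2) auto
      then show ?thesis using True by (auto simp: ennreal_leI simp flip: ennreal_mult)
    qed simp
  qed
  finally show "ennreal (g powr p * c)
      \<le> (\<integral>\<^sup>+y\<in>B. ennreal (\<bar>u x - u y\<bar> powr p * dist x y powr e) \<partial>lborel) * indicator B x"
    using x A by (auto simp: indicator_def)
qed measurable

context caccioppoli_tail
begin

text \<open>\<open>d\<close> is half the proportion of the annulus volume taken as a reference, and
  \<open>lam\<close> makes the set where \<open>u > lam * k / 8\<close> fill at most the proportion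
  \<open>d\<close>. The power \<open>\<omega> powr p\<close> is the energy, in units of the level
  gap, below which the recursion starts under its threshold. None of these constants involves
  \<open>C\<close>, \<open>Cb\<close> or \<open>M\<close>, so that \<open>M\<close> and then
  \<open>Cb\<close> can be formed from them.\<close>

definition d :: real where "d = V / 4 powr n / 2"
definition lam :: real where "lam = max 1 ((C2 / d) powr (1 / (p - 1)))"
definition Q :: real where "Q = (2 powr (n + 1) / V) powr (- 1 - \<sigma> / n)"
definition \<omega> :: real where
  "\<omega> = (min 1 (d * min (min 1 (V / (2 powr n * 2 powr (n + 1))))
    ((2 powr p / Q) powr (- 1 / (\<sigma> / n - 1)) * (2 powr p) powr (- 1 / (\<sigma> / n - 1)\<^sup>2)))) powr (1 / p)"

lemma lam_ge_1: "1 \<le> lam" by (simp add: lam_def)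

lemma \<omega>_pos: "0 < \<omega>"
proof -
  have "0 < d" "0 < Q" using V_pos by (auto simp: d_def Q_def)
  then have "0 < min 1 (d * min (min 1 (V / (2 powr n * 2 powr (n + 1))))
    ((2 powr p / Q) powr (- 1 / (\<sigma> / n - 1)) * (2 powr p) powr (- 1 / (\<sigma> / n - 1)\<^sup>2)))"
    using V_pos by auto
  then show ?thesis unfolding \<omega>_def by simp
qed

text \<open>The fractional Morrey embedding by level sets, started from the annulus, on most of which
  \<open>u\<close> is below a multiple of \<open>k\<close>.\<close>

lemma morrey_bound:
  assumes n: "n < \<sigma>" and R1: "R \<le> 1" and W: "0 < W"
    and En: "(\<integral>\<^sup>+x\<in>ball x0 (R / 2). (\<integral>\<^sup>+y\<in>ball x0 (R / 2).
      ennreal (\<bar>u x - u y\<bar> powr p * dist x y powr (- (n + \<sigma>))) \<partial>lborel) \<partial>lborel) \<le> ennreal (W powr p)"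
  shows "AE x in lborel. x \<in> ball x0 (R / 2) \<longrightarrow> u x \<le> lam * k + 2 / \<omega> * W"
proof -
  define B where "B = ball x0 (R / 2)"
  have [measurable]: "B \<in> sets borel" by (simp add: B_def)
  define \<beta> where "\<beta> = \<sigma> / n - 1"
  have \<beta>: "0 < \<beta>" "\<sigma> / n = 1 + \<beta>" using n n_ge_1 by (auto simp: \<beta>_def)
  have d: "0 < d" using V_pos by (simp add: d_def)
  have Q: "0 < Q" using V_pos by (simp add: Q_def)
  define \<mu> where "\<mu> = min 1 (d * min (min 1 (V / (2 powr n * 2 powr (n + 1))))
    ((2 powr p / Q) powr (- 1 / \<beta>) * (2 powr p) powr (- 1 / \<beta>\<^sup>2)))"
  have \<mu>: "0 < \<mu>" "\<mu> \<le> 1" using d V_pos Q by (auto simp: \<mu>_def)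
  have \<mu>_le: "\<mu> / d \<le> 1" "\<mu> / d \<le> V / (2 powr n * 2 powr (n + 1))"
    "\<mu> / d \<le> (2 powr p / Q) powr (- 1 / \<beta>) * (2 powr p) powr (- 1 / \<beta>\<^sup>2)"
  proof -
    have "\<mu> \<le> d * min (min 1 (V / (2 powr n * 2 powr (n + 1))))
      ((2 powr p / Q) powr (- 1 / \<beta>) * (2 powr p) powr (- 1 / \<beta>\<^sup>2))" unfolding \<mu>_def by (rule min.cobounded2)
    then have "\<mu> / d \<le> min (min 1 (V / (2 powr n * 2 powr (n + 1))))
      ((2 powr p / Q) powr (- 1 / \<beta>) * (2 powr p) powr (- 1 / \<beta>\<^sup>2))" 
      unfolding pos_divide_le_eq[OF d] by (subst mult.commute)
    then show "\<mu> / d \<le> 1" "\<mu> / d \<le> V / (2 powr n * 2 powr (n + 1))"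
      "\<mu> / d \<le> (2 powr p / Q) powr (- 1 / \<beta>) * (2 powr p) powr (- 1 / \<beta>\<^sup>2)" by auto
  qed
  have \<omega>: "\<omega> = \<mu> powr (1 / p)" by (simp add: \<omega>_def \<mu>_def \<beta>_def)
  have \<omega>0: "0 < \<omega>" using \<mu> by (simp add: \<omega>)
  have \<omega>p: "\<omega> powr p = \<mu>" using \<mu> p by (simp add: \<omega> powr_powr)
  \<comment> \<open>The height at which the energy bound becomes the small multiple
    \<open>\<mu>\<close> of \<open>h powr p\<close>.\<close>
  define h where "h = W / \<omega>"
  have h: "0 < h" using W \<omega>0 by (simp add: h_def)
  have Wh: "W powr p = \<mu> * h powr p"
  proof -
    have "W = \<omega> * h" using \<omega>0 by (simp add: h_def)
    then show ?thesis by (simp add: powr_mult \<omega>p)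
  qed
  define c0 where "c0 = lam * k"
  have lam: "1 \<le> lam" by (simp add: lam_def)
  have kc: "k \<le> c0" using lam k by (simp add: c0_def)
  have Rn: "0 < R powr n" using R by simp
  have R\<sigma>: "R powr \<sigma> \<le> R powr n" using R R1 n by (intro powr_mono') auto
  have Zle: "emeasure lborel {x \<in> ball x0 (R / 2) - ball x0 (R / 4). c0 / 8 < u x} \<le> ennreal (d * R powr n)"
  proof -
    have "C2 * (k / c0) powr (p - 1) \<le> d"
    proof -
      have "k / c0 = 1 / lam" using k by (simp add: c0_def)
      moreover have "(C2 / d) powr (1 / (p - 1)) \<le> lam" by (simp add: lam_def)
      then have "((C2 / d) powr (1 / (p - 1))) powr (p - 1) \<le> lam powr (p - 1)"
        using p by (intro powr_mono2) auto
      then have "C2 / d \<le> lam powr (p - 1)" using p C2_pos d by (simp add: powr_powr)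
      ultimately show ?thesis using d lam by (simp add: powr_divide field_simps)
    qed
    then have "C2 * (k / c0) powr (p - 1) * R powr n \<le> d * R powr n" by (intro mult_right_mono) auto
    then show ?thesis using emeasure_annulus_le[OF kc] unfolding C2_def
      by (meson ennreal_leI order_trans)
  qed
  define Y where "Y = {x \<in> B. u x \<le> c0}"
  have [measurable]: "Y \<in> sets borel" unfolding Y_def by measurable
  \<comment> \<open>The annulus has proportion at least \<open>2 * d\<close>, and the values above
    \<open>c0 / 8\<close> there take at most \<open>d\<close>. This set of low values anchors the
    estimate in \<open>k\<close>.\<close>
  have Y: "ennreal (d * R powr n) \<le> emeasure lborel Y"
  proof -
    let ?Z = "{x \<in> ball x0 (R / 2) - ball x0 (R / 4). c0 / 8 < u x}"
    have "ennreal (V * (R / 4) powr n) \<le> emeasure lborel (ball x0 (R / 2) - ball x0 (R / 4))"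
    proof -
      have "emeasure lborel (ball x0 (R / 2) - ball x0 (R / 4)) = emeasure lborel (ball x0 (R / 2)) - emeasure lborel (ball x0 (R / 4))"
        using R emeasure_lborel_ball_finite[of x0 "R / 4"] by (intro emeasure_Diff) (auto simp: subset_iff)
      also have "\<dots> = ennreal (V * (R / 2) powr n - V * (R / 4) powr n)"
        using R V_pos by (simp add: emeasure_ball_V ennreal_minus)
      also have "ennreal (V * (R / 4) powr n) \<le> \<dots>"
      proof (rule ennreal_leI)
        have "(R / 4) powr n + (R / 4) powr n \<le> (R / 4 + R / 4) powr n"
          using R n_ge_1 by (intro powr_superadditive) auto
        then have "V * ((R / 4) powr n + (R / 4) powr n) \<le> V * (R / 2) powr n"
          using V_pos by (intro mult_left_mono) auto
        then show "V * (R / 4) powr n \<le> V * (R / 2) powr n - V * (R / 4) powr n" by (simp add: algebra_simps)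
      qed
      finally show ?thesis .
    qed
    also have "\<dots> \<le> emeasure lborel (Y \<union> ?Z)"
    proof (intro emeasure_mono subsetI)
      fix x assume "x \<in> ball x0 (R / 2) - ball x0 (R / 4)"
      then show "x \<in> Y \<union> ?Z" using kc k by (auto simp: Y_def B_def)
    qed measurable
    also have "\<dots> \<le> emeasure lborel Y + emeasure lborel ?Z" by (intro emeasure_subadditive) auto
    also have "\<dots> \<le> emeasure lborel Y + ennreal (d * R powr n)" using Zle by (intro add_left_mono)
    also have "V * (R / 4) powr n = d * R powr n + d * R powr n"
      by (simp add: d_def powr_divide)
    finally have "ennreal (d * R powr n) + ennreal (d * R powr n) \<le> ennreal (d * R powr n) + emeasure lborel Y"
      using d by (simp add: add.commute flip: ennreal_plus)
    then show ?thesis by (simp add: ennreal_add_left_cancel_le)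
  qed
  define c where "c = (\<lambda>j::nat. c0 + h + h * (1 - 1 / 2 ^ j))"
  define A where "A = (\<lambda>j. {x \<in> B. c j < u x})"
  have [measurable]: "A j \<in> sets borel" for j unfolding A_def by measurable
  have c_diff: "c (Suc j) - c j = h / 2 / 2 ^ j" for j by (simp add: c_def field_simps)
  have c_inc: "c j \<le> c (Suc j)" for j using c_diff[of j] h by (smt (verit) divide_pos_pos zero_less_power)
  define \<alpha> where "\<alpha> = (\<lambda>j. measure lborel (A j) / R powr n)"
  have A_fin: "emeasure lborel (A j) < \<infinity>" for j
  proof -
    have "emeasure lborel (A j) \<le> emeasure lborel (ball x0 (R / 2))" by (intro emeasure_mono) (auto simp: A_def B_def)
    then show ?thesis using emeasure_lborel_ball_finite[of x0 "R / 2"] by (rule le_less_trans)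
  qed
  have A_eq: "emeasure lborel (A j) = ennreal (\<alpha> j * R powr n)" for j
    using A_fin[of j] Rn by (simp add: \<alpha>_def emeasure_eq_ennreal_measure less_top)
  have \<alpha>0: "0 \<le> \<alpha> j" for j by (simp add: \<alpha>_def)
  have \<alpha>_dec: "\<alpha> (Suc j) \<le> \<alpha> j" for j
  proof -
    have "A (Suc j) \<subseteq> A j" using c_inc[of j] by (auto simp: A_def)
    then have "ennreal (\<alpha> (Suc j) * R powr n) \<le> ennreal (\<alpha> j * R powr n)"
      unfolding A_eq[symmetric] by (intro emeasure_mono) auto
    then show ?thesis using Rn \<alpha>0 by (simp add: mult_nonneg_nonneg)
  qed
  \<comment> \<open>Between \<open>A 0\<close> and \<open>Y\<close> the function jumps by at least
    \<open>h\<close> at distance less than \<open>R\<close>, which the energy permits only on a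
    small proportion.\<close>
  have \<alpha>_init: "\<alpha> 0 \<le> \<mu> / d"
  proof -
    have "ennreal (h powr p * (R powr (- (n + \<sigma>)) * (d * R powr n))) * emeasure lborel (A 0) \<le> ennreal (W powr p)"
    proof (rule order_trans[OF seminorm_gap_le[where S="- Y" and B=B] En[folded B_def]])
      show "h \<le> \<bar>u x - u y\<bar>" if "x \<in> A 0" "y \<in> B - - Y" for x y
        using that h by (auto simp: A_def Y_def c_def)
      show "ennreal (R powr (- (n + \<sigma>)) * (d * R powr n)) \<le> (\<integral>\<^sup>+y\<in>B - - Y. ennreal (dist x y powr (- (n + \<sigma>))) \<partial>lborel)"
        if x: "x \<in> A 0" for x
      proof -
        have "ennreal (R powr (- (n + \<sigma>)) * (d * R powr n)) \<le> ennreal (R powr (- (n + \<sigma>))) * emeasure lborel Y"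
          using Y d by (simp add: ennreal_mult mult_left_mono)
        also have "\<dots> \<le> (\<integral>\<^sup>+y\<in>B - - Y. ennreal (dist x y powr (- (n + \<sigma>))) \<partial>lborel)"
        proof (rule emeasure_mult_le_nn_integral)
          fix y assume y: "y \<in> Y"
          have "dist x y < R"
            using x y dist_triangle[of x y x0] by (simp add: A_def Y_def B_def dist_commute)
          moreover have "x \<noteq> y" using x y h by (auto simp: A_def Y_def c_def)
          ultimately have "R powr (- (n + \<sigma>)) \<le> dist x y powr (- (n + \<sigma>))"
            using n_ge_1 \<sigma> by (intro powr_mono2') auto
          then show "ennreal (R powr (- (n + \<sigma>))) \<le> ennreal (dist x y powr (- (n + \<sigma>))) * indicator (B - - Y) y"
            using y by (auto simp: Y_def intro: ennreal_leI)
        qed measurable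
        finally show ?thesis .
      qed
    qed (use h p d in \<open>auto simp: A_def\<close>)
    then have "ennreal (h powr p * (R powr (- (n + \<sigma>)) * (d * R powr n)) * (\<alpha> 0 * R powr n)) \<le> ennreal (W powr p)"
      unfolding A_eq using d \<alpha>0[of 0] by (subst ennreal_mult) auto
    then have "h powr p * (R powr (- (n + \<sigma>)) * (d * R powr n)) * (\<alpha> 0 * R powr n) \<le> \<mu> * h powr p"
      unfolding Wh using \<mu> by (subst (asm) ennreal_le_iff) auto
    then have "h powr p * ((R powr (- (n + \<sigma>)) * (d * R powr n)) * (\<alpha> 0 * R powr n)) \<le> h powr p * \<mu>"
      by (simp add: mult_ac)
    then have le: "(R powr (- (n + \<sigma>)) * (d * R powr n)) * (\<alpha> 0 * R powr n) \<le> \<mu>"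
      by (rule mult_left_le_imp_le) (use h in simp)
    have "R powr (- (n + \<sigma>)) * R powr n * R powr n = R powr n / R powr \<sigma>"
      using R by (simp add: powr_diff flip: powr_add)
    moreover have "1 \<le> R powr n / R powr \<sigma>" using R\<sigma> R by simp
    ultimately have "d * \<alpha> 0 * 1 \<le> d * \<alpha> 0 * (R powr (- (n + \<sigma>)) * R powr n * R powr n)"
      using d \<alpha>0[of 0] by (intro mult_left_mono) auto
    also have "\<dots> \<le> \<mu>" using le by (simp add: mult_ac)
    finally show ?thesis using d by (simp add: field_simps)
  qed
  have \<alpha>\<mu>: "\<alpha> j \<le> \<mu> / d" for j
  proof (induction j)
    case (Suc j)
    then show ?case using \<alpha>_dec[of j] by linarith
  qed (rule \<alpha>_init)
  \<comment> \<open>The energy bound does not improve with the level: \<open>W powr p\<close> is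
    used in every step. Superlinearity comes from the kernel integral alone, whose exponent
    \<open>\<sigma> / n = 1 + \<beta>\<close> exceeds 1.\<close>
  have rec: "\<alpha> (Suc j) \<le> (2 powr p / Q) * (2 powr p) ^ j * \<alpha> j powr (1 + \<beta>)" for j
  proof (cases "\<alpha> j = 0")
    case True
    then show ?thesis using \<alpha>_dec[of j] \<alpha>0[of "Suc j"] by simp
  next
    case False
    then have \<alpha>p: "0 < \<alpha> j" using \<alpha>0[of j] by simp
    define g where "g = h / 2 / 2 ^ j"
    have g: "0 < g" using h by (simp add: g_def)
    define mm where "mm = \<alpha> j * R powr n"
    have mm: "0 < mm" using \<alpha>p Rn by (simp add: mm_def)
    have mV: "mm \<le> V * (R / 2) powr n / 2 powr (n + 1)"
    proof -
      have "mm \<le> V / (2 powr n * 2 powr (n + 1)) * R powr n"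
        unfolding mm_def using \<alpha>\<mu>[of j] \<mu>_le by (intro mult_right_mono) auto
      then show ?thesis by (simp add: powr_divide)
    qed
    have "ennreal (g powr p * (Q * mm powr (- \<sigma> / n))) * emeasure lborel (A (Suc j)) \<le> ennreal (W powr p)"
    proof (rule order_trans[OF seminorm_gap_le[where S="{y. c j < u y}" and B=B] En[folded B_def]])
      show "g \<le> \<bar>u x - u y\<bar>" if "x \<in> A (Suc j)" "y \<in> B - {y. c j < u y}" for x y
        using that c_diff[of j] by (auto simp: A_def g_def)
      show "ennreal (Q * mm powr (- \<sigma> / n)) \<le> (\<integral>\<^sup>+y\<in>B - {y. c j < u y}. ennreal (dist x y powr (- (n + \<sigma>))) \<partial>lborel)"
        if x: "x \<in> A (Suc j)" for x
      proof -
        have xB: "x \<in> ball x0 (R / 2)" using x by (simp add: A_def B_def)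
        have S: "{y. c j < u y} \<in> sets borel" by measurable
        have "ball x0 (R / 2) \<inter> {y. c j < u y} = A j" by (auto simp: A_def B_def)
        then have Sm: "emeasure lborel (ball x0 (R / 2) \<inter> {y. c j < u y}) \<le> ennreal mm" by (simp add: A_eq mm_def)
        show ?thesis
          using nn_integral_dist_powr_Diff_ge[OF xB S Sm mm, of \<sigma>] mV \<sigma>
          by (simp add: B_def Q_def V_def n_def)
      qed
    qed (use g p Q in \<open>auto simp: A_def\<close>)
    then have "ennreal (g powr p * (Q * mm powr (- \<sigma> / n)) * (\<alpha> (Suc j) * R powr n)) \<le> ennreal (W powr p)"
      unfolding A_eq using Q \<alpha>0[of "Suc j"] by (subst ennreal_mult) auto
    then have le: "g powr p * (Q * mm powr (- \<sigma> / n)) * (\<alpha> (Suc j) * R powr n) \<le> \<mu> * h powr p"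
      unfolding Wh using \<mu> by (subst (asm) ennreal_le_iff) auto
    have gp: "h powr p = g powr p * (2 powr p * (2 powr p) ^ j)"
    proof -
      have "h = g * (2 * 2 ^ j)" by (simp add: g_def)
      then show ?thesis by (simp only: powr_mult two_power_powr)
    qed
    have mp: "mm powr (- \<sigma> / n) = 1 / (\<alpha> j powr (1 + \<beta>) * R powr \<sigma>)"
    proof -
      have "mm powr (- \<sigma> / n) = \<alpha> j powr (- (1 + \<beta>)) * R powr (- \<sigma>)"
      proof -
        have e1: "n * (- \<sigma> / n) = - \<sigma>" using n_ge_1 by simp
        have e2: "- \<sigma> / n = - (1 + \<beta>)" using \<beta>(2) by simp
        show ?thesis unfolding mm_def powr_mult powr_powr e1 unfolding e2 by (rule refl)
      qed
      also have "\<dots> = 1 / (\<alpha> j powr (1 + \<beta>) * R powr \<sigma>)"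
        unfolding powr_minus_divide[of "\<alpha> j"] powr_minus_divide[of R] by simp
      finally show ?thesis .
    qed
    have "g powr p * (Q * (1 / (\<alpha> j powr (1 + \<beta>) * R powr \<sigma>)) * (\<alpha> (Suc j) * R powr n))
        \<le> g powr p * (\<mu> * (2 powr p * (2 powr p) ^ j))"
      using le unfolding gp mp by (simp add: mult_ac)
    then have "Q * (1 / (\<alpha> j powr (1 + \<beta>) * R powr \<sigma>)) * (\<alpha> (Suc j) * R powr n) \<le> \<mu> * (2 powr p * (2 powr p) ^ j)"
      by (rule mult_left_le_imp_le) (use g in simp)
    also have "\<dots> \<le> 1 * (2 powr p * (2 powr p) ^ j)" using \<mu> by (intro mult_right_mono) auto
    finally have "\<alpha> (Suc j) * (R powr n / R powr \<sigma>) \<le> 2 powr p * (2 powr p) ^ j / Q * \<alpha> j powr (1 + \<beta>)"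
      using Q \<alpha>p R by (simp add: field_simps)
    moreover have "\<alpha> (Suc j) * 1 \<le> \<alpha> (Suc j) * (R powr n / R powr \<sigma>)"
      using R\<sigma> R \<alpha>0[of "Suc j"] by (intro mult_left_mono) auto
    ultimately show ?thesis by simp
  qed
  have "\<alpha> \<longlonglongrightarrow> 0"
  proof (rule fast_geometric_convergence[OF \<alpha>0 _ _ \<beta>(1) rec])
    show "\<alpha> 0 \<le> (2 powr p / Q) powr (- 1 / \<beta>) * (2 powr p) powr (- 1 / \<beta>\<^sup>2)"
      using \<alpha>_init \<mu>_le by linarith
  qed (use Q p in \<open>auto simp: gr_one_powr\<close>)
  then have "(\<lambda>j. ennreal (\<alpha> j * R powr n)) \<longlonglongrightarrow> ennreal (0 * R powr n)"
    by (intro tendsto_ennrealI tendsto_intros)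
  moreover have "emeasure lborel {x \<in> B. c0 + 2 * h < u x} \<le> ennreal (\<alpha> j * R powr n)" for j
  proof -
    have "c j \<le> c0 + 2 * h" using h by (simp add: c_def field_simps)
    then show ?thesis unfolding A_eq[symmetric] by (intro emeasure_mono) (auto simp: A_def)
  qed
  ultimately have "emeasure lborel {x \<in> B. c0 + 2 * h < u x} \<le> 0"
    by (intro LIMSEQ_le_const) auto
  then have "AE x in lborel. x \<notin> {x \<in> B. c0 + 2 * h < u x}"
    by (intro AE_not_in null_setsI) auto
  then show ?thesis by eventually_elim (auto simp: B_def c0_def h_def)
qed

end

section \<open>Minimizers\<close>

lemma AE_lborel_fst_snd:
  fixes P :: "'a::euclidean_space \<Rightarrow> bool"
  assumes "AE x in lborel. P x"
  shows "AE z in lborel. P (fst z) \<and> P (snd z)"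
proof -
  obtain N where N0: "\<And>x. x \<in> space lborel - N \<Longrightarrow> P x" "N \<in> null_sets lborel"
    using AE_E3[OF assms] by metis
  then have N: "\<And>x. x \<notin> N \<Longrightarrow> P x" by auto
  have [measurable]: "N \<in> sets borel" using N0 by auto
  have "(\<integral>\<^sup>+z. indicator N (fst z) \<partial>(lborel :: ('a \<times> 'a) measure)) = (\<integral>\<^sup>+x. \<integral>\<^sup>+y. indicator N x \<partial>(lborel :: 'a measure) \<partial>lborel)"
    by (subst nn_integral_lborel_pair) auto
  also have "\<dots> = 0"
  proof -
    have "AE x in lborel. (\<integral>\<^sup>+y. indicator N x \<partial>(lborel :: 'a measure)) = 0"
      using AE_not_in[OF N0(2)] by eventually_elim simp
    then show ?thesis by (subst nn_integral_0_iff_AE) auto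
  qed
  finally have "AE z in (lborel :: ('a \<times> 'a) measure). (indicator N (fst z) :: ennreal) = 0"
    by (subst (asm) nn_integral_0_iff_AE) (auto simp: borel_prod[symmetric])
  then have 1: "AE z in (lborel :: ('a \<times> 'a) measure). fst z \<notin> N"
    by eventually_elim (auto split: split_indicator_asm)
  from AE_lborel_swap[OF 1] have 2: "AE z in (lborel :: ('a \<times> 'a) measure). snd z \<notin> N" by simp
  from 1 2 show ?thesis by eventually_elim (use N in auto)
qed

lemma nn_integral_ball_pair:
  fixes f :: "'a::euclidean_space \<Rightarrow> 'a \<Rightarrow> real"
  assumes [measurable]: "(\<lambda>z. f (fst z) (snd z)) \<in> borel_measurable (borel \<Otimes>\<^sub>M borel)"
  shows "(\<integral>\<^sup>+z. ennreal (indicator (ball x0 r) (fst z) * indicator (ball x0 r) (snd z) * f (fst z) (snd z)) \<partial>lborel)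
    = (\<integral>\<^sup>+x\<in>ball x0 r. (\<integral>\<^sup>+y\<in>ball x0 r. ennreal (f x y) \<partial>lborel) \<partial>lborel)"
proof -
  have "(\<integral>\<^sup>+z. ennreal (indicator (ball x0 r) (fst z) * indicator (ball x0 r) (snd z) * f (fst z) (snd z)) \<partial>lborel)
    = (\<integral>\<^sup>+x. \<integral>\<^sup>+y. ennreal (indicator (ball x0 r) x * indicator (ball x0 r) y * f x y) \<partial>lborel \<partial>lborel)"
    by (subst nn_integral_lborel_pair) auto
  also have "\<dots> = (\<integral>\<^sup>+x\<in>ball x0 r. (\<integral>\<^sup>+y\<in>ball x0 r. ennreal (f x y) \<partial>lborel) \<partial>lborel)"
    by (intro nn_integral_cong) (auto split: split_indicator intro!: nn_integral_cong)
  finally show ?thesis .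
qed

lemma F_energy_cong_AE:
  assumes "AE x in lborel. u x = u' x"
  shows "F_energy p q Ksp Ktq a \<Omega> u = F_energy p q Ksp Ktq a \<Omega> u'"
  unfolding F_energy_def nn_integral_completion
  by (rule nn_integral_cong_AE, use AE_lborel_fst_snd[OF assms] in eventually_elim) (simp add: split_beta)

lemma A_space_cong_AE:
  assumes "AE x in lborel. u x = u' x" "u \<in> A_space s t p q a \<Omega>" "u' \<in> borel_measurable lebesgue"
  shows "u' \<in> A_space s t p q a \<Omega>"
proof -
  have "(\<integral>\<^sup>+x\<in>\<Omega>. ennreal (\<bar>u x\<bar> powr p) \<partial>lebesgue) = (\<integral>\<^sup>+x\<in>\<Omega>. ennreal (\<bar>u' x\<bar> powr p) \<partial>lebesgue)"
    unfolding nn_integral_completion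
    by (rule nn_integral_cong_AE, use assms(1) in eventually_elim) simp
  moreover have "(\<integral>\<^sup>+z\<in>C_dom \<Omega>. (case z of (x, y) \<Rightarrow> ennreal
         (\<bar>u x - u y\<bar> powr p / norm (x - y) powr (real CARD('a) + s * p)
          + a x y * (\<bar>u x - u y\<bar> powr q / norm (x - y) powr (real CARD('a) + t * q)))) \<partial>lebesgue)
     = (\<integral>\<^sup>+z\<in>C_dom \<Omega>. (case z of (x, y) \<Rightarrow> ennreal
         (\<bar>u' x - u' y\<bar> powr p / norm (x - y) powr (real CARD('a) + s * p)
          + a x y * (\<bar>u' x - u' y\<bar> powr q / norm (x - y) powr (real CARD('a) + t * q)))) \<partial>lebesgue)"
    unfolding nn_integral_completion
    by (rule nn_integral_cong_AE, use AE_lborel_fst_snd[OF assms(1)] in eventually_elim) (simp add: split_beta)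
  ultimately show ?thesis using assms(2,3) by (simp add: A_space_def)
qed

lemma is_minimizer_cong_AE:
  assumes ae: "AE x in lborel. u x = u' x" and min: "is_minimizer s t p q Ksp Ktq a \<Omega> u"
    and u': "u' \<in> borel_measurable lebesgue"
  shows "is_minimizer s t p q Ksp Ktq a \<Omega> u'"
proof -
  have "AE x in lebesgue. x \<notin> \<Omega> \<longrightarrow> v x = u x" if "AE x in lebesgue. x \<notin> \<Omega> \<longrightarrow> v x = u' x" for v
    using that AE_completion[OF ae] by eventually_elim simp
  then show ?thesis
    using min A_space_cong_AE[OF ae _ u'] F_energy_cong_AE[OF ae, of p q Ksp Ktq a \<Omega>]
    unfolding is_minimizer_def by auto
qed

lemma tail2_cong_AE:
  assumes "AE x in lborel. u x = u' x"
  shows "tail2 s t p q a r R (\<lambda>y. \<bar>u y\<bar>) x0 = tail2 s t p q a r R (\<lambda>y. \<bar>u' y\<bar>) x0"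
proof -
  have "(\<integral>\<^sup>+y\<in>UNIV - ball x0 r. ennreal (\<bar>\<bar>u y\<bar>\<bar> powr c * f y) \<partial>lborel)
      = (\<integral>\<^sup>+y\<in>UNIV - ball x0 r. ennreal (\<bar>\<bar>u' y\<bar>\<bar> powr c * f y) \<partial>lborel)" for c f
    by (rule nn_integral_cong_AE, use assms in eventually_elim) simp
  from this[of "p - 1" "\<lambda>y. 1 / norm (y - x0) powr (real CARD('a) + s * p)"]
    this[of "q - 1" "\<lambda>y. a _ y / norm (y - x0) powr (real CARD('a) + t * q)"]
  show ?thesis unfolding tail2_def nn_integral_completion by (simp add: mult_ac)
qed

text \<open>Sections of \<open>a\<close> need not be measurable, and \<^const>\<open>nn_integral\<close> is then a lower integral.\<close>

lemma nn_integral_cmult_le: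
  assumes c: "0 < c"
  shows "(\<integral>\<^sup>+x. ennreal c * f x \<partial>M) \<le> ennreal c * (\<integral>\<^sup>+x. f x \<partial>M)"
  unfolding nn_integral_def[of M "\<lambda>x. ennreal c * f x"]
proof (rule SUP_least)
  fix g assume "g \<in> {g. simple_function M g \<and> g \<le> (\<lambda>x. ennreal c * f x)}"
  then have g: "simple_function M g" "\<And>x. g x \<le> ennreal c * f x" by (auto simp: le_fun_def)
  have [measurable]: "g \<in> borel_measurable M" using g(1) by (rule borel_measurable_simple_function)
  have inv: "ennreal c * ennreal (1 / c) = 1" using c by (simp flip: ennreal_mult)
  have "integral\<^sup>S M g = (\<integral>\<^sup>+x. g x \<partial>M)" using g(1) by (simp add: nn_integral_eq_simple_integral)
  also have "\<dots> = (\<integral>\<^sup>+x. ennreal c * (ennreal (1 / c) * g x) \<partial>M)"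
    by (simp add: mult.assoc[symmetric] inv)
  also have "\<dots> = ennreal c * (\<integral>\<^sup>+x. ennreal (1 / c) * g x \<partial>M)" by (rule nn_integral_cmult) measurable
  also have "\<dots> \<le> ennreal c * (\<integral>\<^sup>+x. f x \<partial>M)"
  proof (intro mult_left_mono nn_integral_mono)
    fix x
    have "ennreal (1 / c) * g x \<le> ennreal (1 / c) * (ennreal c * f x)" using g(2) by (intro mult_left_mono) auto
    then show "ennreal (1 / c) * g x \<le> f x" by (simp add: mult.assoc[symmetric] inv mult.commute[of "ennreal (1 / c)" "ennreal c"])
  qed auto
  finally show "integral\<^sup>S M g \<le> ennreal c * (\<integral>\<^sup>+x. f x \<partial>M)" .
qed

text \<open>Outside the ball \<open>1 + norm y\<close> is at most \<open>c * norm (y - x0)\<close>,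
  so the weights centred at 0 and at \<open>x0\<close> are comparable there.\<close>

lemma tail_integral_le:
  fixes x0 :: "'a::euclidean_space"
  assumes r: "0 < r" and m: "0 \<le> m" and f0: "\<And>y. 0 \<le> f y"
  shows "(\<integral>\<^sup>+y\<in>UNIV - ball x0 r. ennreal (f y / norm (y - x0) powr m) \<partial>M)
    \<le> ennreal ((1 + (1 + norm x0) / r) powr m) * (\<integral>\<^sup>+y. ennreal (f y / (1 + norm y) powr m) \<partial>M)"
proof -
  define c where "c = 1 + (1 + norm x0) / r"
  have c: "0 < c" using r by (simp add: c_def add_pos_nonneg)
  have "(\<integral>\<^sup>+y\<in>UNIV - ball x0 r. ennreal (f y / norm (y - x0) powr m) \<partial>M)
    \<le> (\<integral>\<^sup>+y. ennreal (c powr m) * ennreal (f y / (1 + norm y) powr m) \<partial>M)"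
  proof (intro nn_integral_mono)
    fix y
    show "ennreal (f y / norm (y - x0) powr m) * indicator (UNIV - ball x0 r) y
      \<le> ennreal (c powr m) * ennreal (f y / (1 + norm y) powr m)"
    proof (cases "y \<in> ball x0 r")
      case False
      then have d: "r \<le> norm (y - x0)" by (simp add: dist_norm norm_minus_commute)
      have "1 + norm y \<le> 1 + norm x0 + norm (y - x0)"
        using norm_triangle_ineq[of x0 "y - x0"] by simp
      also have "\<dots> \<le> (1 + norm x0) * (norm (y - x0) / r) + norm (y - x0)"
        using d r mult_left_mono[of 1 "norm (y - x0) / r" "1 + norm x0"] by simp
      also have "\<dots> = c * norm (y - x0)" by (simp add: c_def algebra_simps)
      finally have "(1 + norm y) powr m \<le> (c * norm (y - x0)) powr m" using m by (intro powr_mono2) auto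
      then have "(1 + norm y) powr m \<le> c powr m * norm (y - x0) powr m" by (simp add: powr_mult)
      moreover have "0 < (1 + norm y) powr m" "0 < norm (y - x0) powr m"
        using d r norm_ge_zero[of y] by (auto simp: powr_gt_zero add_pos_nonneg) (metis add_pos_nonneg less_irrefl norm_ge_zero zero_less_one)
      ultimately have "1 / norm (y - x0) powr m \<le> c powr m / (1 + norm y) powr m" by (simp add: field_simps)
      then have "f y * (1 / norm (y - x0) powr m) \<le> f y * (c powr m / (1 + norm y) powr m)"
        using f0 by (intro mult_left_mono) auto
      then have "ennreal (f y / norm (y - x0) powr m) \<le> ennreal (c powr m * (f y / (1 + norm y) powr m))"
        by (intro ennreal_leI) (simp add: mult_ac)
      also have "\<dots> = ennreal (c powr m) * ennreal (f y / (1 + norm y) powr m)"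
        using f0 by (intro ennreal_mult) auto
      finally show ?thesis using False by (simp only: indicator_def) simp
    qed simp
  qed
  also have "\<dots> \<le> ennreal (c powr m) * (\<integral>\<^sup>+y. ennreal (f y / (1 + norm y) powr m) \<partial>M)"
    using c by (intro nn_integral_cmult_le) simp
  finally show ?thesis by (simp add: c_def)
qed

lemma tail2_finite:
  fixes u :: "real^'n \<Rightarrow> real"
  assumes "0 \<le> s * p" "0 \<le> t * q" and a0: "\<And>x y. 0 \<le> a x y"
    and u: "u \<in> tail_space s p" "u \<in> weighted_tail_space t q a \<Omega>" and sub: "ball x0 R \<subseteq> \<Omega>" and r: "0 < r"
  shows "tail2 s t p q a r R (\<lambda>y. \<bar>u y\<bar>) x0 < \<infinity>"
proof -
  define cp where "cp = (1 + (1 + norm x0) / r) powr (real CARD('n) + s * p)"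
  define cq where "cq = (1 + (1 + norm x0) / r) powr (real CARD('n) + t * q)"
  have "(\<integral>\<^sup>+y\<in>UNIV - ball x0 r. ennreal (\<bar>\<bar>u y\<bar>\<bar> powr (p - 1) / norm (y - x0) powr (real CARD('n) + s * p)) \<partial>lebesgue)
    \<le> ennreal cp * (\<integral>\<^sup>+y. ennreal (\<bar>\<bar>u y\<bar>\<bar> powr (p - 1) / (1 + norm y) powr (real CARD('n) + s * p)) \<partial>lebesgue)"
    unfolding cp_def using assms by (intro tail_integral_le) auto
  also have "\<dots> < \<infinity>" using u(1) by (simp add: tail_space_def ennreal_mult_less_top)
  finally have 1: "(\<integral>\<^sup>+y\<in>UNIV - ball x0 r. ennreal (\<bar>\<bar>u y\<bar>\<bar> powr (p - 1) / norm (y - x0) powr (real CARD('n) + s * p)) \<partial>lebesgue) < \<infinity>" .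
  define S where "S = (SUP x\<in>\<Omega>. \<integral>\<^sup>+y. ennreal
         (a x y * (\<bar>u y\<bar> powr (q - 1) / (1 + norm y) powr (real CARD('n) + t * q))) \<partial>lebesgue)"
  have "(SUP x\<in>ball x0 R. \<integral>\<^sup>+y\<in>UNIV - ball x0 r. ennreal
         (a x y * (\<bar>\<bar>u y\<bar>\<bar> powr (q - 1) / norm (y - x0) powr (real CARD('n) + t * q))) \<partial>lebesgue) \<le> ennreal cq * S"
  proof (rule SUP_least)
    fix x assume x: "x \<in> ball x0 R"
    have "(\<integral>\<^sup>+y\<in>UNIV - ball x0 r. ennreal ((a x y * \<bar>u y\<bar> powr (q - 1)) / norm (y - x0) powr (real CARD('n) + t * q)) \<partial>lebesgue)
      \<le> ennreal cq * (\<integral>\<^sup>+y. ennreal ((a x y * \<bar>u y\<bar> powr (q - 1)) / (1 + norm y) powr (real CARD('n) + t * q)) \<partial>lebesgue)"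
      unfolding cq_def using assms by (intro tail_integral_le) auto
    also have "\<dots> \<le> ennreal cq * S"
    proof (rule mult_left_mono)
      have "x \<in> \<Omega>" using x sub by blast
      then show "(\<integral>\<^sup>+y. ennreal ((a x y * \<bar>u y\<bar> powr (q - 1)) / (1 + norm y) powr (real CARD('n) + t * q)) \<partial>lebesgue) \<le> S"
        unfolding S_def by (intro SUP_upper2[of x]) auto
    qed simp
    finally show "(\<integral>\<^sup>+y\<in>UNIV - ball x0 r. ennreal
         (a x y * (\<bar>\<bar>u y\<bar>\<bar> powr (q - 1) / norm (y - x0) powr (real CARD('n) + t * q))) \<partial>lebesgue) \<le> ennreal cq * S" by simp
  qed
  also have "\<dots> < \<infinity>" using u(2) by (simp add: weighted_tail_space_def S_def ennreal_mult_less_top)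
  finally show ?thesis using 1 by (simp add: tail2_def)
qed

lemma tail2_leD:
  fixes u :: "real^'n \<Rightarrow> real"
  assumes T: "tail2 s t p q a r R (\<lambda>y. \<bar>u y\<bar>) x0 \<le> T"
  shows "(\<integral>\<^sup>+y\<in>UNIV - ball x0 r. ennreal
      (\<bar>u y\<bar> powr (p - 1) / norm (y - x0) powr (real CARD('n) + s * p)) \<partial>lborel) \<le> T"
    and "x \<in> ball x0 R \<Longrightarrow> (\<integral>\<^sup>+y\<in>UNIV - ball x0 r. ennreal
      (a x y * (\<bar>u y\<bar> powr (q - 1) / norm (y - x0) powr (real CARD('n) + t * q))) \<partial>lborel) \<le> T"
proof -
  define I where "I = (\<lambda>x. \<integral>\<^sup>+y\<in>UNIV - ball x0 r. ennreal
      (a x y * (\<bar>u y\<bar> powr (q - 1) / norm (y - x0) powr (real CARD('n) + t * q))) \<partial>lborel)"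
  have eq: "tail2 s t p q a r R (\<lambda>y. \<bar>u y\<bar>) x0 = (\<integral>\<^sup>+y\<in>UNIV - ball x0 r. ennreal
      (\<bar>u y\<bar> powr (p - 1) / norm (y - x0) powr (real CARD('n) + s * p)) \<partial>lborel) + (SUP x\<in>ball x0 R. I x)"
    unfolding tail2_def nn_integral_completion I_def abs_abs by (rule refl)
  show "(\<integral>\<^sup>+y\<in>UNIV - ball x0 r. ennreal
      (\<bar>u y\<bar> powr (p - 1) / norm (y - x0) powr (real CARD('n) + s * p)) \<partial>lborel) \<le> T"
    using T unfolding eq by (rule order_trans[rotated]) simp
  assume "x \<in> ball x0 R"
  then have "I x \<le> (SUP x\<in>ball x0 R. I x)" by (rule SUP_upper)
  also have "\<dots> \<le> T" using T unfolding eq by (rule order_trans[rotated]) simp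
  finally show "(\<integral>\<^sup>+y\<in>UNIV - ball x0 r. ennreal
      (a x y * (\<bar>u y\<bar> powr (q - 1) / norm (y - x0) powr (real CARD('n) + t * q))) \<partial>lborel) \<le> T"
    by (simp add: I_def)
qed

text \<open>\<open>A\<close> is an arbitrary real; that some coefficient satisfies the bound forces
  its sign. In the Hoelder case two points at positive distance are compared.\<close>

lemma coefficient_regularity_nonneg:
  fixes a :: "real^'n \<Rightarrow> real^'n \<Rightarrow> real"
  assumes "coefficient_regularity s t \<alpha> A a"
  shows "0 \<le> A"
proof (cases "s \<le> t")
  case True
  have "\<bar>a 1 0 - a 0 0\<bar> \<le> A * norm (1 :: real^'n) powr \<alpha>"
    using assms True unfolding coefficient_regularity_def by (metis add_0_right diff_0_right diff_self norm_zero)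
  moreover have "0 < norm (1 :: real^'n) powr \<alpha>" by simp
  ultimately show ?thesis by (smt (verit) abs_ge_zero mult_neg_pos)
next
  case False
  then have "\<bar>a 0 0\<bar> \<le> A" using assms by (simp add: coefficient_regularity_def)
  then show ?thesis by linarith
qed

text \<open>One bound for both regimes: a small oscillation from Hoelder continuity, or merely the
  sup norm when no regularity is assumed.\<close>

lemma coefficient_oscillation:
  assumes reg: "coefficient_regularity s t \<alpha> A a" and \<alpha>: "s \<le> t \<Longrightarrow> 0 < \<alpha>" and a0: "\<And>x y. 0 \<le> a x y"
    and xy: "x \<in> ball x0 r" "y \<in> ball x0 r" "x' \<in> ball x0 r" "y' \<in> ball x0 r"
  shows "a x y \<le> a x' y' + (if s \<le> t then A * (4 * r) powr \<alpha> else A)"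
proof (cases "s \<le> t")
  case True
  have "norm (x - x') \<le> 2 * r" "norm (y - y') \<le> 2 * r"
    using xy dist_triangle[of x x' x0] dist_triangle[of y y' x0] by (auto simp: dist_norm[symmetric] dist_commute)
  then have "(norm (x - x') + norm (y - y')) powr \<alpha> \<le> (4 * r) powr \<alpha>"
    using \<alpha>[OF True] by (intro powr_mono2) auto
  then have "A * (norm (x - x') + norm (y - y')) powr \<alpha> \<le> A * (4 * r) powr \<alpha>"
    using coefficient_regularity_nonneg[OF reg] by (intro mult_left_mono) auto
  moreover have "\<bar>a x y - a x' y'\<bar> \<le> A * (norm (x - x') + norm (y - y')) powr \<alpha>"
    using reg True by (simp add: coefficient_regularity_def)
  ultimately show ?thesis using True by auto
next
  case False
  then have "\<bar>a x y\<bar> \<le> A" using reg by (simp add: coefficient_regularity_def)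
  then show ?thesis using False a0[of x' y'] by simp
qed

text \<open>This excludes the value \<open>\<infinity>\<close> of \<^const>\<open>data_norm\<close> if \<open>s p \<le> n\<close>.\<close>

lemma minimizer_bounded_above:
  fixes u :: "real^'n \<Rightarrow> real" and s t p q \<Lambda> :: real
  assumes A1: "0 < s" "s < 1" "0 < t" "t < 1" "1 < p" "p \<le> q" and \<Lambda>: "1 \<le> \<Lambda>"
    and \<alpha>: "s \<le> t \<Longrightarrow> 0 < \<alpha>"
    and A5: "s * p < real CARD('n) \<Longrightarrow> q \<le> real CARD('n) * p / (real CARD('n) - s * p)"
    and sp: "s * p \<le> real CARD('n)"
    and \<Omega>: "open \<Omega>" and K: "comparable_kernel \<Lambda> (s * p) Ksp" "comparable_kernel \<Lambda> (t * q) Ktq"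
    and a: "coefficient \<Omega> a" and reg: "coefficient_regularity s t \<alpha> A a"
    and u: "u \<in> borel_measurable borel" and min: "is_minimizer s t p q Ksp Ktq a \<Omega> u"
    and tail: "\<And>R'. ball x0 R' \<subseteq> \<Omega> \<Longrightarrow> tail2 s t p q a r R' (\<lambda>y. \<bar>u y\<bar>) x0 < \<infinity>"
    and r: "0 < r" and sub: "closure (ball x0 r) \<subseteq> \<Omega>"
  shows "\<exists>M. AE x in lborel. x \<in> ball x0 r \<longrightarrow> u x \<le> M"
proof -
  define n where "n = real CARD('n)"
  have n: "1 \<le> n" by (simp add: n_def Suc_leI)
  have n_DIM: "real DIM(real^'n) = n" by (simp add: n_def)
  have q1: "1 < q" using A1 by simp
  have spq: "0 < s * p" "0 < t * q" using A1 by auto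
  have a0: "0 \<le> a x y" for x y using a by (simp add: coefficient_def)
  \<comment> \<open>The closed ball lies in the open set \<open>\<Omega>\<close>, so there is room
    for a radius \<open>r1 > r\<close>, as interior estimates require.\<close>
  obtain e where e: "0 < e" "(\<Union>x\<in>cball x0 r. ball x e) \<subseteq> \<Omega>"
    using compact_subset_open_imp_ball_epsilon_subset[OF compact_cball[of x0 r] \<Omega>] sub r by auto
  define r1 where "r1 = r + e / 2"
  have r1: "r < r1" using e by (simp add: r1_def)
  have B1: "ball x0 r1 \<subseteq> \<Omega>"
  proof
    fix y assume y: "y \<in> ball x0 r1"
    show "y \<in> \<Omega>"
    proof (cases "y \<in> cball x0 r")
      case True
      then have "y \<in> (\<Union>x\<in>cball x0 r. ball x e)" using e(1) by (intro UN_I[of y]) auto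
      then show ?thesis using e(2) by blast
    next
      case False
      then have d: "r < dist x0 y" by simp
      \<comment> \<open>The radial projection of \<open>y\<close> to the sphere of radius
        \<open>r\<close>.\<close>
      define z where "z = x0 + (r / dist x0 y) *\<^sub>R (y - x0)"
      have "dist x0 z = r" using d r by (auto simp: z_def dist_norm norm_minus_commute)
      moreover have "dist z y < e"
      proof -
        have "y - z = (1 - r / dist x0 y) *\<^sub>R (y - x0)" by (simp add: z_def algebra_simps)
        then have "dist z y = \<bar>1 - r / dist x0 y\<bar> * dist x0 y"
          by (simp add: dist_norm norm_minus_commute)
        also have "\<bar>1 - r / dist x0 y\<bar> = 1 - r / dist x0 y" 
        proof -
          have "0 < dist x0 y" using d r by linarith
          then show ?thesis using d by (intro abs_of_nonneg) (simp add: divide_le_eq)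
        qed
        also have "(1 - r / dist x0 y) * dist x0 y = dist x0 y - r"
        proof -
          have "dist x0 y \<noteq> 0" using d r by linarith
          then show ?thesis by (simp add: left_diff_distrib)
        qed
        also have "\<dots> < e" using y e by (simp add: r1_def)
        finally show ?thesis .
      qed
      ultimately have "y \<in> (\<Union>x\<in>cball x0 r. ball x e)" by (intro UN_I[of z]) auto
      then show ?thesis using e(2) by blast
    qed
  qed
  define a1 where "a1 = a x0 x0 + (if s \<le> t then A * (4 * r1) powr \<alpha> else A)"
  have x0: "x0 \<in> ball x0 r1" using r r1 by simp
  have ab: "0 \<le> a x y \<and> a x y \<le> a1" if "x \<in> ball x0 r1" "y \<in> ball x0 r1" for x y
    using coefficient_oscillation[OF reg \<alpha> a0 that x0 x0] a0 by (simp add: a1_def)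
  then have a1: "0 \<le> a1" using x0 order_trans by blast
  define T where "T = enn2real (tail2 s t p q a r r1 (\<lambda>y. \<bar>u y\<bar>) x0)"
  have T: "tail2 s t p q a r r1 (\<lambda>y. \<bar>u y\<bar>) x0 = ennreal T" "0 \<le> T"
    using tail[OF B1] by (auto simp: T_def)
  note Tpq = tail2_leD[where s=s and t=t and p=p and q=q and a=a and r=r and R=r1 and u=u and ?x0.0=x0,
      OF order_refl, unfolded T(1)]
  \<comment> \<open>For a qualitative bound the first phase alone provides the gain, so the lower
    bound of the coefficient is taken to be 0.\<close>
  have "minimizer_data s t p q \<Lambda> u x0 r r1 T 0 a1"
    unfolding minimizer_data_def
    by (intro exI conjI) (use \<Omega> K a u min r B1 ab T(2) Tpq in \<open>assumption | blast\<close>)+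
  then obtain C where C: "0 < C" and cl: "caccioppoli_class C p q (s * p) (t * q) 0 a1 T r r1 x0 u"
    using minimizer_caccioppoli_class[OF A1 \<Lambda>, where 'n='n] by blast
  \<comment> \<open>The Sobolev exponent if \<open>s * p < n\<close>, where (A5) gives
    \<open>q \<le> \<kappa>\<close>. In the borderline case every finite exponent is admissible, and
    \<open>q + 1\<close> is taken.\<close>
  obtain \<kappa> where \<kappa>: "p < \<kappa>" "q \<le> \<kappa>" "n * ((\<kappa> - p) / \<kappa>) \<le> s * p"
  proof (cases "s * p < n")
    case True
    define \<kappa> where "\<kappa> = n * p / (n - s * p)"
    have \<kappa>0: "0 < \<kappa>" using True n A1 by (simp add: \<kappa>_def)
    have eq: "\<kappa> * (n - s * p) = n * p" using True by (simp add: \<kappa>_def)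
    then have eq2: "n * (\<kappa> - p) = s * p * \<kappa>" by (simp add: algebra_simps)
    have "0 < s * p * \<kappa>" using spq(1) \<kappa>0 by (rule mult_pos_pos)
    then have "0 < n * (\<kappa> - p)" unfolding eq2 .
    then have "p < \<kappa>" using n zero_less_mult_pos[of n "\<kappa> - p"] by simp
    moreover have "q \<le> \<kappa>" using A5 True by (simp add: \<kappa>_def n_def)
    moreover have "n * ((\<kappa> - p) / \<kappa>) \<le> s * p" using eq2 \<kappa>0 by simp
    ultimately show ?thesis by (rule that)
  next
    case False
    then have "s * p = n" using sp by (simp add: n_def)
    moreover have "n * ((q + 1 - p) / (q + 1)) \<le> n * 1"
      using n A1 q1 by (intro mult_left_mono) (auto simp: field_simps)
    ultimately show ?thesis using A1 by (intro that[of "q + 1"]) auto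
  qed
  have "(\<integral>\<^sup>+x\<in>ball x0 r1. (\<integral>\<^sup>+y\<in>ball x0 r1.
      ennreal (\<bar>u x - u y\<bar> powr p * dist x y powr (- (n + s * p))) \<partial>lborel) \<partial>lborel) < \<infinity>"
  proof -
    have "(\<integral>\<^sup>+x\<in>ball x0 r1. (\<integral>\<^sup>+y\<in>ball x0 r1.
        ennreal (\<bar>u x - u y\<bar> powr p * dist x y powr (- (n + s * p))) \<partial>lborel) \<partial>lborel)
      = (\<integral>\<^sup>+z. ennreal (indicator (ball x0 r1) (fst z) * indicator (ball x0 r1) (snd z) *
          (\<bar>u (fst z) - u (snd z)\<bar> powr p * dist (fst z) (snd z) powr (- (n + s * p)))) \<partial>lborel)"
      by (rule nn_integral_ball_pair[symmetric]) (use u in measurable)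
    also have "\<dots> \<le> (\<integral>\<^sup>+z\<in>C_dom \<Omega>. (case z of (x, y) \<Rightarrow> ennreal
         (\<bar>u x - u y\<bar> powr p / norm (x - y) powr (real CARD('n) + s * p)
          + a x y * (\<bar>u x - u y\<bar> powr q / norm (x - y) powr (real CARD('n) + t * q)))) \<partial>lborel)"
    proof (intro nn_integral_mono)
      fix z :: "(real^'n) \<times> (real^'n)"
      obtain x y where z: "z = (x, y)" by (cases z)
      show "ennreal (indicator (ball x0 r1) (fst z) * indicator (ball x0 r1) (snd z) *
          (\<bar>u (fst z) - u (snd z)\<bar> powr p * dist (fst z) (snd z) powr (- (n + s * p))))
        \<le> (case z of (x, y) \<Rightarrow> ennreal
         (\<bar>u x - u y\<bar> powr p / norm (x - y) powr (real CARD('n) + s * p)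
          + a x y * (\<bar>u x - u y\<bar> powr q / norm (x - y) powr (real CARD('n) + t * q)))) * indicator (C_dom \<Omega>) z"
      proof (cases "x \<in> ball x0 r1 \<and> y \<in> ball x0 r1")
        case True
        then have "x \<in> \<Omega>" using B1 by blast
        then have "z \<in> C_dom \<Omega>" by (simp add: z C_dom_def)
        moreover have "\<bar>u x - u y\<bar> powr p * dist x y powr (- (n + s * p))
            = \<bar>u x - u y\<bar> powr p / norm (x - y) powr (real CARD('n) + s * p)"
          by (simp add: dist_norm n_def divide_inverse flip: powr_minus)
        ultimately show ?thesis using True a0[of x y] by (simp add: z ennreal_leI)
      qed (auto simp: z)
    qed
    also have "\<dots> < \<infinity>" using min by (simp add: is_minimizer_def A_space_def nn_integral_completion)
    finally show ?thesis .
  qed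
  then show ?thesis
    using caccioppoli_class_bounded_above[OF cl C r r1 A1(5,6) \<kappa>(2,1), unfolded n_DIM, OF \<kappa>(3)] spq a1 T(2) u by auto
qed

text \<open>The order of the constants matters. \<open>B1\<close> comes from the Morrey bound, whose
  constants precede \<open>Cb\<close>; then \<open>M = B1 * m0\<close> is fixed, from it
  \<open>Cb\<close>, and from that \<open>H\<close>. Only afterwards are the solution and the ball
  given, and the locale is instantiated with their \<open>am\<close>, \<open>a1\<close> and
  \<open>T\<close>.\<close>

lemma minimizer_sup_bound:
  fixes s t p q \<Lambda> \<alpha> A m0 :: real
  assumes A1: "0 < s" "s < 1" "0 < t" "t < 1" "1 < p" "p \<le> q" and \<Lambda>: "1 \<le> \<Lambda>"
    and le: "s \<le> t \<longrightarrow> 0 < \<alpha> \<and> t * q \<le> s * p + \<alpha>" and gt: "t < s \<longrightarrow> t * q \<le> s * p"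
    and m0: "0 < m0"
  shows "\<exists>C\<ge>1. \<forall>\<Omega> Ksp Ktq a (u :: real^'n \<Rightarrow> real) x0 R k.
    open \<Omega> \<longrightarrow> comparable_kernel \<Lambda> (s * p) Ksp \<longrightarrow> comparable_kernel \<Lambda> (t * q) Ktq \<longrightarrow>
    coefficient \<Omega> a \<longrightarrow> coefficient_regularity s t \<alpha> A a \<longrightarrow> u \<in> borel_measurable borel \<longrightarrow>
    is_minimizer s t p q Ksp Ktq a \<Omega> u \<longrightarrow> 0 < R \<longrightarrow> R \<le> 1 \<longrightarrow> ball x0 (2 * R) \<subseteq> \<Omega> \<longrightarrow> 0 < k \<longrightarrow>
    tail2 s t p q a (R / 4) (2 * R) (\<lambda>y. \<bar>u y\<bar>) x0 \<le> ennreal (h_fun s t p q a x0 (2 * R) k) \<longrightarrow>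
    (s * p \<le> real CARD('n) \<longrightarrow> (AE x in lborel. x \<in> ball x0 (2 * R) \<longrightarrow> u x \<le> m0)) \<longrightarrow>
    (real CARD('n) < s * p \<longrightarrow> (\<integral>\<^sup>+z\<in>ball x0 (2 * R) \<times> ball x0 (2 * R). (case z of (x, y) \<Rightarrow> ennreal
         (\<bar>u x - u y\<bar> powr p / norm (x - y) powr (real CARD('n) + s * p))) \<partial>lborel) \<le> ennreal (m0 powr p)) \<longrightarrow>
    (AE x in lborel. x \<in> ball x0 (R / 4) \<longrightarrow> u x \<le> C * k)"
proof -
  have \<alpha>: "s \<le> t \<Longrightarrow> 0 < \<alpha>" and gap_le: "s \<le> t \<Longrightarrow> t * q \<le> s * p + \<alpha>" and gap_gt: "t < s \<Longrightarrow> t * q \<le> s * p"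
    using le gt by auto
  define n where "n = real CARD('n)"
  have n_DIM: "real DIM(real^'n) = n" by (simp add: n_def)
  have spq: "0 < s * p" "s * p \<le> q" "0 < t * q" "t * q \<le> q"
    using A1 by (auto intro: order.trans[of _ p] simp: mult_le_cancel_right1)
  define \<sigma> where "\<sigma> = s * p"
  define \<tau> where "\<tau> = t * q"
  obtain C0 where C0: "0 < C0" and cacc: "\<And>(u :: real^'n \<Rightarrow> real) x0 r0 r1 T am a1.
    minimizer_data s t p q \<Lambda> u x0 r0 r1 T am a1 \<Longrightarrow> caccioppoli_class C0 p q \<sigma> \<tau> am a1 T r0 r1 x0 u"
    using minimizer_caccioppoli_class[OF A1 \<Lambda>, where 'n='n] unfolding \<sigma>_def \<tau>_def by blast
  \<comment> \<open>Chosen so that the oscillation \<open>b\<close> satisfies \<open>b * (2 * R)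
    powr (- \<tau>) \<le> Ab * (2 * R) powr (- \<sigma>)\<close>. If \<open>s \<le> t\<close>, the
    oscillation supplies \<open>R powr \<alpha>\<close>, and the remaining power of
    \<open>2 * R\<close> has the exponent \<open>\<alpha> + \<sigma> - \<tau>\<close>, nonnegative
    by the gap condition; \<open>R \<le> 1\<close> bounds it. If \<open>t < s\<close>, the exponent
    is \<open>\<sigma> - \<tau>\<close>.\<close>
  define Ab where "Ab = \<bar>A\<bar> * (if s \<le> t then 4 powr \<alpha> * 2 powr (\<alpha> + \<sigma> - \<tau>) else 2 powr (\<sigma> - \<tau>))"
  define B1 where "B1 = max 1 (caccioppoli_tail.lam TYPE(real^'n) p q + 2 / caccioppoli_tail.\<omega> TYPE(real^'n) p \<sigma>)"
  have B1: "1 \<le> B1" by (simp add: B1_def)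
  define M where "M = B1 * m0"
  have M: "0 < M" "m0 \<le> M" using m0 B1 by (auto simp: M_def mult_le_cancel_right1)
  \<comment> \<open>The bound on \<open>u\<close> enters here:
    \<open>N powr q \<le> M powr (q - p) * N powr p\<close> for \<open>N \<le> M\<close> turns the
    q-growth of the excess into p-growth.\<close>
  define Cb where "Cb = Ab * M powr (q - p)"
  have Cb: "0 \<le> Cb" by (simp add: Cb_def Ab_def)
  define H where "H = caccioppoli_tail.H TYPE(real^'n) p q \<sigma> \<tau> C0 Cb"
  have main: "AE x in lborel. x \<in> ball x0 (R / 4) \<longrightarrow> u x \<le> max B1 H * k"
    if \<Omega>: "open \<Omega>" and K: "comparable_kernel \<Lambda> (s * p) Ksp" "comparable_kernel \<Lambda> (t * q) Ktq"
    and a: "coefficient \<Omega> a" and reg: "coefficient_regularity s t \<alpha> A a"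
    and u[measurable]: "u \<in> borel_measurable borel" and min: "is_minimizer s t p q Ksp Ktq a \<Omega> u"
    and R: "0 < R" "R \<le> 1" and sub: "ball x0 (2 * R) \<subseteq> \<Omega>" and k: "0 < k"
    and tail: "tail2 s t p q a (R / 4) (2 * R) (\<lambda>y. \<bar>u y\<bar>) x0 \<le> ennreal (h_fun s t p q a x0 (2 * R) k)"
    and bd1: "s * p \<le> real CARD('n) \<Longrightarrow> AE x in lborel. x \<in> ball x0 (2 * R) \<longrightarrow> u x \<le> m0"
    and bd2: "real CARD('n) < s * p \<Longrightarrow> (\<integral>\<^sup>+z\<in>ball x0 (2 * R) \<times> ball x0 (2 * R). (case z of (x, y) \<Rightarrow> ennreal
         (\<bar>u x - u y\<bar> powr p / norm (x - y) powr (real CARD('n) + s * p))) \<partial>lborel) \<le> ennreal (m0 powr p)"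
    for \<Omega> Ksp Ktq a x0 R k and u :: "real^'n \<Rightarrow> real"
  proof -
    have a0: "0 \<le> a x y" for x y using a by (simp add: coefficient_def)
    define am where "am = a_minus a x0 (2 * R)"
    define b where "b = (if s \<le> t then A * (4 * (2 * R)) powr \<alpha> else A)"
    define a1 where "a1 = am + b"
    have A0: "0 \<le> A" using reg by (rule coefficient_regularity_nonneg)
    have b0: "0 \<le> b" using A0 by (simp add: b_def)
    have x0: "x0 \<in> ball x0 (2 * R)" using R by simp
    have am_le: "am \<le> a x y" if "x \<in> ball x0 (2 * R)" "y \<in> ball x0 (2 * R)" for x y
      unfolding am_def a_minus_def using that a0
      by (intro cINF_lower2[where x="(x, y)"]) (auto intro!: bdd_belowI2[of _ 0])
    have am_ge: "c \<le> am" if "\<And>x y. x \<in> ball x0 (2 * R) \<Longrightarrow> y \<in> ball x0 (2 * R) \<Longrightarrow> c \<le> a x y" for c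
      unfolding am_def a_minus_def using that x0 by (intro cINF_greatest) auto
    have am0: "0 \<le> am" using a0 by (intro am_ge)
    have a1_ge: "a x y \<le> a1" if "x \<in> ball x0 (2 * R)" "y \<in> ball x0 (2 * R)" for x y
    proof -
      have "a x y - b \<le> am"
      proof (rule am_ge)
        fix x' y' assume "x' \<in> ball x0 (2 * R)" "y' \<in> ball x0 (2 * R)"
        from coefficient_oscillation[OF reg \<alpha> a0 that this] show "a x y - b \<le> a x' y'"
          unfolding b_def by linarith
      qed
      then show ?thesis by (simp add: a1_def)
    qed
    have B: "ball x0 (R / 2) \<subseteq> ball x0 (2 * R)" using R by auto
    have tail_fin: "tail2 s t p q a (R / 4) (2 * R) (\<lambda>y. \<bar>u y\<bar>) x0 < \<infinity>"
      using tail by (rule le_less_trans) simp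
    define T where "T = enn2real (tail2 s t p q a (R / 4) (2 * R) (\<lambda>y. \<bar>u y\<bar>) x0)"
    have T: "tail2 s t p q a (R / 4) (2 * R) (\<lambda>y. \<bar>u y\<bar>) x0 = ennreal T" "0 \<le> T"
      using tail_fin by (auto simp: T_def)
    have h0: "0 \<le> h_fun s t p q a x0 (2 * R) k" using am0 by (simp add: h_fun_def am_def)
    have Tpq: "(\<integral>\<^sup>+y\<in>UNIV - ball x0 (R / 4). ennreal
        (\<bar>u y\<bar> powr (p - 1) / norm (y - x0) powr (real CARD('n) + s * p)) \<partial>lborel) \<le> ennreal T"
      "x \<in> ball x0 (2 * R) \<Longrightarrow> (\<integral>\<^sup>+y\<in>UNIV - ball x0 (R / 4). ennreal
        (a x y * (\<bar>u y\<bar> powr (q - 1) / norm (y - x0) powr (real CARD('n) + t * q))) \<partial>lborel) \<le> ennreal T" for x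
      using tail2_leD[where s=s and t=t and p=p and q=q and a=a and r="R / 4" and R="2 * R" and u=u and ?x0.0=x0,
          OF order_refl, unfolded T(1)] by blast+
    interpret ct: caccioppoli_tail p q \<sigma> \<tau> C0 Cb am a1 T R M k x0 u
    proof
      show "1 < p" "p \<le> q" "0 < \<sigma>" "\<sigma> \<le> q" "0 < \<tau>" "\<tau> \<le> q" "0 < C0" "0 \<le> Cb" "0 \<le> am" "0 \<le> a1" "0 < R" "0 \<le> T" "0 < k"
        using A1 spq C0 Cb am0 b0 R T k by (auto simp: \<sigma>_def \<tau>_def a1_def)
      show "u \<in> borel_measurable borel" by fact
      have "minimizer_data s t p q \<Lambda> u x0 (R / 4) (R / 2) T am a1"
        unfolding minimizer_data_def
      proof (intro exI conjI ballI)
        show "open \<Omega>" "comparable_kernel \<Lambda> (s * p) Ksp" "comparable_kernel \<Lambda> (t * q) Ktq" "coefficient \<Omega> a"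
          "u \<in> borel_measurable borel" "is_minimizer s t p q Ksp Ktq a \<Omega> u" by fact+
      qed (use R B sub am0 am_le a1_ge T Tpq in \<open>auto simp: subset_iff\<close>)
      then show "caccioppoli_class C0 p q \<sigma> \<tau> am a1 T (R / 4) (R / 2) x0 u" by (rule cacc)
      show "T \<le> k powr (p - 1) * (2 * R) powr (- \<sigma>) + am * (k powr (q - 1) * (2 * R) powr (- \<tau>))"
      proof -
        have "ennreal T \<le> ennreal (h_fun s t p q a x0 (2 * R) k)" using tail by (simp add: T(1))
        then have "T \<le> h_fun s t p q a x0 (2 * R) k" using h0 by simp
        then show ?thesis by (simp add: h_fun_def am_def \<sigma>_def \<tau>_def divide_inverse flip: powr_minus)
      qed
      show "a1 * (N powr q * (2 * R) powr (- \<tau>)) \<le> am * (N powr q * (2 * R) powr (- \<tau>)) + Cb * (N powr p * (2 * R) powr (- \<sigma>))"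
        if N: "0 < N" "N \<le> M" for N
      proof -
        have 1: "b * (2 * R) powr (- \<tau>) \<le> Ab * (2 * R) powr (- \<sigma>)"
        proof (cases "s \<le> t")
          case True
          have "(2 * R) powr (\<alpha> + \<sigma> - \<tau>) \<le> 2 powr (\<alpha> + \<sigma> - \<tau>)"
            using R gap_le[OF True] by (intro powr_mono2) (auto simp: \<sigma>_def \<tau>_def)
          then have "A * 4 powr \<alpha> * (2 * R) powr (\<alpha> + \<sigma> - \<tau>) * (2 * R) powr (- \<sigma>)
              \<le> A * 4 powr \<alpha> * 2 powr (\<alpha> + \<sigma> - \<tau>) * (2 * R) powr (- \<sigma>)"
            using A0 by (intro mult_right_mono mult_left_mono) auto
          moreover have "(2 * R) powr (\<alpha> + \<sigma> - \<tau>) * (2 * R) powr (- \<sigma>) = (2 * R) powr \<alpha> * (2 * R) powr (- \<tau>)"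
            by (simp flip: powr_add)
          moreover have "b = A * 4 powr \<alpha> * (2 * R) powr \<alpha>"
            using True by (simp only: b_def if_True powr_mult mult.assoc)
          ultimately show ?thesis using True A0 by (simp add: Ab_def mult.assoc)
        next
          case False
          have "(2 * R) powr (\<sigma> - \<tau>) \<le> 2 powr (\<sigma> - \<tau>)"
            using R gap_gt False by (intro powr_mono2) (auto simp: \<sigma>_def \<tau>_def)
          then have "A * (2 * R) powr (\<sigma> - \<tau>) * (2 * R) powr (- \<sigma>) \<le> A * 2 powr (\<sigma> - \<tau>) * (2 * R) powr (- \<sigma>)"
            using A0 by (intro mult_right_mono mult_left_mono) auto
          moreover have "(2 * R) powr (\<sigma> - \<tau>) * (2 * R) powr (- \<sigma>) = (2 * R) powr (- \<tau>)"
            by (simp flip: powr_add)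
          ultimately show ?thesis using False A0 by (simp add: Ab_def b_def mult.assoc)
        qed
        have 2: "N powr q \<le> M powr (q - p) * N powr p"
        proof -
          have "N powr q = N powr (q - p) * N powr p" by (simp flip: powr_add)
          also have "\<dots> \<le> M powr (q - p) * N powr p"
            using N A1 by (intro mult_right_mono powr_mono2) auto
          finally show ?thesis .
        qed
        have "N powr q * (b * (2 * R) powr (- \<tau>)) \<le> (M powr (q - p) * N powr p) * (Ab * (2 * R) powr (- \<sigma>))"
          by (rule mult_mono[OF 2 1]) (use b0 in auto)
        then show ?thesis by (simp add: a1_def Cb_def algebra_simps)
      qed
      \<comment> \<open>Chebyshev's inequality for each of the two tail integrals, on the annulus
        where \<open>norm (y - x0) \<le> R / 2\<close>; each is at most \<open>T\<close>, whence
        \<open>2 * T\<close>. The second is taken at the point \<open>x0\<close> of the supremum,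
        where \<open>a x0 y \<ge> am\<close>.\<close>
      show "ennreal (c powr (p - 1) * (R / 2) powr (- (real DIM(real^'n) + \<sigma>)) + am * (c powr (q - 1) * (R / 2) powr (- (real DIM(real^'n) + \<tau>))))
        * emeasure lborel {x \<in> ball x0 (R / 2) - ball x0 (R / 4). c < u x} \<le> ennreal (2 * T)" if c: "0 < c" for c
      proof -
        let ?Z = "{x \<in> ball x0 (R / 2) - ball x0 (R / 4). c < u x}"
        have pw: "c powr r * (R / 2) powr (- (n + e)) \<le> \<bar>u y\<bar> powr r / norm (y - x0) powr (n + e)"
          if y: "y \<in> ?Z" and re: "0 \<le> r" "0 \<le> e" for y r e
        proof -
          have d: "0 < norm (y - x0)" "norm (y - x0) \<le> R / 2"
            using y R by (auto simp: dist_norm norm_minus_commute)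
          have "(R / 2) powr (- (n + e)) \<le> norm (y - x0) powr (- (n + e))"
            using d re by (intro powr_mono2') (auto simp: n_def)
          moreover have "c powr r \<le> \<bar>u y\<bar> powr r" using y c re by (intro powr_mono2) auto
          ultimately have "c powr r * (R / 2) powr (- (n + e)) \<le> \<bar>u y\<bar> powr r * norm (y - x0) powr (- (n + e))"
            by (intro mult_mono) auto
          then show ?thesis unfolding powr_minus[of "norm (y - x0)"] by (simp only: divide_inverse)
        qed
        have "ennreal (c powr (p - 1) * (R / 2) powr (- (n + \<sigma>))) * emeasure lborel ?Z \<le> ennreal T"
        proof (rule order_trans[OF emeasure_mult_le_nn_integral Tpq(1)])
          fix y assume y: "y \<in> ?Z"
          then show "ennreal (c powr (p - 1) * (R / 2) powr (- (n + \<sigma>)))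
            \<le> ennreal (\<bar>u y\<bar> powr (p - 1) / norm (y - x0) powr (real CARD('n) + s * p)) * indicator (UNIV - ball x0 (R / 4)) y"
            using pw[OF y, of "p - 1" \<sigma>] A1 spq by (simp add: \<sigma>_def n_def ennreal_leI)
        qed measurable
        moreover have "ennreal (am * (c powr (q - 1) * (R / 2) powr (- (n + \<tau>)))) * emeasure lborel ?Z \<le> ennreal T"
        proof (rule order_trans[OF emeasure_mult_le_nn_integral Tpq(2)[OF x0]])
          fix y assume y: "y \<in> ?Z"
          then have "am \<le> a x0 y" using B by (intro am_le x0) auto
          moreover have "c powr (q - 1) * (R / 2) powr (- (n + \<tau>)) \<le> \<bar>u y\<bar> powr (q - 1) / norm (y - x0) powr (n + \<tau>)"
            using A1 spq by (intro pw[OF y]) (auto simp: \<tau>_def)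
          ultimately have "am * (c powr (q - 1) * (R / 2) powr (- (n + \<tau>))) \<le> a x0 y * (\<bar>u y\<bar> powr (q - 1) / norm (y - x0) powr (n + \<tau>))"
            by (rule mult_mono) (simp_all add: a0)
          then show "ennreal (am * (c powr (q - 1) * (R / 2) powr (- (n + \<tau>))))
            \<le> ennreal (a x0 y * (\<bar>u y\<bar> powr (q - 1) / norm (y - x0) powr (real CARD('n) + t * q))) * indicator (UNIV - ball x0 (R / 4)) y"
            using y by (simp add: \<tau>_def n_def ennreal_leI)
        qed measurable
        ultimately have "ennreal (c powr (p - 1) * (R / 2) powr (- (n + \<sigma>))) * emeasure lborel ?Z
            + ennreal (am * (c powr (q - 1) * (R / 2) powr (- (n + \<tau>)))) * emeasure lborel ?Z \<le> ennreal T + ennreal T"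
          by (rule add_mono)
        then show ?thesis using T(2) am0 unfolding n_DIM
          by (simp add: distrib_right[symmetric] flip: ennreal_plus)
      qed
    qed
    have H_bound: ?thesis if "AE x in lborel. x \<in> ball x0 (R / 2) \<longrightarrow> u x \<le> M"
    proof -
      have "H * k \<le> max B1 H * k" using k by (intro mult_right_mono) auto
      with ct.bounded_by_tail[OF that] M show ?thesis unfolding H_def by (auto elim!: eventually_mono)
    qed
    show ?thesis
    proof (cases "s * p \<le> n")
      case True
      have "AE x in lborel. x \<in> ball x0 (R / 2) \<longrightarrow> u x \<le> M"
        using bd1 True B M unfolding n_def by (auto elim!: eventually_mono)
      then show ?thesis by (rule H_bound)
    next
      case False
      have "(\<integral>\<^sup>+x\<in>ball x0 (R / 2). (\<integral>\<^sup>+y\<in>ball x0 (R / 2).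
          ennreal (\<bar>u x - u y\<bar> powr p * dist x y powr (- (n + \<sigma>))) \<partial>lborel) \<partial>lborel)
        = (\<integral>\<^sup>+z. ennreal (indicator (ball x0 (R / 2)) (fst z) * indicator (ball x0 (R / 2)) (snd z) *
          (\<bar>u (fst z) - u (snd z)\<bar> powr p * dist (fst z) (snd z) powr (- (n + \<sigma>)))) \<partial>lborel)"
        by (rule nn_integral_ball_pair[symmetric]) measurable
      also have "\<dots> \<le> (\<integral>\<^sup>+z\<in>ball x0 (2 * R) \<times> ball x0 (2 * R). (case z of (x, y) \<Rightarrow> ennreal
         (\<bar>u x - u y\<bar> powr p / norm (x - y) powr (real CARD('n) + s * p))) \<partial>lborel)"
      proof (intro nn_integral_mono)
        fix z :: "(real^'n) \<times> (real^'n)"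
        obtain x y where z: "z = (x, y)" by (cases z)
        show "ennreal (indicator (ball x0 (R / 2)) (fst z) * indicator (ball x0 (R / 2)) (snd z) *
            (\<bar>u (fst z) - u (snd z)\<bar> powr p * dist (fst z) (snd z) powr (- (n + \<sigma>))))
          \<le> (case z of (x, y) \<Rightarrow> ennreal (\<bar>u x - u y\<bar> powr p / norm (x - y) powr (real CARD('n) + s * p)))
            * indicator (ball x0 (2 * R) \<times> ball x0 (2 * R)) z"
        proof (cases "x \<in> ball x0 (R / 2) \<and> y \<in> ball x0 (R / 2)")
          case True
          then have "z \<in> ball x0 (2 * R) \<times> ball x0 (2 * R)" using B z by blast
          moreover have "\<bar>u x - u y\<bar> powr p * dist x y powr (- (n + \<sigma>))
              = \<bar>u x - u y\<bar> powr p / norm (x - y) powr (real CARD('n) + s * p)"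
            unfolding powr_minus dist_norm n_def \<sigma>_def by (simp only: divide_inverse)
          ultimately show ?thesis using True by (simp add: z)
        qed (auto simp: z)
      qed
      also have "\<dots> \<le> ennreal (m0 powr p)" using bd2 False by (simp add: n_def)
      finally have "AE x in lborel. x \<in> ball x0 (R / 2) \<longrightarrow> u x \<le> ct.lam * k + 2 / ct.\<omega> * m0"
      proof (intro ct.morrey_bound m0 R(2))
        show "ct.n < \<sigma>" using False by (simp add: \<sigma>_def n_def ct.n_def)
      qed (simp only: ct.n_def n_DIM)
      moreover have c: "0 \<le> ct.lam" "0 \<le> 2 / ct.\<omega>" using ct.lam_ge_1 ct.\<omega>_pos by auto
      have le: "ct.lam * k + 2 / ct.\<omega> * m0 \<le> B1 * max k m0"
      proof -
        have "ct.lam * k + 2 / ct.\<omega> * m0 \<le> ct.lam * max k m0 + 2 / ct.\<omega> * max k m0"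
          using c by (intro add_mono mult_left_mono) auto
        also have "\<dots> = (ct.lam + 2 / ct.\<omega>) * max k m0" by (simp add: distrib_right)
        also have "\<dots> \<le> B1 * max k m0" using k by (intro mult_right_mono) (auto simp: B1_def)
        finally show ?thesis .
      qed
      ultimately have uB: "AE x in lborel. x \<in> ball x0 (R / 2) \<longrightarrow> u x \<le> B1 * max k m0"
        by (auto elim!: eventually_mono)
      \<comment> \<open>If \<open>m0 \<le> k\<close>, the Morrey bound \<open>B1 * max k m0\<close>
        is already the claim. Otherwise it equals \<open>M\<close> and is the a priori bound that
        \<open>bounded_by_tail\<close> starts from.\<close>
      show ?thesis
      proof (cases "m0 \<le> k")
        case True
        have "B1 * k \<le> max B1 H * k" using k by (intro mult_right_mono) auto
        then show ?thesis using uB True R by (auto elim!: eventually_mono)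
      next
        case False
        then have "max k m0 = m0" by simp
        then show ?thesis using uB by (intro H_bound) (simp add: M_def)
      qed
    qed
  qed
  have "1 \<le> max B1 H" using B1 by simp
  then show ?thesis
    by (intro exI[of _ "max B1 H"] conjI allI impI, assumption, intro main) (assumption | blast)+
qed

section \<open>The inverse of h and the final estimate\<close>

lemma a_minus_nonneg:
  assumes "\<And>x y. 0 \<le> a x y" "0 < r"
  shows "0 \<le> a_minus a x0 r"
  unfolding a_minus_def using assms by (intro cINF_greatest) auto

lemma h_fun_mono:
  assumes "\<And>x y. 0 \<le> a x y" "0 < r" "1 < p" "1 < q" "0 \<le> \<tau>" "\<tau> \<le> \<tau>'"
  shows "h_fun s t p q a x0 r \<tau> \<le> h_fun s t p q a x0 r \<tau>'"
  unfolding h_fun_def using a_minus_nonneg[where a=a and ?x0.0=x0, OF assms(1,2)] assms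
  by (intro add_mono mult_left_mono divide_right_mono powr_mono2) auto

text \<open>The intermediate value theorem: \<open>h_fun\<close> vanishes at 0, and its first
  summand alone reaches \<open>T\<close> at \<open>\<tau>\<close>. Hence \<open>T\<close> is
  attained and \<open>inv_into\<close> is not a default value.\<close>

lemma h_inv_correct:
  assumes a0: "\<And>x y. 0 \<le> a x y" and r: "0 < r" and p: "1 < p" "1 < q" and T: "0 \<le> T"
  shows "0 \<le> h_inv s t p q a x0 r T" "h_fun s t p q a x0 r (h_inv s t p q a x0 r T) = T"
proof -
  let ?h = "h_fun s t p q a x0 r"
  define \<tau> where "\<tau> = (T * r powr (s * p)) powr (1 / (p - 1))"
  have "?h 0 = 0" using p by (simp add: h_fun_def)
  moreover have "T \<le> ?h \<tau>"
  proof -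
    have "\<tau> powr (p - 1) / r powr (s * p) = T" using p T r by (simp add: \<tau>_def powr_powr)
    moreover have "0 \<le> a_minus a x0 r * (\<tau> powr (q - 1) / r powr (t * q))"
      using a_minus_nonneg[where a=a and ?x0.0=x0, OF a0 r] by simp
    ultimately show ?thesis unfolding h_fun_def by linarith
  qed
  moreover have "continuous_on {0..\<tau>} ?h"
    unfolding h_fun_def using r p
    by (intro continuous_intros continuous_on_powr') auto
  moreover have "0 \<le> \<tau>" by (simp add: \<tau>_def)
  ultimately have "\<exists>x. 0 \<le> x \<and> x \<le> \<tau> \<and> ?h x = T" using T by (intro IVT') auto
  then have im: "T \<in> ?h ` {0..}" by auto
  show "0 \<le> h_inv s t p q a x0 r T" using inv_into_into[OF im] by (simp add: h_inv_def)
  show "?h (h_inv s t p q a x0 r T) = T" using f_inv_into_f[OF im] by (simp add: h_inv_def)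
qed

lemma AE_restrict_ball_iff:
  "(AE x in restrict_space lebesgue (ball x0 r). P x) \<longleftrightarrow> (AE x in lborel. x \<in> ball x0 r \<longrightarrow> P x)"
  for x0 :: "'a::euclidean_space"
  by (subst AE_restrict_space_iff) (auto simp: AE_completion_iff)

text \<open>What remains is a reduction: \<open>u\<close> is replaced by a Borel representative,
  which preserves minimality and tails, the data norm is converted into the real bound
  \<open>m0\<close>, and \<open>k\<close> is taken arbitrarily close to the inverse of h at the
  tail.\<close>

theorem corollary1p5:
  fixes s t p q \<Lambda> \<alpha> A :: real and M :: ennreal
  assumes dim: "2 \<le> CARD('n::finite)"
    and A1: "0 < s" "s < 1" "0 < t" "t < 1" "1 < p" "p \<le> q"
    and Lambda: "1 \<le> \<Lambda>"
    and alpha: "s \<le> t \<Longrightarrow> 0 < \<alpha> \<and> \<alpha> \<le> 1"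
    and A5: "s * p < real CARD('n) \<Longrightarrow> q \<le> real CARD('n) * p / (real CARD('n) - s * p)"
    and gap_le: "s \<le> t \<Longrightarrow> \<alpha> < t * q \<and> t * q \<le> s * p + \<alpha>"
    and gap_gt: "t < s \<Longrightarrow> t * q \<le> s * p"
  shows "\<exists>C\<ge>1. \<forall>(\<Omega> :: (real^'n) set) Ksp Ktq a u x0 R.
           open \<Omega> \<and> bounded \<Omega> \<and>
           comparable_kernel \<Lambda> (s * p) Ksp \<and> comparable_kernel \<Lambda> (t * q) Ktq \<and>
           coefficient \<Omega> a \<and> coefficient_regularity s t \<alpha> A a \<and>
           u \<in> A_space s t p q a \<Omega> \<inter> tail_space s p \<inter> weighted_tail_space t q a \<Omega> \<and>
           is_minimizer s t p q Ksp Ktq a \<Omega> u \<and>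
           0 < R \<and> R \<le> 1 \<and> closure (ball x0 (2 * R)) \<subseteq> \<Omega> \<and>
           (AE x in lebesgue. x \<in> ball x0 (2 * R) \<longrightarrow> 0 \<le> u x) \<and>
           data_norm s p (ball x0 (2 * R)) u = M
           \<longrightarrow>
           ess_sup_on (ball x0 (R / 4)) u
             \<le> ereal C * (ess_inf_on (ball x0 (R / 4)) u
                 + ereal (h_inv s t p q a x0 (2 * R)
                     (enn2real (tail2 s t p q a (R / 4) (2 * R) (\<lambda>y. \<bar>u y\<bar>) x0))))"
proof -
  define n where "n = real CARD('n)"
  \<comment> \<open>Adding 1 keeps \<open>m0\<close> positive also for \<open>M = 0\<close>. The
    default \<open>enn2real \<infinity> = 0\<close> does no harm, since the data norm of a minimizer
    is shown to be finite in both regimes.\<close>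
  define m0 where "m0 = enn2real M + 1"
  have m0: "0 < m0" by (simp add: m0_def add_nonneg_pos)
  have q1: "1 < q" using A1 by simp
  have \<alpha>: "s \<le> t \<Longrightarrow> 0 < \<alpha>" using alpha by simp
  have le: "s \<le> t \<longrightarrow> 0 < \<alpha> \<and> t * q \<le> s * p + \<alpha>" and gt: "t < s \<longrightarrow> t * q \<le> s * p"
    using alpha gap_le gap_gt by auto
  obtain C where C: "1 \<le> C" and sup_bound: "\<forall>\<Omega> Ksp Ktq a (u :: real^'n \<Rightarrow> real) x0 R k.
    open \<Omega> \<longrightarrow> comparable_kernel \<Lambda> (s * p) Ksp \<longrightarrow> comparable_kernel \<Lambda> (t * q) Ktq \<longrightarrow>
    coefficient \<Omega> a \<longrightarrow> coefficient_regularity s t \<alpha> A a \<longrightarrow> u \<in> borel_measurable borel \<longrightarrow>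
    is_minimizer s t p q Ksp Ktq a \<Omega> u \<longrightarrow> 0 < R \<longrightarrow> R \<le> 1 \<longrightarrow> ball x0 (2 * R) \<subseteq> \<Omega> \<longrightarrow> 0 < k \<longrightarrow>
    tail2 s t p q a (R / 4) (2 * R) (\<lambda>y. \<bar>u y\<bar>) x0 \<le> ennreal (h_fun s t p q a x0 (2 * R) k) \<longrightarrow>
    (s * p \<le> real CARD('n) \<longrightarrow> (AE x in lborel. x \<in> ball x0 (2 * R) \<longrightarrow> u x \<le> m0)) \<longrightarrow>
    (real CARD('n) < s * p \<longrightarrow> (\<integral>\<^sup>+z\<in>ball x0 (2 * R) \<times> ball x0 (2 * R). (case z of (x, y) \<Rightarrow> ennreal
         (\<bar>u x - u y\<bar> powr p / norm (x - y) powr (real CARD('n) + s * p))) \<partial>lborel) \<le> ennreal (m0 powr p)) \<longrightarrow>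
    (AE x in lborel. x \<in> ball x0 (R / 4) \<longrightarrow> u x \<le> C * k)"
    using minimizer_sup_bound[OF A1 Lambda le gt m0, of A, where 'n='n] by (elim exE conjE) (rule that)
  have main: "ess_sup_on (ball x0 (R / 4)) u
             \<le> ereal C * (ess_inf_on (ball x0 (R / 4)) u
                 + ereal (h_inv s t p q a x0 (2 * R)
                     (enn2real (tail2 s t p q a (R / 4) (2 * R) (\<lambda>y. \<bar>u y\<bar>) x0))))"
    if \<Omega>: "open \<Omega>" and K: "comparable_kernel \<Lambda> (s * p) Ksp" "comparable_kernel \<Lambda> (t * q) Ktq"
      and a: "coefficient \<Omega> a" and reg: "coefficient_regularity s t \<alpha> A a"
      and uA: "u \<in> A_space s t p q a \<Omega>" and ut: "u \<in> tail_space s p" "u \<in> weighted_tail_space t q a \<Omega>"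
      and min: "is_minimizer s t p q Ksp Ktq a \<Omega> u"
      and R: "0 < R" "R \<le> 1" and sub: "closure (ball x0 (2 * R)) \<subseteq> \<Omega>"
      and pos: "AE x in lebesgue. x \<in> ball x0 (2 * R) \<longrightarrow> 0 \<le> u x"
      and M: "data_norm s p (ball x0 (2 * R)) u = M"
    for \<Omega> :: "(real^'n) set" and Ksp Ktq a u x0 R
  proof -
    have a0: "0 \<le> a x y" for x y using a by (simp add: coefficient_def)
    have um: "u \<in> borel_measurable lebesgue" using uA by (simp add: A_space_def)
    obtain u' where u'[measurable]: "u' \<in> borel_measurable borel" and ae: "AE x in lborel. u x = u' x"
      using completion_ex_borel_measurable_real[of u lborel] um by auto
    have ae': "AE x in lborel. u' x = u x" using ae by eventually_elim simp
    have min': "is_minimizer s t p q Ksp Ktq a \<Omega> u'"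
      using u' by (intro is_minimizer_cong_AE[OF ae min] measurable_completion) simp
    have sub': "ball x0 (2 * R) \<subseteq> \<Omega>" using sub closure_subset by blast
    have tail_u: "tail2 s t p q a r R' (\<lambda>y. \<bar>u y\<bar>) x0 < \<infinity>" if "0 < r" "ball x0 R' \<subseteq> \<Omega>" for r R'
      using A1 ut that a0 by (intro tail2_finite) auto
    have tail_eq: "tail2 s t p q a r R' (\<lambda>y. \<bar>u' y\<bar>) x0 = tail2 s t p q a r R' (\<lambda>y. \<bar>u y\<bar>) x0" for r R'
      by (rule tail2_cong_AE[OF ae'])
    have bd1: "s * p \<le> real CARD('n) \<longrightarrow> (AE x in lborel. x \<in> ball x0 (2 * R) \<longrightarrow> u' x \<le> m0)"
    proof
      assume sp: "s * p \<le> real CARD('n)"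
      have "\<exists>b. AE x in lborel. x \<in> ball x0 (2 * R) \<longrightarrow> u' x \<le> b"
        by (rule minimizer_bounded_above[OF A1 Lambda \<alpha> A5 sp \<Omega> K a reg u' min' _ _ sub])
          (use R tail_u tail_eq in auto)
      then obtain b where b: "AE x in lborel. x \<in> ball x0 (2 * R) \<longrightarrow> u' x \<le> b" by blast
      have Me: "M = esssup (restrict_space lebesgue (ball x0 (2 * R))) (\<lambda>x. ennreal \<bar>u x\<bar>)"
        using M sp by (simp add: data_norm_def Linf_norm_def)
      have "M \<le> ennreal b"
        unfolding Me
      proof (rule esssup_I)
        show "(\<lambda>x. ennreal \<bar>u x\<bar>) \<in> borel_measurable (restrict_space lebesgue (ball x0 (2 * R)))"
          using um by (intro measurable_restrict_space1) measurable
        show "AE x in restrict_space lebesgue (ball x0 (2 * R)). ennreal \<bar>u x\<bar> \<le> ennreal b"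
          unfolding AE_restrict_ball_iff using b ae pos[unfolded AE_completion_iff]
          by eventually_elim (auto intro: ennreal_leI)
      qed
      then have fin: "M < \<infinity>" by (rule le_less_trans) simp
      have "AE x in lborel. x \<in> ball x0 (2 * R) \<longrightarrow> ennreal \<bar>u x\<bar> \<le> M"
        using esssup_AE[of "\<lambda>x. ennreal \<bar>u x\<bar>" "restrict_space lebesgue (ball x0 (2 * R))"]
        unfolding AE_restrict_ball_iff Me .
      then show "AE x in lborel. x \<in> ball x0 (2 * R) \<longrightarrow> u' x \<le> m0"
        using ae
      proof eventually_elim
        case (elim x)
        show ?case
        proof
          assume "x \<in> ball x0 (2 * R)"
          then have "ennreal \<bar>u x\<bar> \<le> ennreal (enn2real M)" using elim fin by simp
          then have "\<bar>u x\<bar> \<le> enn2real M" by simp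
          then show "u' x \<le> m0" using elim by (simp add: m0_def)
        qed
      qed
    qed
    have bd2: "real CARD('n) < s * p \<longrightarrow> (\<integral>\<^sup>+z\<in>ball x0 (2 * R) \<times> ball x0 (2 * R). (case z of (x, y) \<Rightarrow> ennreal
         (\<bar>u' x - u' y\<bar> powr p / norm (x - y) powr (real CARD('n) + s * p))) \<partial>lborel) \<le> ennreal (m0 powr p)"
    proof
      assume sp: "real CARD('n) < s * p"
      define I where "I = (\<integral>\<^sup>+z\<in>ball x0 (2 * R) \<times> ball x0 (2 * R). (case z of (x, y) \<Rightarrow> ennreal
         (\<bar>u x - u y\<bar> powr p / norm (x - y) powr (real CARD('n) + s * p))) \<partial>lebesgue)"
      have I': "(\<integral>\<^sup>+z\<in>ball x0 (2 * R) \<times> ball x0 (2 * R). (case z of (x, y) \<Rightarrow> ennreal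
         (\<bar>u' x - u' y\<bar> powr p / norm (x - y) powr (real CARD('n) + s * p))) \<partial>lborel) = I"
        unfolding I_def nn_integral_completion
        by (rule nn_integral_cong_AE, use AE_lborel_fst_snd[OF ae'] in eventually_elim) (simp add: split_beta)
      have "I \<le> (\<integral>\<^sup>+z\<in>C_dom \<Omega>. (case z of (x, y) \<Rightarrow> ennreal
         (\<bar>u x - u y\<bar> powr p / norm (x - y) powr (real CARD('n) + s * p)
          + a x y * (\<bar>u x - u y\<bar> powr q / norm (x - y) powr (real CARD('n) + t * q)))) \<partial>lebesgue)"
        unfolding I_def
      proof (intro nn_integral_mono)
        fix z :: "(real^'n) \<times> (real^'n)"
        obtain x y where z: "z = (x, y)" by (cases z)
        show "(case z of (x, y) \<Rightarrow> ennreal (\<bar>u x - u y\<bar> powr p / norm (x - y) powr (real CARD('n) + s * p)))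
            * indicator (ball x0 (2 * R) \<times> ball x0 (2 * R)) z
          \<le> (case z of (x, y) \<Rightarrow> ennreal (\<bar>u x - u y\<bar> powr p / norm (x - y) powr (real CARD('n) + s * p)
          + a x y * (\<bar>u x - u y\<bar> powr q / norm (x - y) powr (real CARD('n) + t * q)))) * indicator (C_dom \<Omega>) z"
        proof (cases "z \<in> ball x0 (2 * R) \<times> ball x0 (2 * R)")
          case True
          then have "x \<in> \<Omega>" using sub' z by blast
          then have "z \<in> C_dom \<Omega>" by (simp add: z C_dom_def)
          then show ?thesis using True a0[of x y] by (simp add: z ennreal_leI)
        qed simp
      qed
      also have "\<dots> < \<infinity>" using uA by (simp add: A_space_def)
      finally have Ifin: "I < \<infinity>" .
      then have "M = ennreal (enn2real I powr (1 / p))"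
        using M sp by (auto simp: data_norm_def Wsp_seminorm_def I_def[symmetric] Let_def split: if_splits)
      then have "enn2real M powr p = enn2real I" using A1 by (simp add: powr_powr)
      moreover have "enn2real M powr p \<le> m0 powr p" using A1 by (intro powr_mono2) (auto simp: m0_def)
      ultimately have "ennreal (enn2real I) \<le> ennreal (m0 powr p)" by (intro ennreal_leI) simp
      then show "(\<integral>\<^sup>+z\<in>ball x0 (2 * R) \<times> ball x0 (2 * R). (case z of (x, y) \<Rightarrow> ennreal
         (\<bar>u' x - u' y\<bar> powr p / norm (x - y) powr (real CARD('n) + s * p))) \<partial>lborel) \<le> ennreal (m0 powr p)"
        unfolding I' using Ifin by (simp only: ennreal_enn2real infinity_ennreal_def)
    qed
    define T where "T = enn2real (tail2 s t p q a (R / 4) (2 * R) (\<lambda>y. \<bar>u y\<bar>) x0)"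
    have T: "tail2 s t p q a (R / 4) (2 * R) (\<lambda>y. \<bar>u y\<bar>) x0 = ennreal T" "0 \<le> T"
      using tail_u[OF _ sub', of "R / 4"] R by (auto simp: T_def)
    define \<tau> where "\<tau> = h_inv s t p q a x0 (2 * R) T"
    have r2: "0 < 2 * R" using R by simp
    have \<tau>: "0 \<le> \<tau>" "h_fun s t p q a x0 (2 * R) \<tau> = T"
      using h_inv_correct[where a=a, OF a0 r2 A1(5) q1 T(2)] by (auto simp: \<tau>_def)
    \<comment> \<open>\<open>\<tau>\<close> may be 0, whereas the bound requires
      \<open>k > 0\<close>. Countably many positive shifts are used, so that their exceptional sets
      unite to a null set; monotonicity of \<open>h_fun\<close> makes them admissible.\<close>
    have "AE x in lborel. x \<in> ball x0 (R / 4) \<longrightarrow> u' x \<le> C * (\<tau> + 1 / real (Suc i))" for i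
    proof (rule sup_bound[rule_format, OF \<Omega> K a reg u' min' R sub'])
      show "0 < \<tau> + 1 / real (Suc i)" using \<tau> by (simp add: add_nonneg_pos)
      have "T \<le> h_fun s t p q a x0 (2 * R) (\<tau> + 1 / real (Suc i))"
        using h_fun_mono[where a=a and s=s and t=t and ?x0.0=x0 and \<tau>'="\<tau> + 1 / real (Suc i)", OF a0 r2 A1(5) q1 \<tau>(1)] \<tau>(2) by simp
      then show "tail2 s t p q a (R / 4) (2 * R) (\<lambda>y. \<bar>u' y\<bar>) x0 \<le> ennreal (h_fun s t p q a x0 (2 * R) (\<tau> + 1 / real (Suc i)))"
        unfolding tail_eq T(1) by (rule ennreal_leI)
    qed (use bd1 bd2 in blast)+
    then have "AE x in lborel. \<forall>i. x \<in> ball x0 (R / 4) \<longrightarrow> u' x \<le> C * (\<tau> + 1 / real (Suc i))"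
      unfolding AE_all_countable by blast
    then have u_le: "AE x in lborel. x \<in> ball x0 (R / 4) \<longrightarrow> u x \<le> C * \<tau>"
      using ae
    proof eventually_elim
      case (elim x)
      show ?case
      proof
        assume "x \<in> ball x0 (R / 4)"
        then have "u x \<le> C * (\<tau> + 1 / real (Suc i))" for i using elim by auto
        moreover have "(\<lambda>i. C * (\<tau> + 1 / real (Suc i))) \<longlonglongrightarrow> C * (\<tau> + 0)"
          by (intro tendsto_intros lim_1_over_real_power LIMSEQ_Suc[OF lim_1_over_n])
        ultimately have "u x \<le> C * (\<tau> + 0)" by (intro LIMSEQ_le_const[of _ "C * (\<tau> + 0)"]) auto
        then show "u x \<le> C * \<tau>" by simp
      qed
    qed
    have meas: "u \<in> borel_measurable (restrict_space lebesgue (ball x0 (R / 4)))"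
      using um by (rule measurable_restrict_space1)
    have "ess_sup_on (ball x0 (R / 4)) u \<le> ereal (C * \<tau>)"
      unfolding ess_sup_on_def
    proof (rule esssup_I)
      show "AE x in restrict_space lebesgue (ball x0 (R / 4)). ereal (u x) \<le> ereal (C * \<tau>)"
        unfolding AE_restrict_ball_iff using u_le by eventually_elim simp
    qed (use meas in measurable)
    also have "\<dots> = ereal C * ereal \<tau>" by simp
    also have "\<dots> \<le> ereal C * (ess_inf_on (ball x0 (R / 4)) u + ereal \<tau>)"
    proof (rule ereal_mult_left_mono)
      have "esssup (restrict_space lebesgue (ball x0 (R / 4))) (\<lambda>x. - ereal (u x)) \<le> 0"
      proof (rule esssup_I)
        show "AE x in restrict_space lebesgue (ball x0 (R / 4)). - ereal (u x) \<le> 0"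
          unfolding AE_restrict_ball_iff using pos[unfolded AE_completion_iff]
          by eventually_elim (use R in auto)
      qed (use meas in measurable)
      then have "0 \<le> ess_inf_on (ball x0 (R / 4)) u" by (simp add: ess_inf_on_def)
      then show "ereal \<tau> \<le> ess_inf_on (ball x0 (R / 4)) u + ereal \<tau>"
        using add_right_mono[of 0 "ess_inf_on (ball x0 (R / 4)) u" "ereal \<tau>"] by simp
    qed (use C in simp)
    finally show ?thesis by (simp add: \<tau>_def T_def)
  qed
  show ?thesis
    by (intro exI[of _ C] conjI allI impI, rule C, elim conjE IntE, rule main) assumption+
qed

end
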